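(* Let $A=\bigoplus_{i=0}^{\ell}A_i$ be a finitely graded algebra that is a commutative local ring and is Iwanaga-Gorenstein. Then $A$ is homologically well-graded.
   Context: Algebras are algebras over a commutative ring $\mathbf{k}$; modules are right modules. A finitely graded algebra is a graded algebra $A=\bigoplus_{i=0}^{\ell}A_i$ with $\ell=\max\{i\mid A_i\neq 0\}\geq 1$. $A$ is Iwanaga-Gorenstein (IG) if it is graded Noetherian and has finite graded self-injective dimension on both sides (equivalently, it is IG as an ungraded algebra; for commutative rings this is the usual Gorenstein condition with finite self-injective dimension). $\operatorname{Mod}^{\mathbb{Z}}A$ is the category of graded $A$-modules with degree-preserving homomorphisms, and $M(j)_i=M_{i+j}$. For $M,N\in\mathsf{D}(\operatorname{Mod}^{\mathbb{Z}}A)$ and $j\in\mathbb{Z}$ put $\mathbb{R}\mathrm{HOM}_A(M,N)_j:=\mathbb{R}\mathrm{Hom}_{\operatorname{Mod}^{\mathbb{Z}}A}(M,N(j))$. $A$ is right homologically well-graded (right hwg) if there is $i\in\mathbb{Z}$ with $\mathbb{R}\mathrm{HOM}_A(A_0,A)_j=0$ for all $j\neq i$, where $A_0=A/A_{\geq 1}$ is a graded $A$-module concentrated in degree $0$ (necessarily $i=\ell$); left hwg if $A^{\mathrm{op}}$ is right hwg; homologically well-graded (hwg) if it is both. *)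

theory Defs
  imports "HOL-Algebra.QuotRing" "HOL-Algebra.Module"
begin

section \<open>Graded abelian groups, rings and right modules\<close>

record ('r, 'm) graded_module = "('r, 'm) module" +
  component :: "int \<Rightarrow> 'm set"

text \<open>
  The same record type is used for graded algebras (all fields are meaningful) and for graded
  modules (the ring fields \<open>mult\<close> and \<open>one\<close> are irrelevant and never inspected).
\<close>

definition homogeneous_decomposition ::
  "('r, 'm, 'e) graded_module_scheme \<Rightarrow> 'm \<Rightarrow> (int \<Rightarrow> 'm) \<Rightarrow> bool" where
  "homogeneous_decomposition M x c \<longleftrightarrow>
     (\<forall>i. c i \<in> component M i) \<and> finite {i. c i \<noteq> \<zero>\<^bsub>M\<^esub>} \<and>
     x = (\<Oplus>\<^bsub>M\<^esub>i\<in>{i. c i \<noteq> \<zero>\<^bsub>M\<^esub>}. c i)"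

locale graded_group = abelian_group M
  for M :: "('r, 'm, 'e) graded_module_scheme" (structure) +
  assumes component_subgroup: "additive_subgroup (component M i) M"
    and unique_decomposition: "x \<in> carrier M \<Longrightarrow> \<exists>!c. homogeneous_decomposition M x c"

definition hpart :: "('r, 'm, 'e) graded_module_scheme \<Rightarrow> 'm \<Rightarrow> int \<Rightarrow> 'm" where
  "hpart M x = (THE c. homogeneous_decomposition M x c)"

locale graded_ring = ring A + graded_group A
  for A :: "('k, 'a, 'e) graded_module_scheme" (structure) +
  assumes component_mult:
      "\<lbrakk>a \<in> component A i; b \<in> component A j\<rbrakk> \<Longrightarrow> a \<otimes> b \<in> component A (i + j)"
    and one_component: "\<one> \<in> component A 0"

locale graded_algebra = module k A + graded_ring A
  for k :: "('k, 'f) ring_scheme" and A :: "('k, 'a, 'e) graded_module_scheme" +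
  assumes smult_mult_left: "\<lbrakk>c \<in> carrier k; a \<in> carrier A; b \<in> carrier A\<rbrakk> \<Longrightarrow>
      (c \<odot>\<^bsub>A\<^esub> a) \<otimes>\<^bsub>A\<^esub> b = c \<odot>\<^bsub>A\<^esub> (a \<otimes>\<^bsub>A\<^esub> b)"
    and smult_mult_right: "\<lbrakk>c \<in> carrier k; a \<in> carrier A; b \<in> carrier A\<rbrakk> \<Longrightarrow>
      a \<otimes>\<^bsub>A\<^esub> (c \<odot>\<^bsub>A\<^esub> b) = c \<odot>\<^bsub>A\<^esub> (a \<otimes>\<^bsub>A\<^esub> b)"
    and component_smult: "\<lbrakk>c \<in> carrier k; a \<in> component A i\<rbrakk> \<Longrightarrow> c \<odot>\<^bsub>A\<^esub> a \<in> component A i"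

locale finitely_graded_algebra = graded_algebra k A
  for k :: "('k, 'f) ring_scheme" and A :: "('k, 'a, 'e) graded_module_scheme" and l :: nat +
  assumes top_degree_pos: "1 \<le> l"
    and component_outside: "i < 0 \<or> int l < i \<Longrightarrow> component A i = {\<zero>\<^bsub>A\<^esub>}"
    and component_top: "component A (int l) \<noteq> {\<zero>\<^bsub>A\<^esub>}"

definition opposite ::
  "('k, 'a, 'e) graded_module_scheme \<Rightarrow> ('k, 'a, 'e) graded_module_scheme" where
  "opposite A = A\<lparr>mult := (\<lambda>x y. y \<otimes>\<^bsub>A\<^esub> x)\<rparr>"

text \<open>
  Modules are right modules: the term \<open>a \<odot>\<^bsub>M\<^esub> x\<close> stands for the product of \<open>x\<close> with the
  scalar \<open>a\<close> on the right, which is why \<open>act_assoc\<close> reverses the order of the factors.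
\<close>

locale graded_right_module = A: graded_ring A + graded_group M
  for A :: "('k, 'a, 'e) graded_module_scheme"
    and M :: "('a, 'm, 'g) graded_module_scheme" (structure) +
  assumes act_closed: "\<lbrakk>a \<in> carrier A; x \<in> carrier M\<rbrakk> \<Longrightarrow> a \<odot> x \<in> carrier M"
    and act_add_scalar: "\<lbrakk>a \<in> carrier A; b \<in> carrier A; x \<in> carrier M\<rbrakk> \<Longrightarrow>
      (a \<oplus>\<^bsub>A\<^esub> b) \<odot> x = a \<odot> x \<oplus> b \<odot> x"
    and act_add: "\<lbrakk>a \<in> carrier A; x \<in> carrier M; y \<in> carrier M\<rbrakk> \<Longrightarrow>
      a \<odot> (x \<oplus> y) = a \<odot> x \<oplus> a \<odot> y"
    and act_assoc: "\<lbrakk>a \<in> carrier A; b \<in> carrier A; x \<in> carrier M\<rbrakk> \<Longrightarrow>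
      (a \<otimes>\<^bsub>A\<^esub> b) \<odot> x = b \<odot> (a \<odot> x)"
    and act_one: "x \<in> carrier M \<Longrightarrow> \<one>\<^bsub>A\<^esub> \<odot> x = x"
    and act_component: "\<lbrakk>a \<in> component A i; x \<in> component M j\<rbrakk> \<Longrightarrow> a \<odot> x \<in> component M (j + i)"

definition gr_hom ::
  "('k, 'a, 'e) graded_module_scheme \<Rightarrow> ('a, 'm, 'f) graded_module_scheme \<Rightarrow>
   ('a, 'n, 'g) graded_module_scheme \<Rightarrow> ('m \<Rightarrow> 'n) set" where
  "gr_hom A M N = {f. f \<in> carrier M \<rightarrow> carrier N \<and>
     (\<forall>x\<in>carrier M. \<forall>y\<in>carrier M. f (x \<oplus>\<^bsub>M\<^esub> y) = f x \<oplus>\<^bsub>N\<^esub> f y) \<and>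
     (\<forall>a\<in>carrier A. \<forall>x\<in>carrier M. f (a \<odot>\<^bsub>M\<^esub> x) = a \<odot>\<^bsub>N\<^esub> f x) \<and>
     (\<forall>i. \<forall>x\<in>component M i. f x \<in> component N i)}"

definition gr_submodule ::
  "('k, 'a, 'e) graded_module_scheme \<Rightarrow> ('a, 'm, 'f) graded_module_scheme \<Rightarrow> 'm set \<Rightarrow> bool" where
  "gr_submodule A M N \<longleftrightarrow> additive_subgroup N M \<and>
     (\<forall>a\<in>carrier A. \<forall>x\<in>N. a \<odot>\<^bsub>M\<^esub> x \<in> N) \<and> (\<forall>x\<in>N. \<forall>i. hpart M x i \<in> N)"

definition shift ::
  "('a, 'm, 'f) graded_module_scheme \<Rightarrow> int \<Rightarrow> ('a, 'm, 'f) graded_module_scheme" where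
  "shift M j = M\<lparr>component := (\<lambda>i. component M (i + j))\<rparr>"

definition regular_module :: "('k, 'a, 'e) graded_module_scheme \<Rightarrow> ('a, 'a) graded_module" where
  "regular_module A = \<lparr>carrier = carrier A, mult = mult A, one = \<one>\<^bsub>A\<^esub>, zero = \<zero>\<^bsub>A\<^esub>,
     add = add A, smult = (\<lambda>a x. x \<otimes>\<^bsub>A\<^esub> a), component = component A\<rparr>"

text \<open>For an algebra graded in non-negative degrees, \<open>positive_part A\<close> is the ideal
  \<open>A\<^bsub>\<ge>1\<^esub>\<close>.\<close>

definition positive_part :: "('k, 'a, 'e) graded_module_scheme \<Rightarrow> 'a set" where
  "positive_part A = {x \<in> carrier A. \<forall>i\<le>0. hpart A x i = \<zero>\<^bsub>A\<^esub>}"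

definition degree_zero_module ::
  "('k, 'a, 'e) graded_module_scheme \<Rightarrow> ('a, 'a set) graded_module" where
  "degree_zero_module A =
     (let P = positive_part A; Q = A Quot P in
      \<lparr>carrier = carrier Q, mult = mult Q, one = \<one>\<^bsub>Q\<^esub>, zero = \<zero>\<^bsub>Q\<^esub>, add = add Q,
       smult = (\<lambda>a X. X \<otimes>\<^bsub>Q\<^esub> (P +>\<^bsub>A\<^esub> a)),
       component = (\<lambda>i. (\<lambda>x. P +>\<^bsub>A\<^esub> x) ` component A i)\<rparr>)"

section \<open>Injective resolutions and the derived Hom functor\<close>

text \<open>
  HOL does not quantify over types, so the monomorphisms tested here live on the type of the ring.
  This loses nothing: theorem \<open>gr_injective_extends\<close> below proves the lifting property
  for monomorphisms between graded modules over arbitrary types.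
\<close>

definition gr_injective ::
  "('k, 'a, 'e) graded_module_scheme \<Rightarrow> ('a, 'm, 'f) graded_module_scheme \<Rightarrow> bool" where
  "gr_injective A I \<longleftrightarrow> graded_right_module A I \<and>
     (\<forall>(X :: ('a, 'a) graded_module) (Y :: ('a, 'a) graded_module) f g.
        graded_right_module A X \<longrightarrow> graded_right_module A Y \<longrightarrow>
        f \<in> gr_hom A X Y \<longrightarrow> inj_on f (carrier X) \<longrightarrow> g \<in> gr_hom A X I \<longrightarrow>
        (\<exists>h\<in>gr_hom A Y I. \<forall>x\<in>carrier X. h (f x) = g x))"

definition injective_resolution ::
  "('k, 'a, 'e) graded_module_scheme \<Rightarrow> ('a, 'n, 'f) graded_module_scheme \<Rightarrow>
   (nat \<Rightarrow> ('a, 'c) graded_module) \<Rightarrow> (nat \<Rightarrow> 'c \<Rightarrow> 'c) \<Rightarrow> ('n \<Rightarrow> 'c) \<Rightarrow> bool" where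
  "injective_resolution A N I d e \<longleftrightarrow>
     (\<forall>n. gr_injective A (I n)) \<and> (\<forall>n. d n \<in> gr_hom A (I n) (I (Suc n))) \<and>
     e \<in> gr_hom A N (I 0) \<and> inj_on e (carrier N) \<and>
     {x \<in> carrier (I 0). d 0 x = \<zero>\<^bsub>I 1\<^esub>} = e ` carrier N \<and>
     (\<forall>n. {x \<in> carrier (I (Suc n)). d (Suc n) x = \<zero>\<^bsub>I (Suc (Suc n))\<^esub>} = d n ` carrier (I n))"

text \<open>
  The complex obtained by applying \<open>gr_hom A M\<close> to \<open>(I, d)\<close> has zero cohomology in every degree.
  Homomorphisms are compared on \<open>carrier M\<close>, since their values elsewhere are arbitrary.
\<close>

definition hom_complex_acyclic ::
  "('k, 'a, 'e) graded_module_scheme \<Rightarrow> ('a, 'm, 'f) graded_module_scheme \<Rightarrow>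
   (nat \<Rightarrow> ('a, 'c) graded_module) \<Rightarrow> (nat \<Rightarrow> 'c \<Rightarrow> 'c) \<Rightarrow> bool" where
  "hom_complex_acyclic A M I d \<longleftrightarrow>
     (\<forall>f\<in>gr_hom A M (I 0). (\<forall>x\<in>carrier M. d 0 (f x) = \<zero>\<^bsub>I 1\<^esub>) \<longrightarrow>
        (\<forall>x\<in>carrier M. f x = \<zero>\<^bsub>I 0\<^esub>)) \<and>
     (\<forall>n. \<forall>f\<in>gr_hom A M (I (Suc n)).
        (\<forall>x\<in>carrier M. d (Suc n) (f x) = \<zero>\<^bsub>I (Suc (Suc n))\<^esub>) \<longrightarrow>
        (\<exists>g\<in>gr_hom A M (I n). \<forall>x\<in>carrier M. f x = d n (g x)))"

text \<open>
  The derived Hom of graded modules \<open>M\<close>, \<open>N\<close> is represented by \<open>gr_hom A M\<close> applied to an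
  injective resolution of \<open>N\<close>; it is zero iff that complex is acyclic, and this does not depend on
  the resolution. The type argument \<open>'c\<close>, here and below, is the type on which the modules of the
  resolutions live. Requiring a resolution to exist keeps the predicates from holding vacuously
  for types that are too small.
\<close>

definition RHom_zero ::
  "'c itself \<Rightarrow> ('k, 'a, 'e) graded_module_scheme \<Rightarrow> ('a, 'm, 'f) graded_module_scheme \<Rightarrow>
   ('a, 'n, 'g) graded_module_scheme \<Rightarrow> bool" where
  "RHom_zero _ A M N \<longleftrightarrow>
     (\<exists>(I :: nat \<Rightarrow> ('a, 'c) graded_module) d e.
        injective_resolution A N I d e \<and> hom_complex_acyclic A M I d)"

definition finite_gr_injective_dimension ::
  "'c itself \<Rightarrow> ('k, 'a, 'e) graded_module_scheme \<Rightarrow> ('a, 'n, 'f) graded_module_scheme \<Rightarrow> bool" where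
  "finite_gr_injective_dimension _ A N \<longleftrightarrow>
     (\<exists>(I :: nat \<Rightarrow> ('a, 'c) graded_module) d e m.
        injective_resolution A N I d e \<and> (\<forall>n>m. carrier (I n) = {\<zero>\<^bsub>I n\<^esub>}))"

section \<open>Iwanaga-Gorenstein and homologically well-graded algebras\<close>

definition gr_noetherian ::
  "('k, 'a, 'e) graded_module_scheme \<Rightarrow> ('a, 'm, 'f) graded_module_scheme \<Rightarrow> bool" where
  "gr_noetherian A M \<longleftrightarrow>
     (\<forall>N :: nat \<Rightarrow> 'm set. (\<forall>n. gr_submodule A M (N n) \<and> N n \<subseteq> N (Suc n)) \<longrightarrow>
        (\<exists>m. \<forall>n\<ge>m. N n = N m))"

definition iwanaga_gorenstein ::
  "'c itself \<Rightarrow> ('k, 'a, 'e) graded_module_scheme \<Rightarrow> bool" where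
  "iwanaga_gorenstein C A \<longleftrightarrow>
     gr_noetherian A (regular_module A) \<and>
     gr_noetherian (opposite A) (regular_module (opposite A)) \<and>
     finite_gr_injective_dimension C A (regular_module A) \<and>
     finite_gr_injective_dimension C (opposite A) (regular_module (opposite A))"

definition right_hwg :: "'c itself \<Rightarrow> ('k, 'a, 'e) graded_module_scheme \<Rightarrow> bool" where
  "right_hwg C A \<longleftrightarrow>
     (\<exists>i. \<forall>j. j \<noteq> i \<longrightarrow> RHom_zero C A (degree_zero_module A) (shift (regular_module A) j))"

definition hwg :: "'c itself \<Rightarrow> ('k, 'a, 'e) graded_module_scheme \<Rightarrow> bool" where
  "hwg C A \<longleftrightarrow> right_hwg C A \<and> right_hwg C (opposite A)"

definition local_ring :: "('a, 'e) ring_scheme \<Rightarrow> bool" where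
  "local_ring R \<longleftrightarrow> cring R \<and> (\<exists>!m. maximalideal m R)"

section \<open>Injectivity tests on arbitrary types\<close>

context graded_group
begin

lemma component_carrier: "x \<in> component M i \<Longrightarrow> x \<in> carrier M"
  using additive_subgroup.a_Hcarr[OF component_subgroup] .

lemma hpart_decomposition:
  assumes "x \<in> carrier M" shows "homogeneous_decomposition M x (hpart M x)"
  unfolding hpart_def by (rule theI'[OF unique_decomposition[OF assms]])

lemma hpart_component: "x \<in> carrier M \<Longrightarrow> hpart M x i \<in> component M i"
  using hpart_decomposition unfolding homogeneous_decomposition_def by blast

lemma hpart_carrier: "x \<in> carrier M \<Longrightarrow> hpart M x i \<in> carrier M"
  using hpart_component component_carrier by blast

lemma zero_component: "\<zero> \<in> component M i"
  using additive_subgroup.zero_closed[OF component_subgroup] .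

lemma hpart_finite: "x \<in> carrier M \<Longrightarrow> finite {i. hpart M x i \<noteq> \<zero>}"
  using hpart_decomposition unfolding homogeneous_decomposition_def by blast

lemma hpart_sum:
  assumes "x \<in> carrier M" "finite S" "{i. hpart M x i \<noteq> \<zero>} \<subseteq> S"
  shows "x = (\<Oplus>i\<in>S. hpart M x i)"
proof -
  have "x = (\<Oplus>i\<in>{i. hpart M x i \<noteq> \<zero>}. hpart M x i)"
    using hpart_decomposition[OF assms(1)] unfolding homogeneous_decomposition_def by blast
  also have "\<dots> = (\<Oplus>i\<in>S. hpart M x i)"
    by (rule add.finprod_mono_neutral_cong_left) (use assms hpart_carrier in auto)
  finally show ?thesis .
qed

lemma hpart_eqI:
  assumes "finite S" "\<And>i. c i \<in> component M i" "\<And>i. i \<notin> S \<Longrightarrow> c i = \<zero>"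
    and "x = (\<Oplus>i\<in>S. c i)"
  shows "hpart M x = c"
proof -
  have cc: "c i \<in> carrier M" for i using assms(2) component_carrier by blast
  have sub: "{i. c i \<noteq> \<zero>} \<subseteq> S" using assms(3) by blast
  have "(\<Oplus>i\<in>{i. c i \<noteq> \<zero>}. c i) = (\<Oplus>i\<in>S. c i)"
    by (rule add.finprod_mono_neutral_cong_left) (use assms sub cc in auto)
  then have "homogeneous_decomposition M x c"
    unfolding homogeneous_decomposition_def
    using assms finite_subset[OF sub] by auto
  moreover have "x \<in> carrier M" using assms(4) cc by auto
  ultimately show ?thesis
    using hpart_decomposition unique_decomposition by blast
qed

lemma hpart_homogeneous:
  assumes "x \<in> component M i" shows "hpart M x = (\<lambda>j. if j = i then x else \<zero>)"
  by (rule hpart_eqI[of "{i}"]) (use assms zero_component component_carrier in auto)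

lemma hpart_add:
  assumes "x \<in> carrier M" "y \<in> carrier M"
  shows "hpart M (x \<oplus> y) i = hpart M x i \<oplus> hpart M y i"
proof -
  let ?S = "{i. hpart M x i \<noteq> \<zero>} \<union> {i. hpart M y i \<noteq> \<zero>}"
  have fin: "finite ?S" using assms hpart_finite by blast
  have "x \<oplus> y = (\<Oplus>i\<in>?S. hpart M x i) \<oplus> (\<Oplus>i\<in>?S. hpart M y i)"
    using hpart_sum[OF assms(1) fin] hpart_sum[OF assms(2) fin] by auto
  also have "\<dots> = (\<Oplus>i\<in>?S. hpart M x i \<oplus> hpart M y i)"
    using fin assms hpart_carrier by (subst finsum_addf) auto
  finally have "hpart M (x \<oplus> y) = (\<lambda>i. hpart M x i \<oplus> hpart M y i)"
    using assms hpart_component fin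
    by (intro hpart_eqI[of ?S]) (auto intro: additive_subgroup.a_closed[OF component_subgroup])
  then show ?thesis by simp
qed

lemma hpart_zero: "hpart M \<zero> i = \<zero>"
  using hpart_homogeneous[OF zero_component, of i] by simp

lemma hpart_sum_mem:
  assumes "x \<in> carrier M" "\<And>i. hpart M x i \<in> T" "\<zero> \<in> T" "\<And>a b. a \<in> T \<Longrightarrow> b \<in> T \<Longrightarrow> a \<oplus> b \<in> T"
    "T \<subseteq> carrier M"
  shows "x \<in> T"
proof -
  have "finite S \<Longrightarrow> (\<Oplus>i\<in>S. hpart M x i) \<in> T" for S
  proof (induction S rule: finite_induct)
    case (insert i S)
    then show ?case using assms by (subst finsum_insert) (auto simp: hpart_carrier)
  qed (use assms in auto)
  then show ?thesis
    using hpart_sum[OF assms(1) hpart_finite[OF assms(1)] order_refl] hpart_finite[OF assms(1)] by metis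
qed

end

lemma hpart_map:
  fixes M :: "('r, 'm, 'e) graded_module_scheme" and N :: "('s, 'n, 'f) graded_module_scheme"
  assumes "graded_group M" "graded_group N" and f: "f \<in> carrier M \<rightarrow> carrier N"
    and add: "\<And>x y. \<lbrakk>x \<in> carrier M; y \<in> carrier M\<rbrakk> \<Longrightarrow> f (x \<oplus>\<^bsub>M\<^esub> y) = f x \<oplus>\<^bsub>N\<^esub> f y"
    and comp: "\<And>i x. x \<in> component M i \<Longrightarrow> f x \<in> component N (i + s)"
    and x: "x \<in> carrier M"
  shows "hpart N (f x) (i + s) = f (hpart M x i)"
proof -
  interpret M: graded_group M by fact
  interpret N: graded_group N by fact
  have f0: "f \<zero>\<^bsub>M\<^esub> = \<zero>\<^bsub>N\<^esub>"
    using add[of "\<zero>\<^bsub>M\<^esub>" "\<zero>\<^bsub>M\<^esub>"] f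
    by (metis M.l_zero M.zero_closed N.add.l_cancel_one' PiE)
  have fs: "f (\<Oplus>\<^bsub>M\<^esub>i\<in>S. c i) = (\<Oplus>\<^bsub>N\<^esub>i\<in>S. f (c i))"
    if "finite S" "\<And>i. c i \<in> carrier M" for S and c :: "int \<Rightarrow> 'm"
    using that(1)
  proof (induction S rule: finite_induct)
    case (insert i S)
    have "\<And>i. f (c i) \<in> carrier N" using f that(2) by blast
    with insert that(2) show ?case
      by (subst M.finsum_insert, simp, simp, simp, simp, subst N.finsum_insert) (auto simp: add)
  qed (simp add: f0)
  let ?S = "{i. hpart M x i \<noteq> \<zero>\<^bsub>M\<^esub>}"
  have fin: "finite ?S" using M.hpart_finite x by blast
  have "f x = (\<Oplus>\<^bsub>N\<^esub>i\<in>?S. f (hpart M x i))"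
    using M.hpart_sum[OF x fin order_refl] fs[OF fin, of "hpart M x"] M.hpart_carrier[OF x] by simp
  also have "\<dots> = (\<Oplus>\<^bsub>N\<^esub>j\<in>(\<lambda>i. i + s) ` ?S. f (hpart M x (j - s)))"
    using f M.hpart_carrier[OF x] by (subst N.finsum_reindex) (auto simp: inj_on_def)
  finally have "hpart N (f x) = (\<lambda>j. f (hpart M x (j - s)))"
  proof (rule N.hpart_eqI[rotated 3])
    show "f (hpart M x (j - s)) \<in> component N j" for j
      using comp[OF M.hpart_component[OF x, of "j - s"]] by simp
    show "f (hpart M x (j - s)) = \<zero>\<^bsub>N\<^esub>" if "j \<notin> (\<lambda>i. i + s) ` ?S" for j
    proof -
      have "hpart M x (j - s) = \<zero>\<^bsub>M\<^esub>"
        using that by (force simp: image_iff)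
      then show ?thesis using f0 by simp
    qed
  qed (use fin in auto)
  then show ?thesis by simp
qed

lemma graded_group_shift:
  fixes M (structure)
  assumes "graded_group M" shows "graded_group (shift M j)"
proof -
  interpret graded_group M by fact
  have ab: "abelian_group (shift M j)"
    using abelian_group_axioms
    unfolding abelian_group_def abelian_monoid_def abelian_group_axioms_def shift_def by simp
  interpret s: abelian_group "shift M j" by fact
  have fs: "finsum (shift M j) c S = finsum M c S" for c and S :: "int set"
    unfolding finsum_def shift_def by simp
  show ?thesis
  proof (intro graded_group.intro graded_group_axioms.intro ab)
    show "additive_subgroup (component (shift M j) i) (shift M j)" for i
      using component_subgroup[of "i + j"] unfolding additive_subgroup_def shift_def by simp
    fix x assume "x \<in> carrier (shift M j)"
    then have x: "x \<in> carrier M" by (simp add: shift_def)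
    have *: "homogeneous_decomposition M x (\<lambda>i. c (i - j))"
      if "homogeneous_decomposition (shift M j) x c" for c
    proof -
      have c: "\<And>i. c i \<in> component M (i + j)" "finite {i. c i \<noteq> \<zero>}"
          "x = (\<Oplus>i\<in>{i. c i \<noteq> \<zero>}. c i)"
        using that fs unfolding homogeneous_decomposition_def by (auto simp: shift_def)
      have eq: "{i. c (i - j) \<noteq> \<zero>} = (\<lambda>i. i + j) ` {i. c i \<noteq> \<zero>}"
        by (auto simp: image_iff) (metis diff_add_cancel)
      have cc: "c i \<in> carrier M" for i using c(1) component_carrier by blast
      show ?thesis unfolding homogeneous_decomposition_def eq
        using c cc by (subst finsum_reindex) (auto simp: inj_on_def, metis diff_add_cancel)
    qed
    have "homogeneous_decomposition (shift M j) x (\<lambda>i. hpart M x (i + j))"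
    proof -
      have eq: "{i. hpart M x i \<noteq> \<zero>} = (\<lambda>i. i + j) ` {i. hpart M x (i + j) \<noteq> \<zero>}"
        by (auto simp: image_iff) (metis diff_add_cancel)
      have fin: "finite {i. hpart M x (i + j) \<noteq> \<zero>}"
        using hpart_finite[OF x] unfolding eq by (rule finite_imageD) (auto simp: inj_on_def)
      have "x = (\<Oplus>i\<in>{i. hpart M x (i + j) \<noteq> \<zero>}. hpart M x (i + j))"
        using hpart_sum[OF x hpart_finite[OF x] order_refl] hpart_carrier[OF x]
        unfolding eq by (subst (asm) finsum_reindex) (auto simp: inj_on_def)
      then show ?thesis
        using fin hpart_component[OF x] fs unfolding homogeneous_decomposition_def
        by (auto simp: shift_def)
    qed
    moreover have "c = c'"
      if "homogeneous_decomposition (shift M j) x c" "homogeneous_decomposition (shift M j) x c'"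
      for c c'
    proof -
      have "(\<lambda>i. c (i - j)) = (\<lambda>i. c' (i - j))"
        using *[OF that(1)] *[OF that(2)] unique_decomposition[OF x] by blast
      then show ?thesis by (metis (no_types, opaque_lifting) add_diff_cancel_right' ext)
    qed
    ultimately show "\<exists>!c. homogeneous_decomposition (shift M j) x c" by blast
  qed
qed

lemma graded_right_module_shift:
  assumes "graded_right_module A M" shows "graded_right_module A (shift M j)"
proof -
  interpret graded_right_module A M by fact
  interpret s: graded_group "shift M j" by (rule graded_group_shift) unfold_locales
  show ?thesis
    by unfold_locales
      (auto simp: shift_def act_closed act_add_scalar act_add act_assoc act_one,
       metis act_component add.commute add.left_commute)
qed

lemma graded_right_module_regular:
  assumes "graded_ring A" shows "graded_right_module A (regular_module A)"
proof -
  interpret graded_ring A by fact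
  have fs: "finsum (regular_module A) c S = finsum A c S" for c and S :: "int set"
    unfolding finsum_def finprod_def regular_module_def by simp
  have ab: "abelian_group (regular_module A)"
    by (rule abelian_groupI) (auto simp: regular_module_def a_assoc a_comm a_lcomm intro: l_neg)
  interpret r: abelian_group "regular_module A" by fact
  interpret r: graded_group "regular_module A"
  proof (intro graded_group.intro graded_group_axioms.intro ab)
    show "additive_subgroup (component (regular_module A) i) (regular_module A)" for i
      using component_subgroup[of i]
      unfolding additive_subgroup_def subgroup_def m_inv_def regular_module_def by simp
    show "\<exists>!c. homogeneous_decomposition (regular_module A) x c"
      if "x \<in> carrier (regular_module A)" for x
      using that unique_decomposition[of x] fs unfolding homogeneous_decomposition_def
      by (simp add: regular_module_def)
  qed
  show ?thesis
    by unfold_locales (auto simp: regular_module_def component_mult r_distr l_distr m_assoc)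
qed

lemma graded_right_module_submodule:
  fixes M (structure)
  assumes "graded_right_module A M" "gr_submodule A M N"
  shows "graded_right_module A (M\<lparr>carrier := N, component := (\<lambda>i. component M i \<inter> N)\<rparr>)"
    (is "graded_right_module A ?N")
proof -
  interpret graded_right_module A M by fact
  have sub: "additive_subgroup N M" and sm: "\<And>a x. a \<in> carrier A \<Longrightarrow> x \<in> N \<Longrightarrow> a \<odot> x \<in> N"
    and hp: "\<And>x i. x \<in> N \<Longrightarrow> hpart M x i \<in> N"
    using assms(2) unfolding gr_submodule_def by auto
  interpret N: additive_subgroup N M by fact
  have NM: "x \<in> N \<Longrightarrow> x \<in> carrier M" for x by (rule N.a_Hcarr)
  have neg: "\<ominus> x \<in> N" if "x \<in> N" for x using N.a_inv_closed that by simp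
  have ab: "abelian_group ?N"
    by (rule abelian_groupI) (auto simp: NM N.a_closed a_assoc a_comm a_lcomm, metis NM neg r_neg)
  interpret n: abelian_group ?N by fact
  have fs: "finsum ?N c S = finsum M c S" if "\<And>i. c i \<in> N" for c and S :: "int set"
  proof (induction S rule: infinite_finite_induct)
    case (insert i S)
    then show ?case using that NM
      by (subst n.finsum_insert, simp, simp, simp, simp, subst finsum_insert) auto
  qed (auto simp: finsum_def finprod_def)
  interpret n: graded_group ?N
  proof (intro graded_group.intro graded_group_axioms.intro ab)
    show "additive_subgroup (component ?N i) ?N" for i
    proof -
      interpret C: additive_subgroup "component M i" M by (rule component_subgroup)
      have "subgroup (component M i \<inter> N) (add_monoid ?N)"
      proof (rule group.subgroupI)
        show "group (add_monoid ?N)" using n.a_group .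
        show "inv\<^bsub>add_monoid ?N\<^esub> x \<in> component M i \<inter> N" if "x \<in> component M i \<inter> N" for x
        proof -
          have "\<ominus>\<^bsub>?N\<^esub> x = \<ominus> x"
            using that n.minus_equality[of "\<ominus> x" x] neg NM l_neg by auto
          then have "inv\<^bsub>add_monoid ?N\<^esub> x = \<ominus> x"
            by (simp only: a_inv_def[of ?N])
          then show ?thesis using that neg C.a_inv_closed by (metis IntD1 IntD2 IntI)
        qed
        show "component M i \<inter> N \<noteq> {}" using zero_component N.zero_closed by blast
      qed auto
      then show ?thesis unfolding additive_subgroup_def by simp
    qed
    fix x assume "x \<in> carrier ?N"
    then have x: "x \<in> N" by simp
    have "homogeneous_decomposition ?N x c \<longleftrightarrow> homogeneous_decomposition M x c \<and> (\<forall>i. c i \<in> N)" for c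
      using fs unfolding homogeneous_decomposition_def by auto
    then show "\<exists>!c. homogeneous_decomposition ?N x c"
      using unique_decomposition[OF NM[OF x]] hpart_decomposition[OF NM[OF x]] hp[OF x] by blast
  qed
  show ?thesis
    by unfold_locales
      (auto simp: NM sm act_add_scalar act_add act_assoc act_one act_component
         dest: A.component_carrier)
qed


lemma (in graded_right_module) act_minus_one:
  assumes "x \<in> carrier M" shows "(\<ominus>\<^bsub>A\<^esub> \<one>\<^bsub>A\<^esub>) \<odot> x = \<ominus> x" and "\<zero>\<^bsub>A\<^esub> \<odot> x = \<zero>"
proof -
  have "\<zero>\<^bsub>A\<^esub> \<odot> x \<oplus> \<zero>\<^bsub>A\<^esub> \<odot> x = \<zero>\<^bsub>A\<^esub> \<odot> x"
    using act_add_scalar[of "\<zero>\<^bsub>A\<^esub>" "\<zero>\<^bsub>A\<^esub>" x] assms by simp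
  then show z: "\<zero>\<^bsub>A\<^esub> \<odot> x = \<zero>"
    using assms act_closed[of "\<zero>\<^bsub>A\<^esub>" x] add.l_cancel_one'[of "\<zero>\<^bsub>A\<^esub> \<odot> x" "\<zero>\<^bsub>A\<^esub> \<odot> x"] by auto
  have "(\<ominus>\<^bsub>A\<^esub> \<one>\<^bsub>A\<^esub>) \<odot> x \<oplus> x = \<zero>"
    using act_add_scalar[of "\<ominus>\<^bsub>A\<^esub> \<one>\<^bsub>A\<^esub>" "\<one>\<^bsub>A\<^esub>" x] assms z by (simp add: act_one A.l_neg)
  then show "(\<ominus>\<^bsub>A\<^esub> \<one>\<^bsub>A\<^esub>) \<odot> x = \<ominus> x"
    using assms by (metis A.a_inv_closed A.one_closed act_closed minus_equality)
qed

theorem gr_injective_extends: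
  fixes A :: "('k, 'a, 'e) graded_module_scheme"
    and X :: "('a, 'x, 'f) graded_module_scheme" and Y :: "('a, 'y, 'g) graded_module_scheme"
    and I :: "('a, 'm, 'h) graded_module_scheme"
  assumes inj: "gr_injective A I"
    and X: "graded_right_module A X" and Y: "graded_right_module A Y"
    and f: "f \<in> gr_hom A X Y" and f_inj: "inj_on f (carrier X)" and g: "g \<in> gr_hom A X I"
  shows "\<exists>h\<in>gr_hom A Y I. \<forall>x\<in>carrier X. h (f x) = g x"
proof -
  interpret A: graded_ring A using X by (rule graded_right_module.axioms(1))
  interpret I: graded_right_module A I using inj unfolding gr_injective_def by blast
  interpret X: graded_right_module A X by fact
  interpret Y: graded_right_module A Y by fact
  have fX: "f x \<in> carrier Y" if "x \<in> carrier X" for x using f that unfolding gr_hom_def by auto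
  have gX: "g x \<in> carrier I" if "x \<in> carrier X" for x using g that unfolding gr_hom_def by auto
  have fhp: "hpart Y (f x) i = f (hpart X x i)" if "x \<in> carrier X" for x i
    using hpart_map[of X Y f 0 x i] f that X.graded_group_axioms Y.graded_group_axioms
    unfolding gr_hom_def by auto
  have ghp: "hpart I (g x) i = g (hpart X x i)" if "x \<in> carrier X" for x i
    using hpart_map[of X I g 0 x i] g that X.graded_group_axioms I.graded_group_axioms
    unfolding gr_hom_def by auto
  define P where "P G \<longleftrightarrow> G \<subseteq> carrier Y \<times> carrier I \<and>
    (\<forall>u v u' v'. (u, v) \<in> G \<longrightarrow> (u', v') \<in> G \<longrightarrow> (u \<oplus>\<^bsub>Y\<^esub> u', v \<oplus>\<^bsub>I\<^esub> v') \<in> G) \<and>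
    (\<forall>a u v. a \<in> carrier A \<longrightarrow> (u, v) \<in> G \<longrightarrow> (a \<odot>\<^bsub>Y\<^esub> u, a \<odot>\<^bsub>I\<^esub> v) \<in> G) \<and>
    (\<forall>u v i. (u, v) \<in> G \<longrightarrow> (hpart Y u i, hpart I v i) \<in> G) \<and>
    (\<forall>v. (\<zero>\<^bsub>Y\<^esub>, v) \<in> G \<longrightarrow> v = \<zero>\<^bsub>I\<^esub>) \<and>
    (\<forall>x\<in>carrier X. (f x, g x) \<in> G)" for G
  have Psub: "G \<subseteq> carrier Y \<times> carrier I" if "P G" for G
    using that unfolding P_def by (elim conjE)
  have Padd: "(u \<oplus>\<^bsub>Y\<^esub> u', v \<oplus>\<^bsub>I\<^esub> v') \<in> G" if "P G" "(u, v) \<in> G" "(u', v') \<in> G" for G u v u' v'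
    using that(1) unfolding P_def by (elim conjE) (use that in simp)
  have Pact: "(a \<odot>\<^bsub>Y\<^esub> u, a \<odot>\<^bsub>I\<^esub> v) \<in> G" if "P G" "a \<in> carrier A" "(u, v) \<in> G" for G a u v
    using that(1) unfolding P_def by (elim conjE) (use that in simp)
  have Php: "(hpart Y u i, hpart I v i) \<in> G" if "P G" "(u, v) \<in> G" for G u v i
    using that(1) unfolding P_def by (elim conjE) (use that in simp)
  have P0: "v = \<zero>\<^bsub>I\<^esub>" if "P G" "(\<zero>\<^bsub>Y\<^esub>, v) \<in> G" for G v
    using that(1) unfolding P_def by (elim conjE) (use that in simp)
  have Pfg: "(f x, g x) \<in> G" if "P G" "x \<in> carrier X" for G x
    using that(1) unfolding P_def by (elim conjE) (use that in simp)
  have "\<exists>G\<in>Collect P. \<forall>G'\<in>Collect P. G \<subseteq> G' \<longrightarrow> G' = G"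
  proof (rule subset_Zorn_nonempty)
    have "P ((\<lambda>x. (f x, g x)) ` carrier X)"
      unfolding P_def
    proof (intro conjI allI impI ballI)
      fix u v u' v' assume "(u, v) \<in> (\<lambda>x. (f x, g x)) ` carrier X" "(u', v') \<in> (\<lambda>x. (f x, g x)) ` carrier X"
      then obtain x x' where "x \<in> carrier X" "x' \<in> carrier X" "u = f x" "v = g x" "u' = f x'" "v' = g x'"
        by auto
      then show "(u \<oplus>\<^bsub>Y\<^esub> u', v \<oplus>\<^bsub>I\<^esub> v') \<in> (\<lambda>x. (f x, g x)) ` carrier X"
        using f g unfolding gr_hom_def by (intro image_eqI[of _ _ "x \<oplus>\<^bsub>X\<^esub> x'"]) auto
    next
      fix a u v assume "a \<in> carrier A" "(u, v) \<in> (\<lambda>x. (f x, g x)) ` carrier X"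
      then obtain x where "a \<in> carrier A" "x \<in> carrier X" "u = f x" "v = g x" by auto
      then show "(a \<odot>\<^bsub>Y\<^esub> u, a \<odot>\<^bsub>I\<^esub> v) \<in> (\<lambda>x. (f x, g x)) ` carrier X"
        using f g X.act_closed unfolding gr_hom_def by (intro image_eqI[of _ _ "a \<odot>\<^bsub>X\<^esub> x"]) auto
    next
      fix u v i assume "(u, v) \<in> (\<lambda>x. (f x, g x)) ` carrier X"
      then show "(hpart Y u i, hpart I v i) \<in> (\<lambda>x. (f x, g x)) ` carrier X"
        using fhp ghp X.hpart_carrier by auto
    next
      fix v assume "(\<zero>\<^bsub>Y\<^esub>, v) \<in> (\<lambda>x. (f x, g x)) ` carrier X"
      then obtain x where x: "x \<in> carrier X" "f x = \<zero>\<^bsub>Y\<^esub>" "v = g x" by auto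
      have "f (\<zero>\<^bsub>A\<^esub> \<odot>\<^bsub>X\<^esub> \<zero>\<^bsub>X\<^esub>) = \<zero>\<^bsub>A\<^esub> \<odot>\<^bsub>Y\<^esub> f \<zero>\<^bsub>X\<^esub>" "g (\<zero>\<^bsub>A\<^esub> \<odot>\<^bsub>X\<^esub> \<zero>\<^bsub>X\<^esub>) = \<zero>\<^bsub>A\<^esub> \<odot>\<^bsub>I\<^esub> g \<zero>\<^bsub>X\<^esub>"
        using f g A.zero_closed X.zero_closed unfolding gr_hom_def by blast+
      then have "f \<zero>\<^bsub>X\<^esub> = \<zero>\<^bsub>Y\<^esub>" "g \<zero>\<^bsub>X\<^esub> = \<zero>\<^bsub>I\<^esub>"
        using X.act_minus_one(2) Y.act_minus_one(2) I.act_minus_one(2) fX gX by simp_all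
      then show "v = \<zero>\<^bsub>I\<^esub>" using x f_inj by (metis X.zero_closed inj_onD)
    qed (use fX gX in auto)
    then show "Collect P \<noteq> {}" by blast
  next
    fix C assume ne: "C \<noteq> {}" and ch: "subset.chain (Collect P) C"
    have P: "P G" if "G \<in> C" for G using ch that unfolding subset.chain_def by blast
    have "P (\<Union>C)"
      unfolding P_def
    proof (intro conjI allI impI ballI)
      fix u v u' v' assume "(u, v) \<in> \<Union>C" "(u', v') \<in> \<Union>C"
      then obtain G G' where "G \<in> C" "G' \<in> C" "(u, v) \<in> G" "(u', v') \<in> G'" by blast
      moreover have "G \<subseteq> G' \<or> G' \<subseteq> G" using ch calculation unfolding subset.chain_def by blast
      ultimately obtain H where "H \<in> C" "(u, v) \<in> H" "(u', v') \<in> H" by blast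
      then show "(u \<oplus>\<^bsub>Y\<^esub> u', v \<oplus>\<^bsub>I\<^esub> v') \<in> \<Union>C" using P[of H] Padd by blast
    next
      show "\<Union>C \<subseteq> carrier Y \<times> carrier I" using P Psub by blast
    next
      fix a u v assume "a \<in> carrier A" "(u, v) \<in> \<Union>C"
      then show "(a \<odot>\<^bsub>Y\<^esub> u, a \<odot>\<^bsub>I\<^esub> v) \<in> \<Union>C" using P Pact by blast
    next
      fix u v i assume "(u, v) \<in> \<Union>C"
      then show "(hpart Y u i, hpart I v i) \<in> \<Union>C" using P Php by blast
    next
      fix v assume "(\<zero>\<^bsub>Y\<^esub>, v) \<in> \<Union>C"
      then show "v = \<zero>\<^bsub>I\<^esub>" using P P0 by blast
    next
      fix x assume "x \<in> carrier X"
      then show "(f x, g x) \<in> \<Union>C" using P ne Pfg by blast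
    qed
    then show "\<Union>C \<in> Collect P" by simp
  qed
  then obtain G where PG: "P G" and max: "\<And>G'. P G' \<Longrightarrow> G \<subseteq> G' \<Longrightarrow> G' = G" by blast
  have Gc: "u \<in> carrier Y" "v \<in> carrier I" if "(u, v) \<in> G" for u v
    using Psub[OF PG] that by auto
  have Gadd: "(u \<oplus>\<^bsub>Y\<^esub> u', v \<oplus>\<^bsub>I\<^esub> v') \<in> G" if "(u, v) \<in> G" "(u', v') \<in> G" for u v u' v'
    using Padd[OF PG] that by blast
  have Gact: "(a \<odot>\<^bsub>Y\<^esub> u, a \<odot>\<^bsub>I\<^esub> v) \<in> G" if "a \<in> carrier A" "(u, v) \<in> G" for a u v
    using Pact[OF PG] that by blast
  have Ghp: "(hpart Y u i, hpart I v i) \<in> G" if "(u, v) \<in> G" for u v i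
    using Php[OF PG] that by blast
  have G0: "v = \<zero>\<^bsub>I\<^esub>" if "(\<zero>\<^bsub>Y\<^esub>, v) \<in> G" for v
    using P0[OF PG] that by blast
  have Gfg: "(f x, g x) \<in> G" if "x \<in> carrier X" for x
    using Pfg[OF PG] that by blast
  have G00: "(\<zero>\<^bsub>Y\<^esub>, \<zero>\<^bsub>I\<^esub>) \<in> G"
    using Gact[OF A.zero_closed Gfg[OF X.zero_closed]] Y.act_minus_one(2) I.act_minus_one(2)
      fX[OF X.zero_closed] gX[OF X.zero_closed] by simp
  have Gneg: "(\<ominus>\<^bsub>Y\<^esub> u, \<ominus>\<^bsub>I\<^esub> v) \<in> G" if "(u, v) \<in> G" for u v
    using Gact[OF A.a_inv_closed[OF A.one_closed] that] Gc[OF that]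
      Y.act_minus_one(1) I.act_minus_one(1) by simp
  have Gfun: "v = v'" if "(u, v) \<in> G" "(u, v') \<in> G" for u v v'
  proof -
    have "v \<oplus>\<^bsub>I\<^esub> \<ominus>\<^bsub>I\<^esub> v' = \<zero>\<^bsub>I\<^esub>"
      using Gadd[OF that(1) Gneg[OF that(2)]] Gc[OF that(1)] G0 by (simp add: Y.r_neg)
    then show ?thesis using Gc that by (metis I.minus_equality I.minus_minus I.a_inv_closed)
  qed
  have Ghom: "v \<in> component I i" if "(u, v) \<in> G" "u \<in> component Y i" for u v i
  proof -
    have "hpart Y u i = u" using Y.hpart_homogeneous[OF that(2)] by simp
    with Ghp[OF that(1), of i] have "(u, hpart I v i) \<in> G" by simp
    then have "v = hpart I v i" by (rule Gfun[OF that(1)])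
    then show ?thesis using I.hpart_component[OF Gc(2)[OF that(1)], of i] by simp
  qed
  have dom: "y \<in> fst ` G" if hy: "y \<in> component Y j" for y j
  proof (rule ccontr)
    assume ny: "y \<notin> fst ` G"
    have yc: "y \<in> carrier Y" using Y.component_carrier hy .
    have yhp: "hpart Y (a \<odot>\<^bsub>Y\<^esub> y) i = hpart A a (i - j) \<odot>\<^bsub>Y\<^esub> y" if "a \<in> carrier A" for a i
      using hpart_map[of A Y "\<lambda>a. a \<odot>\<^bsub>Y\<^esub> y" j a "i - j"] that yc hy Y.act_closed Y.act_add_scalar
        Y.act_component A.graded_group_axioms Y.graded_group_axioms by (auto simp: add.commute)
    define J where "J = {a \<in> carrier A. a \<odot>\<^bsub>Y\<^esub> y \<in> fst ` G}"
    have JI: "a \<in> J" if "a \<in> carrier A" "(a \<odot>\<^bsub>Y\<^esub> y, v) \<in> G" for a v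
      using that image_eqI[of _ fst, OF _ that(2)] unfolding J_def by simp
    have JE: "\<exists>v. (a \<odot>\<^bsub>Y\<^esub> y, v) \<in> G" if "a \<in> J" for a
      using that unfolding J_def by auto
    have Jc: "a \<in> carrier A" if "a \<in> J" for a using that unfolding J_def by simp
    define R where "R = shift (regular_module A) (- j)"
    define XJ where "XJ = R\<lparr>carrier := J, component := (\<lambda>i. component R i \<inter> J)\<rparr>"
    have Rs: "carrier R = carrier A" "add R = add A" "\<zero>\<^bsub>R\<^esub> = \<zero>\<^bsub>A\<^esub>" "smult R = (\<lambda>a x. x \<otimes>\<^bsub>A\<^esub> a)"
      "component R = (\<lambda>i. component A (i - j))"
      unfolding R_def shift_def regular_module_def by auto
    have R: "graded_right_module A R"
      unfolding R_def
      by (rule graded_right_module_shift[OF graded_right_module_regular[OF A.graded_ring_axioms]])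
    interpret R: graded_right_module A R by (rule R)
    have Rhp: "hpart R a i = hpart A a (i - j)" if "a \<in> carrier A" for a i
      using hpart_map[of A R "\<lambda>x. x" j a "i - j"] that A.graded_group_axioms R.graded_group_axioms Rs
      by auto
    have J1: "gr_submodule A R J"
    proof -
      have Jneg: "\<ominus>\<^bsub>R\<^esub> a \<in> J" if "a \<in> J" for a
      proof -
        have a: "a \<in> carrier A" "a \<odot>\<^bsub>Y\<^esub> y \<in> fst ` G" using that unfolding J_def by auto
        then obtain v where "(a \<odot>\<^bsub>Y\<^esub> y, v) \<in> G" by auto
        then have "(\<ominus>\<^bsub>Y\<^esub> (a \<odot>\<^bsub>Y\<^esub> y), \<ominus>\<^bsub>I\<^esub> v) \<in> G" by (rule Gneg)
        moreover have "(\<ominus>\<^bsub>A\<^esub> a) \<odot>\<^bsub>Y\<^esub> y = \<ominus>\<^bsub>Y\<^esub> (a \<odot>\<^bsub>Y\<^esub> y)"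
        proof (rule Y.minus_equality[symmetric])
          show "(\<ominus>\<^bsub>A\<^esub> a) \<odot>\<^bsub>Y\<^esub> y \<oplus>\<^bsub>Y\<^esub> a \<odot>\<^bsub>Y\<^esub> y = \<zero>\<^bsub>Y\<^esub>"
            using Y.act_add_scalar[of "\<ominus>\<^bsub>A\<^esub> a" a y] a yc Y.act_minus_one(2)[OF yc]
            by (simp add: A.l_neg)
        qed (use a yc Y.act_closed in auto)
        ultimately have "\<ominus>\<^bsub>A\<^esub> a \<in> J" using a by (intro JI) auto
        moreover have "\<ominus>\<^bsub>R\<^esub> a = \<ominus>\<^bsub>A\<^esub> a"
          by (rule R.minus_equality) (use a in \<open>auto simp: Rs A.l_neg\<close>)
        ultimately show ?thesis by simp
      qed
      have "additive_subgroup J R"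
        unfolding additive_subgroup_def
      proof (rule group.subgroupI[OF R.a_group])
        show "J \<subseteq> carrier (add_monoid R)" unfolding J_def by (auto simp: Rs)
        have "\<zero>\<^bsub>A\<^esub> \<in> J" using G00 Y.act_minus_one(2)[OF yc] by (intro JI) auto
        then show "J \<noteq> {}" by blast
        show "inv\<^bsub>add_monoid R\<^esub> a \<in> J" if "a \<in> J" for a
          using Jneg[OF that] by (simp only: a_inv_def)
        show "a \<otimes>\<^bsub>add_monoid R\<^esub> b \<in> J" if ab: "a \<in> J" "b \<in> J" for a b
        proof -
          obtain v w where "(a \<odot>\<^bsub>Y\<^esub> y, v) \<in> G" "(b \<odot>\<^bsub>Y\<^esub> y, w) \<in> G" using JE[OF ab(1)] JE[OF ab(2)] by blast
          from Gadd[OF this] have "((a \<oplus>\<^bsub>A\<^esub> b) \<odot>\<^bsub>Y\<^esub> y, v \<oplus>\<^bsub>I\<^esub> w) \<in> G"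
            using Y.act_add_scalar[of a b y] Jc that yc by simp
          then have "a \<oplus>\<^bsub>A\<^esub> b \<in> J" by (rule JI[rotated]) (use Jc that in simp)
          then show ?thesis by (simp add: Rs)
        qed
      qed
      moreover have "a \<odot>\<^bsub>R\<^esub> x \<in> J" if ax: "a \<in> carrier A" "x \<in> J" for a x
      proof -
        obtain v where "(x \<odot>\<^bsub>Y\<^esub> y, v) \<in> G" using JE[OF ax(2)] by blast
        then have "((x \<otimes>\<^bsub>A\<^esub> a) \<odot>\<^bsub>Y\<^esub> y, a \<odot>\<^bsub>I\<^esub> v) \<in> G"
          using Gact[OF that(1)] Y.act_assoc[of x a y] Jc that yc by simp
        then have "x \<otimes>\<^bsub>A\<^esub> a \<in> J" by (rule JI[rotated]) (use Jc that in simp)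
        then show ?thesis by (simp add: Rs)
      qed
      moreover have "hpart R x i \<in> J" if xJ: "x \<in> J" for x i
      proof -
        have xc: "x \<in> carrier A" using Jc that .
        obtain v where "(x \<odot>\<^bsub>Y\<^esub> y, v) \<in> G" using JE[OF xJ] by blast
        from Ghp[OF this, of i] have "(hpart A x (i - j) \<odot>\<^bsub>Y\<^esub> y, hpart I v i) \<in> G"
          using yhp[OF xc] by simp
        then have "hpart A x (i - j) \<in> J" by (rule JI[rotated]) (use A.hpart_carrier xc in simp)
        then show ?thesis using Rhp[OF xc] by simp
      qed
      ultimately show ?thesis unfolding gr_submodule_def by blast
    qed
    have XJ: "graded_right_module A XJ"
      unfolding XJ_def by (rule graded_right_module_submodule[OF R J1])
    define \<phi> where "\<phi> a = (THE v. (a \<odot>\<^bsub>Y\<^esub> y, v) \<in> G)" for a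
    have \<phi>: "(a \<odot>\<^bsub>Y\<^esub> y, \<phi> a) \<in> G" if aJ: "a \<in> J" for a
    proof -
      obtain v where v: "(a \<odot>\<^bsub>Y\<^esub> y, v) \<in> G" using JE[OF aJ] by blast
      show ?thesis unfolding \<phi>_def by (rule theI[where P = "\<lambda>v. (a \<odot>\<^bsub>Y\<^esub> y, v) \<in> G", OF v]) (rule Gfun[OF _ v])
    qed
    have "\<phi> \<in> gr_hom A XJ I"
      unfolding gr_hom_def
    proof (intro CollectI conjI ballI allI)
      show "\<phi> \<in> carrier XJ \<rightarrow> carrier I" using \<phi> Gc(2) unfolding XJ_def by auto
      show "\<phi> (a \<oplus>\<^bsub>XJ\<^esub> b) = \<phi> a \<oplus>\<^bsub>I\<^esub> \<phi> b" if "a \<in> carrier XJ" "b \<in> carrier XJ" for a b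
      proof -
        have ab: "a \<in> J" "b \<in> J" using that unfolding XJ_def by auto
        have "((a \<oplus>\<^bsub>A\<^esub> b) \<odot>\<^bsub>Y\<^esub> y, \<phi> a \<oplus>\<^bsub>I\<^esub> \<phi> b) \<in> G"
          using Gadd[OF \<phi>[OF ab(1)] \<phi>[OF ab(2)]] Y.act_add_scalar[of a b y] Jc ab yc by simp
        moreover from this have "a \<oplus>\<^bsub>A\<^esub> b \<in> J" by (rule JI[rotated]) (use Jc ab in simp)
        ultimately have "\<phi> (a \<oplus>\<^bsub>A\<^esub> b) = \<phi> a \<oplus>\<^bsub>I\<^esub> \<phi> b" using Gfun[OF \<phi>] by blast
        then show ?thesis unfolding XJ_def by (simp add: Rs)
      qed
      show "\<phi> (a \<odot>\<^bsub>XJ\<^esub> b) = a \<odot>\<^bsub>I\<^esub> \<phi> b" if "a \<in> carrier A" "b \<in> carrier XJ" for a b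
      proof -
        have b: "b \<in> J" using that unfolding XJ_def by auto
        have "((b \<otimes>\<^bsub>A\<^esub> a) \<odot>\<^bsub>Y\<^esub> y, a \<odot>\<^bsub>I\<^esub> \<phi> b) \<in> G"
          using Gact[OF that(1) \<phi>[OF b]] Y.act_assoc[of b a y] Jc b that yc by simp
        moreover from this have "b \<otimes>\<^bsub>A\<^esub> a \<in> J" by (rule JI[rotated]) (use Jc b that in simp)
        ultimately have "\<phi> (b \<otimes>\<^bsub>A\<^esub> a) = a \<odot>\<^bsub>I\<^esub> \<phi> b" using Gfun[OF \<phi>] by blast
        then show ?thesis unfolding XJ_def by (simp add: Rs)
      qed
      show "\<phi> a \<in> component I i" if "a \<in> component XJ i" for a i
      proof -
        have a: "a \<in> J" "a \<in> component A (i - j)" using that unfolding XJ_def by (auto simp: Rs)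
        have "a \<odot>\<^bsub>Y\<^esub> y \<in> component Y i" using Y.act_component[OF a(2) hy] by simp
        then show ?thesis using Ghom[OF \<phi>[OF a(1)]] by blast
      qed
    qed
    moreover have "(\<lambda>a. a) \<in> gr_hom A XJ R"
      unfolding gr_hom_def XJ_def using Jc by (auto simp: Rs)
    ultimately obtain h where h: "h \<in> gr_hom A R I" and h\<phi>: "\<And>a. a \<in> J \<Longrightarrow> h a = \<phi> a"
    proof -
      assume \<phi>: "\<phi> \<in> gr_hom A XJ I" and id: "(\<lambda>a. a) \<in> gr_hom A XJ R"
        and *: "\<And>h. h \<in> gr_hom A R I \<Longrightarrow> (\<And>a. a \<in> J \<Longrightarrow> h a = \<phi> a) \<Longrightarrow> thesis"
      have "\<exists>h\<in>gr_hom A R I. \<forall>x\<in>carrier XJ. h ((\<lambda>a. a) x) = \<phi> x"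
        using inj XJ R id inj_on_id2 \<phi> unfolding gr_injective_def by blast
      then show thesis using * unfolding XJ_def by auto
    qed
    define z where "z = h \<one>\<^bsub>A\<^esub>"
    have z: "z \<in> component I j" using h A.one_component unfolding gr_hom_def z_def by (auto simp: Rs)
    have zc: "z \<in> carrier I" using I.component_carrier z .
    have zhp: "hpart I (a \<odot>\<^bsub>I\<^esub> z) i = hpart A a (i - j) \<odot>\<^bsub>I\<^esub> z" if "a \<in> carrier A" for a i
      using hpart_map[of A I "\<lambda>a. a \<odot>\<^bsub>I\<^esub> z" j a "i - j"] that zc z I.act_closed I.act_add_scalar
        I.act_component A.graded_group_axioms I.graded_group_axioms by (auto simp: add.commute)
    have hz: "h a = a \<odot>\<^bsub>I\<^esub> z" if "a \<in> carrier A" for a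
    proof -
      have "h (a \<odot>\<^bsub>R\<^esub> \<one>\<^bsub>A\<^esub>) = a \<odot>\<^bsub>I\<^esub> z"
        using h that A.one_closed unfolding gr_hom_def z_def Rs(1) by blast
      then show ?thesis using that by (simp add: Rs)
    qed
    define G' where "G' = {(u \<oplus>\<^bsub>Y\<^esub> a \<odot>\<^bsub>Y\<^esub> y, v \<oplus>\<^bsub>I\<^esub> a \<odot>\<^bsub>I\<^esub> z) | u v a. (u, v) \<in> G \<and> a \<in> carrier A}"
    have G'I: "(p, q) \<in> G'" if "(u, v) \<in> G" "a \<in> carrier A" "p = u \<oplus>\<^bsub>Y\<^esub> a \<odot>\<^bsub>Y\<^esub> y" "q = v \<oplus>\<^bsub>I\<^esub> a \<odot>\<^bsub>I\<^esub> z"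
      for u v a p q using that unfolding G'_def by blast
    have G'E: "\<exists>u v a. (u, v) \<in> G \<and> a \<in> carrier A \<and> p = u \<oplus>\<^bsub>Y\<^esub> a \<odot>\<^bsub>Y\<^esub> y \<and> q = v \<oplus>\<^bsub>I\<^esub> a \<odot>\<^bsub>I\<^esub> z"
      if "(p, q) \<in> G'" for p q using that unfolding G'_def by blast
    have sub: "G \<subseteq> G'"
    proof
      fix p assume p: "p \<in> G"
      obtain u v where uv: "p = (u, v)" by (cases p)
      show "p \<in> G'" unfolding uv
        by (rule G'I[of u v "\<zero>\<^bsub>A\<^esub>"])
          (use p uv Gc yc zc Y.act_minus_one(2) I.act_minus_one(2) in auto)
    qed
    have "P G'"
      unfolding P_def
    proof (intro conjI allI impI ballI)
      show "G' \<subseteq> carrier Y \<times> carrier I"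
        using Gc yc zc Y.act_closed I.act_closed unfolding G'_def by auto
      show "(f x, g x) \<in> G'" if "x \<in> carrier X" for x using Gfg that sub by blast
    next
      fix p q p' q' assume "(p, q) \<in> G'" "(p', q') \<in> G'"
      then obtain u v a u' v' a' where *: "(u, v) \<in> G" "a \<in> carrier A" "p = u \<oplus>\<^bsub>Y\<^esub> a \<odot>\<^bsub>Y\<^esub> y"
          "q = v \<oplus>\<^bsub>I\<^esub> a \<odot>\<^bsub>I\<^esub> z" "(u', v') \<in> G" "a' \<in> carrier A" "p' = u' \<oplus>\<^bsub>Y\<^esub> a' \<odot>\<^bsub>Y\<^esub> y"
          "q' = v' \<oplus>\<^bsub>I\<^esub> a' \<odot>\<^bsub>I\<^esub> z"
        using G'E by meson
      show "(p \<oplus>\<^bsub>Y\<^esub> p', q \<oplus>\<^bsub>I\<^esub> q') \<in> G'"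
      proof (rule G'I[OF Gadd[OF *(1) *(5)] A.a_closed[OF *(2) *(6)]])
        show "p \<oplus>\<^bsub>Y\<^esub> p' = u \<oplus>\<^bsub>Y\<^esub> u' \<oplus>\<^bsub>Y\<^esub> (a \<oplus>\<^bsub>A\<^esub> a') \<odot>\<^bsub>Y\<^esub> y"
          using * Gc yc Y.act_closed by (simp add: Y.act_add_scalar Y.a_ac)
        show "q \<oplus>\<^bsub>I\<^esub> q' = v \<oplus>\<^bsub>I\<^esub> v' \<oplus>\<^bsub>I\<^esub> (a \<oplus>\<^bsub>A\<^esub> a') \<odot>\<^bsub>I\<^esub> z"
          using * Gc[OF *(1)] Gc[OF *(5)] zc I.act_closed by (simp add: I.act_add_scalar I.a_ac)
      qed
    next
      fix b p q assume b: "b \<in> carrier A" "(p, q) \<in> G'"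
      then obtain u v a where *: "(u, v) \<in> G" "a \<in> carrier A" "p = u \<oplus>\<^bsub>Y\<^esub> a \<odot>\<^bsub>Y\<^esub> y"
          "q = v \<oplus>\<^bsub>I\<^esub> a \<odot>\<^bsub>I\<^esub> z"
        using G'E by meson
      show "(b \<odot>\<^bsub>Y\<^esub> p, b \<odot>\<^bsub>I\<^esub> q) \<in> G'"
        by (rule G'I[OF Gact[OF b(1) *(1)] A.m_closed[OF *(2) b(1)]])
          (use * Gc[OF *(1)] b(1) yc zc Y.act_closed I.act_closed in
            \<open>simp_all add: Y.act_add Y.act_assoc I.act_add I.act_assoc\<close>)
    next
      fix p q i assume "(p, q) \<in> G'"
      then obtain u v a where *: "(u, v) \<in> G" "a \<in> carrier A" "p = u \<oplus>\<^bsub>Y\<^esub> a \<odot>\<^bsub>Y\<^esub> y"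
          "q = v \<oplus>\<^bsub>I\<^esub> a \<odot>\<^bsub>I\<^esub> z"
        using G'E by meson
      show "(hpart Y p i, hpart I q i) \<in> G'"
        by (rule G'I[OF Ghp[OF *(1)] A.hpart_carrier[OF *(2)]])
          (use * Gc[OF *(1)] yc zc Y.act_closed I.act_closed in
            \<open>simp_all add: Y.hpart_add I.hpart_add yhp zhp\<close>)
    next
      fix q assume "(\<zero>\<^bsub>Y\<^esub>, q) \<in> G'"
      then obtain u v a where *: "(u, v) \<in> G" "a \<in> carrier A" "\<zero>\<^bsub>Y\<^esub> = u \<oplus>\<^bsub>Y\<^esub> a \<odot>\<^bsub>Y\<^esub> y"
          "q = v \<oplus>\<^bsub>I\<^esub> a \<odot>\<^bsub>I\<^esub> z"
        using G'E by meson
      have "a \<odot>\<^bsub>Y\<^esub> y = \<ominus>\<^bsub>Y\<^esub> u"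
        using * Gc[OF *(1)] yc Y.act_closed by (metis Y.a_comm Y.minus_equality)
      then have aJ: "a \<in> J" using Gneg[OF *(1)] *(2) by (intro JI) auto
      have "(a \<odot>\<^bsub>Y\<^esub> y, a \<odot>\<^bsub>I\<^esub> z) \<in> G" using \<phi>[OF aJ] h\<phi>[OF aJ] hz[OF *(2)] by simp
      then show "q = \<zero>\<^bsub>I\<^esub>" using Gadd[OF *(1)] G0 * by metis
    qed
    then have "G' = G" using max sub by blast
    moreover have "(y, z) \<in> G'"
      by (rule G'I[OF G00 A.one_closed]) (use yc zc in \<open>simp_all add: Y.act_one I.act_one\<close>)
    ultimately show False using ny by force
  qed
  have all: "u \<in> fst ` G" if "u \<in> carrier Y" for u
  proof (rule Y.hpart_sum_mem[OF that])
    show "hpart Y u i \<in> fst ` G" for i using dom Y.hpart_component[OF that] by blast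
    show "\<zero>\<^bsub>Y\<^esub> \<in> fst ` G" using G00 by force
    show "a \<oplus>\<^bsub>Y\<^esub> b \<in> fst ` G" if "a \<in> fst ` G" "b \<in> fst ` G" for a b using that Gadd by force
    show "fst ` G \<subseteq> carrier Y" using Gc by auto
  qed
  define h where "h u = (THE v. (u, v) \<in> G)" for u
  have hG: "h u = v" if "(u, v) \<in> G" for u v
    unfolding h_def using that Gfun by (intro the_equality) auto
  have Gh: "(u, h u) \<in> G" if "u \<in> carrier Y" for u using all[OF that] hG by force
  have "h \<in> gr_hom A Y I"
    unfolding gr_hom_def
    using Gh Gc(2) hG[OF Gadd[OF Gh Gh]] hG[OF Gact[OF _ Gh]] Ghom[OF Gh] Y.component_carrier by auto
  moreover have "\<forall>x\<in>carrier X. h (f x) = g x" using hG[OF Gfg] by blast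
  ultimately show ?thesis by blast
qed

end

theory Submission
  imports Defs "HOL-Algebra.Ring_Divisibility"
begin

text \<open>
  Why the theorem holds. Fix a finite injective resolution \<open>I\<close> of \<open>A\<close>. For a graded ideal \<open>J\<close>, a
  graded homomorphism \<open>A/J \<rightarrow> (I n)(j)\<close> is an element of degree \<open>j\<close> of \<open>I n\<close> killed by \<open>J\<close>, so
  \<open>Ext(A/J, A(j))\<close> is the cohomology of the \<open>J\<close>-torsion subcomplex of \<open>I\<close> in degree \<open>j\<close>. As only
  cyclic modules and the sequences \<open>0 \<rightarrow> A/(J : a) \<rightarrow> A/J \<rightarrow> A/(J + aA) \<rightarrow> 0\<close> for homogeneous \<open>a\<close>
  are needed, the argument below takes place among these torsion subcomplexes. Injectivity enters
  it through the fact that multiplication by \<open>a\<close> maps the \<open>J\<close>-torsion onto the \<open>(J : a)\<close>-torsion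
  (\<open>torsion_lift\<close>).

  Elements of positive degree are nilpotent, so they lie in every prime. Hence depth can be measured
  in degree zero: choose a regular sequence of \<open>t\<close> nonunits of \<open>A\<^sub>0\<close>, generating an ideal \<open>X\<close>, that
  cannot be prolonged. Prime avoidance then embeds the residue field of \<open>A\<close>, up to a shift, into
  \<open>A/X\<close> (\<open>maximal_regular_ideal\<close>). By Rees' theorem \<open>Ext(A/X, A)\<close> is \<open>A/X\<close>, placed in cohomological
  degree \<open>t\<close> and with no shift of the grading (\<open>Ext_regular_ideal\<close>). Bass' argument with
  Nakayama's lemma shows that all \<open>Ext\<close> above degree \<open>t\<close> vanishes (\<open>Ext_zero_above\<close>). Therefore
  \<open>A/X\<close> is self-injective: \<open>Ext\<close> in degree \<open>t\<close> is exact on modules over \<open>A/X\<close> and agrees with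
  homomorphisms into \<open>A/X\<close>.

  For a self-injective graded ring with \<open>A\<^sub>0\<close> local, the elements killed by all elements of positive
  degree are concentrated in one degree. Indeed, the projection onto one of two such elements of
  different degrees would be multiplication by some \<open>e\<close> of degree zero, while \<open>e\<close> or \<open>1 - e\<close> is
  invertible (\<open>Ext_unique_degree\<close>). This is the claim for \<open>A/X\<close>. To return to \<open>A\<close>, note that \<open>A\<^sub>0\<close> is
  a direct summand of \<open>A\<close> as a module over itself, so the regular sequence is regular on \<open>A\<^sub>0\<close>; if
  \<open>Ext(A\<^sub>0/xA\<^sub>0, A(j))\<close> vanishes then \<open>x\<close> acts surjectively on \<open>Ext(A\<^sub>0, A(j))\<close>, which vanishes by
  Nakayama's lemma (\<open>Ext_zero_descend\<close>).

  The left-hand condition is the same statement for the opposite algebra, which satisfies the same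
  hypotheses because \<open>A\<close> is commutative.
\<close>

section \<open>Graded ideals of a graded commutative ring\<close>

lemma ascending_chains_imp_maximal:
  assumes "\<S> \<noteq> {}"
    and acc: "\<And>f :: nat \<Rightarrow> 'x set. (\<And>n. f n \<in> \<S> \<and> f n \<subseteq> f (Suc n)) \<Longrightarrow> \<exists>m. \<forall>n\<ge>m. f n = f m"
  shows "\<exists>U\<in>\<S>. \<forall>V\<in>\<S>. U \<subseteq> V \<longrightarrow> V = U"
proof (rule ccontr)
  assume max: "\<not> ?thesis"
  then have *: "\<exists>V. V \<in> \<S> \<and> U \<subset> V" if "U \<in> \<S>" for U using that max by blast
  have "\<exists>f. \<forall>n. f n \<in> \<S> \<and> f n \<subset> f (Suc n)"
    by (rule dependent_nat_choice) (use * \<open>\<S> \<noteq> {}\<close> in auto)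
  then obtain f where f: "\<And>n. f n \<in> \<S> \<and> f n \<subset> f (Suc n)" by blast
  then have "\<exists>m. \<forall>n\<ge>m. f n = f m" by (intro acc) auto
  then obtain m where "f (Suc m) = f m" by (metis le_SucI order_refl)
  then show False using f[of m] by blast
qed

lemma shift_zero_regular: "shift (regular_module A) 0 = regular_module A"
  by (simp add: shift_def regular_module_def)

locale graded_cring = graded_ring A + cring A
  for A :: "('k, 'a, 'e) graded_module_scheme" (structure)
begin

lemma hpart_mult_homogeneous:
  assumes "a \<in> component A s" "r \<in> carrier A"
  shows "hpart A (a \<otimes> r) i = a \<otimes> hpart A r (i - s)"
  using hpart_map[OF graded_group_axioms graded_group_axioms, of "\<lambda>r. a \<otimes> r" s r "i - s"]
    assms component_mult[OF assms(1)] component_carrier[OF assms(1)]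
  by (auto simp: r_distr add.commute)

lemma hpart_homogeneous_mult:
  assumes "a \<in> component A s" "r \<in> carrier A"
  shows "hpart A (r \<otimes> a) i = hpart A r (i - s) \<otimes> a"
  using hpart_mult_homogeneous[OF assms] assms component_carrier
  by (simp add: m_comm hpart_carrier)

lemma component_add: "\<lbrakk>a \<in> component A i; b \<in> component A i\<rbrakk> \<Longrightarrow> a \<oplus> b \<in> component A i"
  by (rule additive_subgroup.a_closed[OF component_subgroup])

lemma component_minus: "a \<in> component A i \<Longrightarrow> \<ominus> a \<in> component A i"
  using additive_subgroup.a_inv_closed[OF component_subgroup] .

lemma component_diff: "\<lbrakk>a \<in> component A i; b \<in> component A i\<rbrakk> \<Longrightarrow> a \<ominus> b \<in> component A i"
  unfolding a_minus_def by (intro component_add component_minus)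

definition gr_ideal :: "'a set \<Rightarrow> bool" where
  "gr_ideal J \<longleftrightarrow> gr_submodule A (regular_module A) J"

lemma regular_module_simps [simp]:
  "carrier (regular_module A) = carrier A" "\<zero>\<^bsub>regular_module A\<^esub> = \<zero>"
  "add (regular_module A) = add A" "component (regular_module A) = component A"
  "a \<odot>\<^bsub>regular_module A\<^esub> x = x \<otimes> a"
  by (auto simp: regular_module_def)

lemma graded_right_module_shift_regular: "graded_right_module A (shift (regular_module A) s)"
  by (intro graded_right_module_shift graded_right_module_regular graded_ring_axioms)

lemma hpart_shift_regular:
  assumes "x \<in> carrier A" shows "hpart (shift (regular_module A) s) x i = hpart A x (i + s)"
proof -
  interpret R: graded_right_module A "shift (regular_module A) s"
    by (rule graded_right_module_shift_regular)
  show ?thesis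
    using hpart_map[OF graded_group_axioms R.graded_group_axioms, of "\<lambda>x. x" "-s" x "i + s"] assms
    by (auto simp: shift_def)
qed

lemma hpart_regular:
  assumes "x \<in> carrier A" shows "hpart (regular_module A) x i = hpart A x i"
  using hpart_shift_regular[OF assms, of 0 i] by (simp add: shift_zero_regular)

lemma gr_idealI:
  assumes "J \<subseteq> carrier A" "\<zero> \<in> J" "\<And>a b. \<lbrakk>a \<in> J; b \<in> J\<rbrakk> \<Longrightarrow> a \<oplus> b \<in> J"
    "\<And>a r. \<lbrakk>a \<in> J; r \<in> carrier A\<rbrakk> \<Longrightarrow> a \<otimes> r \<in> J" "\<And>a i. a \<in> J \<Longrightarrow> hpart A a i \<in> J"
  shows "gr_ideal J"
proof -
  interpret R: graded_right_module A "regular_module A"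
    by (rule graded_right_module_regular) unfold_locales
  have neg: "\<ominus>\<^bsub>regular_module A\<^esub> x \<in> J" if "x \<in> J" for x
  proof -
    have "x \<otimes> (\<ominus> \<one>) \<in> J" by (rule assms(4)[OF that]) simp
    then show ?thesis using that assms(1) R.act_minus_one(1)[of x] by auto
  qed
  have "additive_subgroup J (regular_module A)"
    unfolding additive_subgroup_def
  proof (rule group.subgroupI[OF R.a_group])
    show "inv\<^bsub>add_monoid (regular_module A)\<^esub> x \<in> J" if "x \<in> J" for x
      using neg[OF that] by (simp only: a_inv_def)
  qed (use assms in auto)
  then show ?thesis
    unfolding gr_ideal_def gr_submodule_def using assms by (auto simp: hpart_regular subset_iff)
qed

lemma gr_ideal_additive: "gr_ideal J \<Longrightarrow> additive_subgroup J (regular_module A)"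
  unfolding gr_ideal_def gr_submodule_def by blast

lemma gr_ideal_subset: "gr_ideal J \<Longrightarrow> J \<subseteq> carrier A"
  using additive_subgroup.a_subset[OF gr_ideal_additive] by simp

lemma gr_ideal_carrier: "\<lbrakk>gr_ideal J; a \<in> J\<rbrakk> \<Longrightarrow> a \<in> carrier A"
  using gr_ideal_subset by blast

lemma gr_ideal_zero: "gr_ideal J \<Longrightarrow> \<zero> \<in> J"
  using additive_subgroup.zero_closed[OF gr_ideal_additive] by simp

lemma gr_ideal_add: "\<lbrakk>gr_ideal J; a \<in> J; b \<in> J\<rbrakk> \<Longrightarrow> a \<oplus> b \<in> J"
  using additive_subgroup.a_closed[OF gr_ideal_additive] by simp

lemma gr_ideal_mult: "\<lbrakk>gr_ideal J; a \<in> J; r \<in> carrier A\<rbrakk> \<Longrightarrow> a \<otimes> r \<in> J"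
  unfolding gr_ideal_def gr_submodule_def by simp

lemma gr_ideal_mult_left: "\<lbrakk>gr_ideal J; a \<in> J; r \<in> carrier A\<rbrakk> \<Longrightarrow> r \<otimes> a \<in> J"
  using gr_ideal_mult gr_ideal_carrier m_comm by metis

lemma gr_ideal_minus: assumes "gr_ideal J" "a \<in> J" shows "\<ominus> a \<in> J"
proof -
  have "a \<otimes> (\<ominus> \<one>) \<in> J" by (rule gr_ideal_mult[OF assms]) simp
  then show ?thesis using gr_ideal_carrier[OF assms] by (simp add: r_minus)
qed

lemma gr_ideal_diff: "\<lbrakk>gr_ideal J; a \<in> J; b \<in> J\<rbrakk> \<Longrightarrow> a \<ominus> b \<in> J"
  unfolding a_minus_def by (intro gr_ideal_add gr_ideal_minus)

lemma gr_ideal_hpart: "\<lbrakk>gr_ideal J; a \<in> J\<rbrakk> \<Longrightarrow> hpart A a i \<in> J"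
  using hpart_regular gr_ideal_carrier unfolding gr_ideal_def gr_submodule_def by metis

lemma gr_ideal_subsetI:
  assumes "gr_ideal J" "gr_ideal K" "\<And>a s. \<lbrakk>a \<in> J; a \<in> component A s\<rbrakk> \<Longrightarrow> a \<in> K"
  shows "J \<subseteq> K"
proof
  fix x assume x: "x \<in> J"
  have xc: "x \<in> carrier A" using gr_ideal_carrier[OF assms(1) x] .
  show "x \<in> K"
  proof (rule hpart_sum_mem[OF xc])
    show "hpart A x i \<in> K" for i
      by (rule assms(3)[OF gr_ideal_hpart[OF assms(1) x] hpart_component[OF xc]])
  qed (use assms gr_ideal_zero gr_ideal_add gr_ideal_subset in auto)
qed

lemma gr_ideal_zero_ideal: "gr_ideal {\<zero>}"
  by (rule gr_idealI) (auto simp: hpart_zero)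

definition colon :: "'a set \<Rightarrow> 'a \<Rightarrow> 'a set" where
  "colon J a = {r \<in> carrier A. a \<otimes> r \<in> J}"

definition adjoin :: "'a set \<Rightarrow> 'a \<Rightarrow> 'a set" where
  "adjoin J a = {u \<oplus> a \<otimes> r | u r. u \<in> J \<and> r \<in> carrier A}"

lemma gr_ideal_colon:
  assumes J: "gr_ideal J" and a: "a \<in> component A s" shows "gr_ideal (colon J a)"
proof (rule gr_idealI)
  have ac: "a \<in> carrier A" using component_carrier a .
  show "\<zero> \<in> colon J a" using ac gr_ideal_zero[OF J] by (simp add: colon_def)
  show "x \<oplus> y \<in> colon J a" if "x \<in> colon J a" "y \<in> colon J a" for x y
    using that ac gr_ideal_add[OF J] by (simp add: colon_def r_distr)
  show "x \<otimes> y \<in> colon J a" if "x \<in> colon J a" "y \<in> carrier A" for x y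
    using that ac gr_ideal_mult[OF J, of "a \<otimes> x" y] by (simp add: colon_def m_assoc)
  show "hpart A x i \<in> colon J a" if "x \<in> colon J a" for x i
    using that ac gr_ideal_hpart[OF J, of "a \<otimes> x" "i + s"] hpart_mult_homogeneous[OF a, of x "i + s"]
    by (simp add: colon_def hpart_carrier)
qed (auto simp: colon_def)

lemma colon_superset: "\<lbrakk>gr_ideal J; a \<in> carrier A\<rbrakk> \<Longrightarrow> J \<subseteq> colon J a"
  using gr_ideal_mult_left gr_ideal_carrier unfolding colon_def by blast

lemma adjoin_superset: assumes "gr_ideal J" "a \<in> carrier A" shows "J \<subseteq> adjoin J a"
proof
  fix u assume u: "u \<in> J"
  then have "u = u \<oplus> a \<otimes> \<zero>" using assms gr_ideal_carrier by simp
  then show "u \<in> adjoin J a" using u unfolding adjoin_def by blast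
qed

lemma adjoin_mem: assumes "gr_ideal J" "a \<in> carrier A" shows "a \<in> adjoin J a"
proof -
  have "a = \<zero> \<oplus> a \<otimes> \<one>" using assms by simp
  then show ?thesis using gr_ideal_zero[OF assms(1)] unfolding adjoin_def by blast
qed

lemma adjoin_least: "\<lbrakk>gr_ideal K; J \<subseteq> K; a \<in> K\<rbrakk> \<Longrightarrow> adjoin J a \<subseteq> K"
  unfolding adjoin_def using gr_ideal_add gr_ideal_mult by blast

lemma gr_ideal_adjoin:
  assumes J: "gr_ideal J" and a: "a \<in> component A s" shows "gr_ideal (adjoin J a)"
proof (rule gr_idealI)
  have ac: "a \<in> carrier A" using component_carrier a .
  note Jc = gr_ideal_carrier[OF J]
  have I: "x \<in> adjoin J a" if "u \<in> J" "r \<in> carrier A" "x = u \<oplus> a \<otimes> r" for x u r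
    using that unfolding adjoin_def by blast
  show "adjoin J a \<subseteq> carrier A" using ac Jc unfolding adjoin_def by auto
  show "\<zero> \<in> adjoin J a" using adjoin_superset[OF J ac] gr_ideal_zero[OF J] by blast
  show "x \<oplus> y \<in> adjoin J a" if xy: "x \<in> adjoin J a" "y \<in> adjoin J a" for x y
  proof -
    from xy obtain u r v q where *: "u \<in> J" "v \<in> J" "r \<in> carrier A" "q \<in> carrier A"
      "x = u \<oplus> a \<otimes> r" "y = v \<oplus> a \<otimes> q" unfolding adjoin_def by blast
    show ?thesis
      by (rule I[of "u \<oplus> v" "r \<oplus> q"]) (use * ac Jc gr_ideal_add[OF J] in \<open>auto simp: r_distr a_ac\<close>)
  qed
  show "x \<otimes> y \<in> adjoin J a" if xy: "x \<in> adjoin J a" "y \<in> carrier A" for x y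
  proof -
    from xy obtain u r where *: "u \<in> J" "r \<in> carrier A" "x = u \<oplus> a \<otimes> r" unfolding adjoin_def by blast
    show ?thesis
      by (rule I[of "u \<otimes> y" "r \<otimes> y"])
        (use * ac Jc xy gr_ideal_mult[OF J] in \<open>auto simp: l_distr m_assoc\<close>)
  qed
  show "hpart A x i \<in> adjoin J a" if xy: "x \<in> adjoin J a" for x i
  proof -
    from xy obtain u r where *: "u \<in> J" "r \<in> carrier A" "x = u \<oplus> a \<otimes> r" unfolding adjoin_def by blast
    show ?thesis
      by (rule I[of "hpart A u i" "hpart A r (i - s)"])
        (use * ac Jc gr_ideal_hpart[OF J] hpart_mult_homogeneous[OF a] in
          \<open>auto simp: hpart_add hpart_carrier\<close>)
  qed
qed

text \<open>When \<open>A\<close> is graded in nonnegative degrees and \<open>X\<close> is a graded ideal, this is the ideal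
  \<open>X + A\<^bsub>\<ge>1\<^esub>\<close>, whose quotient is the degree-zero part of \<open>A/X\<close>.\<close>

definition degree_zero_in :: "'a set \<Rightarrow> 'a set" where
  "degree_zero_in X = {a \<in> carrier A. hpart A a 0 \<in> X}"

end

section \<open>Noetherian local rings with a bounded grading\<close>

text \<open>Locality is required of \<open>A\<^sub>0\<close> in elementary form: one of \<open>a\<close>, \<open>1 - a\<close> has an inverse of degree zero.\<close>

locale local_graded_cring = graded_cring A
  for A :: "('k, 'a, 'e) graded_module_scheme" (structure) +
  fixes l :: int
  assumes noetherian: "gr_noetherian A (regular_module A)"
    and outside: "i < 0 \<or> l < i \<Longrightarrow> component A i = {\<zero>}"
    and local: "a \<in> component A 0 \<Longrightarrow>
      (\<exists>b\<in>component A 0. a \<otimes> b = \<one>) \<or> (\<exists>b\<in>component A 0. (\<one> \<ominus> a) \<otimes> b = \<one>)"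
    and one_neq_zero: "\<one> \<noteq> \<zero>"
begin

lemma add_minus_left:
  assumes "x \<in> carrier A" "y \<in> carrier A" shows "x \<oplus> y \<ominus> x = y"
proof -
  have "x \<oplus> y \<ominus> x = x \<oplus> \<ominus> x \<oplus> y" using assms by (simp add: minus_eq a_ac)
  then show ?thesis using assms by (simp add: r_neg)
qed

lemma mult_degree_zero: "\<lbrakk>a \<in> component A 0; b \<in> component A 0\<rbrakk> \<Longrightarrow> a \<otimes> b \<in> component A 0"
  using component_mult[of a 0 b 0] by simp

text \<open>Without components of negative degree, no product of parts of nonzero degree lands in degree zero.\<close>

lemma hpart_mult_zero:
  assumes a: "a \<in> carrier A" and r: "r \<in> carrier A"
  shows "hpart A (a \<otimes> r) 0 = hpart A a 0 \<otimes> hpart A r 0"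
proof -
  let ?T = "{r \<in> carrier A. hpart A (a \<otimes> r) 0 = hpart A a 0 \<otimes> hpart A r 0}"
  have "r \<in> ?T"
  proof (rule hpart_sum_mem[OF r])
    show "hpart A r i \<in> ?T" for i
    proof -
      have ri: "hpart A r i \<in> component A i" using hpart_component r .
      have rc: "hpart A r i \<in> carrier A" using hpart_carrier r .
      have *: "hpart A (a \<otimes> hpart A r i) 0 = hpart A a (- i) \<otimes> hpart A r i"
        using hpart_homogeneous_mult[OF ri a, of 0] by simp
      show ?thesis
      proof (cases "i = 0")
        case True
        then show ?thesis using * rc hpart_homogeneous[OF ri] by simp
      next
        case False
        have "hpart A a (- i) = \<zero> \<or> hpart A r i = \<zero>"
          using False outside[of i] outside[of "- i"] ri hpart_component[OF a, of "- i"]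
          by (cases "i < 0") auto
        then have "hpart A a (- i) \<otimes> hpart A r i = \<zero>" using hpart_carrier[OF a] rc by auto
        then show ?thesis using * False rc hpart_homogeneous[OF ri] hpart_carrier[OF a] by simp
      qed
    qed
    show "x \<oplus> y \<in> ?T" if "x \<in> ?T" "y \<in> ?T" for x y
      using that a by (simp add: r_distr hpart_add hpart_carrier)
  qed (use a in \<open>auto simp: hpart_zero hpart_carrier\<close>)
  then show ?thesis by simp
qed

lemma gr_ideal_degree_zero_in:
  assumes "\<zero> \<in> X" "\<And>a b. \<lbrakk>a \<in> X; b \<in> X; a \<in> component A 0; b \<in> component A 0\<rbrakk> \<Longrightarrow> a \<oplus> b \<in> X"
    "\<And>a r. \<lbrakk>a \<in> X; a \<in> component A 0; r \<in> component A 0\<rbrakk> \<Longrightarrow> a \<otimes> r \<in> X"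
  shows "gr_ideal (degree_zero_in X)"
proof (rule gr_idealI)
  show "hpart A a i \<in> degree_zero_in X" if a: "a \<in> degree_zero_in X" for a i
  proof -
    have "hpart A (hpart A a i) 0 = (if 0 = i then hpart A a i else \<zero>)"
      using a hpart_homogeneous[OF hpart_component[of a i]] unfolding degree_zero_in_def by simp
    then show ?thesis using a assms(1) by (auto simp: degree_zero_in_def hpart_carrier)
  qed
  show "a \<oplus> b \<in> degree_zero_in X" if "a \<in> degree_zero_in X" "b \<in> degree_zero_in X" for a b
    using that assms(2)[OF _ _ hpart_component hpart_component]
    by (simp add: degree_zero_in_def hpart_add)
  show "a \<otimes> r \<in> degree_zero_in X" if "a \<in> degree_zero_in X" "r \<in> carrier A" for a r
    using that assms(3)[OF _ hpart_component hpart_component]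
    by (simp add: degree_zero_in_def hpart_mult_zero)
qed (use assms(1) in \<open>auto simp: degree_zero_in_def hpart_zero\<close>)

lemma degree_zero_in_superset: "gr_ideal X \<Longrightarrow> X \<subseteq> degree_zero_in X"
  unfolding degree_zero_in_def using gr_ideal_hpart gr_ideal_carrier by blast

lemma gr_ideal_degree_zero_in_ideal: "gr_ideal X \<Longrightarrow> gr_ideal (degree_zero_in X)"
  by (rule gr_ideal_degree_zero_in)
    (blast intro: gr_ideal_zero gr_ideal_add gr_ideal_mult component_carrier)+

lemma degree_zero_in_homogeneous:
  "a \<in> component A s \<Longrightarrow> \<zero> \<in> X \<Longrightarrow> a \<in> degree_zero_in X \<longleftrightarrow> s \<noteq> 0 \<or> a \<in> X"
  using hpart_homogeneous[of a s] component_carrier by (auto simp: degree_zero_in_def)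

definition nonunits :: "'a set" where
  "nonunits = {a \<in> component A 0. \<forall>b\<in>component A 0. a \<otimes> b \<noteq> \<one>}"

lemma nonunitsD: "x \<in> nonunits \<Longrightarrow> x \<in> component A 0" "x \<in> nonunits \<Longrightarrow> x \<in> carrier A"
  unfolding nonunits_def using component_carrier by auto

lemma zero_nonunit: "\<zero> \<in> nonunits"
proof -
  have "\<zero> \<otimes> b \<noteq> \<one>" if "b \<in> component A 0" for b
    using component_carrier[OF that] one_neq_zero by simp
  then show ?thesis unfolding nonunits_def using zero_component by simp
qed

lemma nonunits_mult:
  assumes "a \<in> nonunits" "r \<in> component A 0" shows "a \<otimes> r \<in> nonunits"
  unfolding nonunits_def
proof (intro CollectI conjI ballI)
  show "a \<otimes> r \<in> component A 0" using assms nonunitsD mult_degree_zero by blast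
  fix b assume b: "b \<in> component A 0"
  have "a \<otimes> r \<otimes> b = a \<otimes> (r \<otimes> b)"
    by (rule m_assoc[OF nonunitsD(2)[OF assms(1)] component_carrier[OF assms(2)] component_carrier[OF b]])
  then show "a \<otimes> r \<otimes> b \<noteq> \<one>"
    using assms(1) mult_degree_zero[OF assms(2) b] unfolding nonunits_def by simp
qed

lemma nonunits_add:
  assumes a: "a \<in> nonunits" and b: "b \<in> nonunits" shows "a \<oplus> b \<in> nonunits"
proof (rule ccontr)
  note c = nonunitsD[OF a] nonunitsD[OF b]
  assume "a \<oplus> b \<notin> nonunits"
  then obtain e where e: "e \<in> component A 0" "(a \<oplus> b) \<otimes> e = \<one>"
    unfolding nonunits_def using component_add c by blast
  have ec: "e \<in> carrier A" using component_carrier e(1) .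
  have "a \<otimes> e \<oplus> b \<otimes> e = \<one>" using e(2) ec c by (simp add: l_distr)
  then have "\<one> \<ominus> a \<otimes> e = a \<otimes> e \<oplus> b \<otimes> e \<ominus> a \<otimes> e" by simp
  also have "\<dots> = b \<otimes> e" by (rule add_minus_left) (use ec c in auto)
  finally have "\<one> \<ominus> a \<otimes> e = b \<otimes> e" .
  then show False
    using local[OF mult_degree_zero[OF c(1) e(1)]] nonunits_mult[OF a e(1)] nonunits_mult[OF b e(1)]
    unfolding nonunits_def by auto
qed

lemma one_minus_nonunit:
  assumes "x \<in> nonunits" "r \<in> component A 0"
  obtains c where "c \<in> component A 0" "(\<one> \<ominus> x \<otimes> r) \<otimes> c = \<one>"
  using local[of "x \<otimes> r"] nonunits_mult[OF assms] unfolding nonunits_def by blast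

definition max_ideal :: "'a set" where
  "max_ideal = degree_zero_in nonunits"

lemma gr_ideal_max_ideal: "gr_ideal max_ideal"
  unfolding max_ideal_def
  by (rule gr_ideal_degree_zero_in) (blast intro: zero_nonunit nonunits_add nonunits_mult)+

lemma max_ideal_homogeneous: "a \<in> component A s \<Longrightarrow> a \<in> max_ideal \<longleftrightarrow> s \<noteq> 0 \<or> a \<in> nonunits"
  unfolding max_ideal_def using degree_zero_in_homogeneous zero_nonunit by blast

lemma one_notin_max_ideal: "\<one> \<notin> max_ideal"
proof
  assume "\<one> \<in> max_ideal"
  then have "\<one> \<in> nonunits" using max_ideal_homogeneous[OF one_component] by blast
  then have "\<one> \<otimes> \<one> \<noteq> \<one>" using one_component unfolding nonunits_def by blast
  then show False by simp
qed

lemma proper_subset_max_ideal: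
  assumes J: "gr_ideal J" and "\<one> \<notin> J" shows "J \<subseteq> max_ideal"
proof
  fix a assume a: "a \<in> J"
  have ac: "a \<in> carrier A" using gr_ideal_carrier[OF J a] .
  have "hpart A a 0 \<otimes> b \<noteq> \<one>" if "b \<in> component A 0" for b
  proof
    assume "hpart A a 0 \<otimes> b = \<one>"
    then show False
      using gr_ideal_mult[OF J gr_ideal_hpart[OF J a, of 0] component_carrier[OF that]] assms(2) by simp
  qed
  then show "a \<in> max_ideal"
    using ac hpart_component[OF ac] unfolding max_ideal_def degree_zero_in_def nonunits_def by auto
qed

lemma gr_ideal_maximal:
  assumes "\<S> \<noteq> {}" "\<And>J. J \<in> \<S> \<Longrightarrow> gr_ideal J"
  shows "\<exists>U\<in>\<S>. \<forall>V\<in>\<S>. U \<subseteq> V \<longrightarrow> V = U"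
proof (rule ascending_chains_imp_maximal[OF assms(1)])
  fix f :: "nat \<Rightarrow> 'a set" assume "\<And>n. f n \<in> \<S> \<and> f n \<subseteq> f (Suc n)"
  then show "\<exists>m. \<forall>n\<ge>m. f n = f m"
    using noetherian assms(2) unfolding gr_noetherian_def gr_ideal_def by blast
qed

lemma gr_ideal_generator_induct [consumes 3, case_names base adjoin]:
  assumes X: "gr_ideal X" and J: "gr_ideal J" and sub: "X \<subseteq> J" and base: "P X"
    and step: "\<And>K a s. \<lbrakk>gr_ideal K; X \<subseteq> K; P K; a \<in> component A s\<rbrakk> \<Longrightarrow> P (adjoin K a)"
  shows "P J"
proof -
  let ?S = "{K. gr_ideal K \<and> X \<subseteq> K \<and> K \<subseteq> J \<and> P K}"
  have "\<exists>U\<in>?S. \<forall>V\<in>?S. U \<subseteq> V \<longrightarrow> V = U"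
    by (rule gr_ideal_maximal) (use X sub base in auto)
  then obtain U where "U \<in> ?S" and U_max: "\<forall>V\<in>?S. U \<subseteq> V \<longrightarrow> V = U" by (rule bexE)
  then have U: "gr_ideal U" "X \<subseteq> U" "U \<subseteq> J" "P U" by simp_all
  have max: "V = U" if "gr_ideal V" "X \<subseteq> V" "V \<subseteq> J" "P V" "U \<subseteq> V" for V
    using bspec[OF U_max, of V] that by simp
  have "J \<subseteq> U"
  proof (rule gr_ideal_subsetI[OF J U(1)])
    fix a s assume a: "a \<in> J" "a \<in> component A s"
    have ac: "a \<in> carrier A" using component_carrier a(2) .
    note sup = adjoin_superset[OF U(1) ac]
    have "adjoin U a = U"
      by (rule max[OF gr_ideal_adjoin[OF U(1) a(2)] order_trans[OF U(2) sup]
            adjoin_least[OF J U(3) a(1)] step[OF U(1,2,4) a(2)] sup])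
    then show "a \<in> U" using adjoin_mem[OF U(1) ac] by simp
  qed
  then have "U = J" using U(3) by blast
  then show ?thesis using U(4) by simp
qed

subsection \<open>Associated primes\<close>

text \<open>Primality is required only for homogeneous elements; this is what the arguments below
  produce directly.\<close>

definition gr_prime :: "'a set \<Rightarrow> bool" where
  "gr_prime P \<longleftrightarrow> gr_ideal P \<and> \<one> \<notin> P \<and> (\<forall>s. \<forall>a\<in>component A s. a \<notin> P \<longrightarrow> colon P a = P)"

lemma gr_prime_mult:
  assumes "gr_prime P" "a \<in> component A s" "b \<in> carrier A" "a \<otimes> b \<in> P" "a \<notin> P"
  shows "b \<in> P"
proof -
  have "colon P a = P" using assms unfolding gr_prime_def by blast
  then show ?thesis using assms(3,4) unfolding colon_def by blast
qed

text \<open>Elements of nonzero degree are nilpotent, as the grading is bounded.\<close>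

lemma gr_prime_nonzero_degree:
  assumes P: "gr_prime P" and a: "a \<in> component A s" and s: "s \<noteq> 0"
  shows "a \<in> P"
proof (cases "s < 0")
  case True
  then show ?thesis using outside[of s] a P gr_ideal_zero unfolding gr_prime_def by auto
next
  case False
  have ac: "a \<in> carrier A" using component_carrier a .
  have pow: "a [^] n \<in> component A (int n * s)" for n :: nat
  proof (induction n)
    case (Suc n)
    then show ?case using component_mult[OF Suc a] by (simp add: algebra_simps)
  qed (simp add: one_component)
  show ?thesis
  proof (rule ccontr)
    assume aP: "a \<notin> P"
    have np: "a [^] n \<notin> P" for n :: nat
    proof (induction n)
      case 0
      then show ?case using P unfolding gr_prime_def by simp
    next
      case (Suc n)
      then show ?case
        using gr_prime_mult[OF P a, of "a [^] n"] aP ac nat_pow_Suc2 by auto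
    qed
    have "l < int (nat (l + 1)) * s"
    proof -
      have "int (nat (l + 1)) * 1 \<le> int (nat (l + 1)) * s"
        by (rule mult_left_mono) (use False s in auto)
      then show ?thesis by linarith
    qed
    then have "a [^] nat (l + 1) = \<zero>"
      using outside[of "int (nat (l + 1)) * s"] pow[of "nat (l + 1)"] by simp
    then show False using np[of "nat (l + 1)"] P gr_ideal_zero unfolding gr_prime_def by auto
  qed
qed

definition annihilators :: "'a set \<Rightarrow> 'a set set" where
  "annihilators X = {colon X z | z s. z \<in> component A s \<and> z \<notin> X}"

definition max_annihilators :: "'a set \<Rightarrow> 'a set set" where
  "max_annihilators X = {P \<in> annihilators X. \<forall>Q\<in>annihilators X. P \<subseteq> Q \<longrightarrow> Q = P}"

lemma annihilator_subset_max:
  assumes X: "gr_ideal X" and P: "P \<in> annihilators X"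
  shows "\<exists>Q\<in>max_annihilators X. P \<subseteq> Q"
proof -
  let ?S = "{Q \<in> annihilators X. P \<subseteq> Q}"
  have "\<exists>U\<in>?S. \<forall>V\<in>?S. U \<subseteq> V \<longrightarrow> V = U"
    by (rule gr_ideal_maximal) (use P gr_ideal_colon[OF X] in \<open>auto simp: annihilators_def\<close>)
  then obtain U where "U \<in> ?S" and max: "\<forall>V\<in>?S. U \<subseteq> V \<longrightarrow> V = U" by (rule bexE)
  then have U: "U \<in> annihilators X" "P \<subseteq> U" by simp_all
  have "V = U" if "V \<in> annihilators X" "U \<subseteq> V" for V
    using bspec[OF max, of V] that U(2) by simp
  then have "U \<in> max_annihilators X" using U(1) unfolding max_annihilators_def by simp
  then show ?thesis using U(2) by (rule rev_bexI)
qed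

text \<open>If \<open>a\<close> is not in \<open>P = (X : z)\<close> then \<open>za\<close> is nonzero modulo \<open>X\<close> and \<open>(X : za)\<close> contains \<open>P\<close>, so
  it equals \<open>P\<close> by maximality.\<close>

lemma max_annihilator_prime:
  assumes X: "gr_ideal X" and P: "P \<in> max_annihilators X" shows "gr_prime P"
proof -
  obtain z s where z: "z \<in> component A s" "z \<notin> X" "P = colon X z"
    using P unfolding max_annihilators_def annihilators_def by blast
  have zc: "z \<in> carrier A" using component_carrier z(1) .
  have Pi: "gr_ideal P" unfolding z(3) by (rule gr_ideal_colon[OF X z(1)])
  have "colon P a = P" if a: "a \<in> component A t" "a \<notin> P" for t a
  proof -
    have ac: "a \<in> carrier A" using component_carrier a(1) .
    have eq: "colon P a = colon X (z \<otimes> a)"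
      using ac zc by (auto simp: z(3) colon_def m_assoc)
    have "z \<otimes> a \<notin> X" using a ac z(3) unfolding colon_def by blast
    then have "colon P a \<in> annihilators X"
      using component_mult[OF z(1) a(1)] unfolding eq annihilators_def by blast
    then show ?thesis
      using P colon_superset[OF Pi ac] unfolding max_annihilators_def by blast
  qed
  moreover have "\<one> \<notin> P" using z zc by (simp add: colon_def)
  ultimately show ?thesis using Pi unfolding gr_prime_def by blast
qed

lemma gr_prime_Inter:
  assumes P: "gr_prime P" and F: "finite F" "\<And>Q. Q \<in> F \<Longrightarrow> gr_ideal Q" 
    and sub: "carrier A \<inter> \<Inter>F \<subseteq> P"
  shows "\<exists>Q\<in>F. Q \<subseteq> P"
proof (rule ccontr)
  assume no: "\<not> ?thesis"
  have "\<exists>y\<in>component A 0. y \<notin> P \<and> (\<forall>Q\<in>G. y \<in> Q)" if "G \<subseteq> F" for G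
    using finite_subset[OF that F(1)] that
  proof (induction G rule: finite_induct)
    case empty
    show ?case using P one_component unfolding gr_prime_def by blast
  next
    case (insert Q G)
    then obtain y where y: "y \<in> component A 0" "y \<notin> P" "\<forall>Q\<in>G. y \<in> Q" by auto
    have Q: "gr_ideal Q" "\<not> Q \<subseteq> P" using insert no F(2) by auto
    then obtain q s where q: "q \<in> Q" "q \<in> component A s" "q \<notin> P"
      using gr_ideal_subsetI[of Q P] P unfolding gr_prime_def by blast
    have s: "s = 0" using gr_prime_nonzero_degree[OF P q(2)] q(3) by blast
    note c = component_carrier[OF y(1)] component_carrier[OF q(2)]
    show ?case
    proof (intro bexI conjI ballI)
      show "y \<otimes> q \<in> component A 0" using mult_degree_zero y q s by blast
      show "y \<otimes> q \<notin> P" using gr_prime_mult[OF P y(1) c(2)] y q by blast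
      show "y \<otimes> q \<in> Q'" if "Q' \<in> insert Q G" for Q'
        using that gr_ideal_mult[of Q' y q] gr_ideal_mult_left[OF Q(1) q(1) c(1)] y c F(2) insert.prems
        by auto
    qed
  qed
  from this[of F] show False using sub component_carrier by blast
qed

text \<open>Take a graded ideal \<open>U\<close> containing \<open>X\<close> that is maximal among those killed modulo \<open>X\<close> by a finite
  intersection of maximal annihilators. If \<open>P = (X : z)\<close> is a maximal annihilator, then \<open>U + zA\<close> is
  again of this kind, so \<open>z\<close> lies in \<open>U\<close>, and \<open>P\<close> contains the finite intersection, hence one of its
  members.\<close>

lemma finite_max_annihilators:
  assumes X: "gr_ideal X" shows "finite (max_annihilators X)"
proof -
  define Q where "Q K F \<longleftrightarrow> finite F \<and> F \<subseteq> max_annihilators X \<and>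
      (\<forall>r\<in>carrier A. r \<in> \<Inter>F \<longrightarrow> (\<forall>k\<in>K. k \<otimes> r \<in> X))" for K F
  define S where "S = {K. gr_ideal K \<and> (\<exists>F. Q K F)}"
  have "Q X {}" unfolding Q_def using gr_ideal_mult[OF X] by simp
  then have "X \<in> S" unfolding S_def using X by blast
  have "\<exists>U\<in>S. \<forall>V\<in>S. U \<subseteq> V \<longrightarrow> V = U"
    by (rule gr_ideal_maximal) (use \<open>X \<in> S\<close> in \<open>auto simp: S_def\<close>)
  then obtain U where "U \<in> S" and U_max: "\<forall>V\<in>S. U \<subseteq> V \<longrightarrow> V = U" by (rule bexE)
  then obtain F where U: "gr_ideal U" and UF: "Q U F" unfolding S_def by blast
  then have F: "finite F" "F \<subseteq> max_annihilators X"
    and F_ann: "\<And>r k. \<lbrakk>r \<in> carrier A; r \<in> \<Inter>F; k \<in> U\<rbrakk> \<Longrightarrow> k \<otimes> r \<in> X"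
    unfolding Q_def by simp_all
  have "P \<in> F" if P: "P \<in> max_annihilators X" for P
  proof -
    obtain z s where z: "z \<in> component A s" "z \<notin> X" "P = colon X z"
      using P unfolding max_annihilators_def annihilators_def by blast
    have zc: "z \<in> carrier A" using component_carrier z(1) .
    have "k \<otimes> r \<in> X" if r: "r \<in> carrier A" "r \<in> \<Inter>(insert P F)" and k: "k \<in> adjoin U z" for r k
    proof -
      obtain u q where uq: "u \<in> U" "q \<in> carrier A" "k = u \<oplus> z \<otimes> q"
        using k unfolding adjoin_def by blast
      have uc: "u \<in> carrier A" using gr_ideal_carrier[OF U uq(1)] .
      have zr: "z \<otimes> r \<in> X" using r z(3) by (simp add: colon_def)
      have ur: "u \<otimes> r \<in> X" using F_ann[OF r(1) _ uq(1)] r(2) by simp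
      have "z \<otimes> q \<otimes> r = z \<otimes> r \<otimes> q" using uq(2) r(1) zc by (simp add: m_ac)
      then have "k \<otimes> r = u \<otimes> r \<oplus> z \<otimes> r \<otimes> q"
        unfolding uq(3) using uq(2) uc r(1) zc by (simp add: l_distr)
      then show ?thesis
        using gr_ideal_add[OF X ur gr_ideal_mult[OF X zr uq(2)]] by simp
    qed
    then have "Q (adjoin U z) (insert P F)" unfolding Q_def using F P by blast
    then have "adjoin U z \<in> S" unfolding S_def using gr_ideal_adjoin[OF U z(1)] by blast
    then have "adjoin U z = U" using U_max adjoin_superset[OF U zc] by blast
    then have zU: "z \<in> U" using adjoin_mem[OF U zc] by simp
    have "carrier A \<inter> \<Inter>F \<subseteq> P" using F_ann[OF _ _ zU] unfolding z(3) colon_def by blast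
    moreover have "gr_ideal K" if "K \<in> F" for K
      using max_annihilator_prime[OF X subsetD[OF F(2) that]] unfolding gr_prime_def by (elim conjE)
    ultimately obtain K where K: "K \<in> F" "K \<subseteq> P"
      using gr_prime_Inter[OF max_annihilator_prime[OF X P] F(1)] by blast
    then have "P = K" using P F(2) unfolding max_annihilators_def by blast
    then show ?thesis using K by simp
  qed
  then show ?thesis using F(1) finite_subset[of "max_annihilators X" F] by blast
qed

text \<open>Pairwise incomparability makes each step of the induction easy: if \<open>x\<close> avoids all primes but \<open>P\<close>,
  add to it a nonunit outside \<open>P\<close> that lies in all the others.\<close>

lemma prime_avoidance:
  assumes F: "finite F" "\<And>P. P \<in> F \<Longrightarrow> gr_prime P" "\<And>P. P \<in> F \<Longrightarrow> \<not> nonunits \<subseteq> P"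
    and incomparable: "\<And>P Q. \<lbrakk>P \<in> F; Q \<in> F; Q \<subseteq> P\<rbrakk> \<Longrightarrow> P = Q"
  shows "\<exists>x\<in>nonunits. \<forall>P\<in>F. x \<notin> P"
  using assms
proof (induction F rule: finite_induct)
  case empty
  then show ?case using zero_nonunit by blast
next
  case (insert P F)
  have "\<exists>x\<in>nonunits. \<forall>P\<in>F. x \<notin> P"
  proof (rule insert.IH)
    show "gr_prime Q" if "Q \<in> F" for Q using insert.prems(1) that by simp
    show "\<not> nonunits \<subseteq> Q" if "Q \<in> F" for Q using insert.prems(2) that by simp
    show "Q = Q'" if "Q \<in> F" "Q' \<in> F" "Q' \<subseteq> Q" for Q Q' using insert.prems(3) that by simp
  qed
  then obtain x where x: "x \<in> nonunits" "\<forall>Q\<in>F. x \<notin> Q" by (rule bexE)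
  have P: "gr_prime P" using insert.prems(1) by simp
  have gi: "gr_ideal Q" if "Q \<in> insert P F" for Q
    using insert.prems(1)[OF that] unfolding gr_prime_def by (elim conjE)
  show ?case
  proof (cases "x \<in> P")
    case True
    obtain y0 where y0: "y0 \<in> nonunits" "y0 \<notin> P" using insert.prems(2)[of P] by blast
    have "\<not> (carrier A \<inter> \<Inter>F \<subseteq> P)"
    proof
      assume "carrier A \<inter> \<Inter>F \<subseteq> P"
      then obtain Q where Q: "Q \<in> F" "Q \<subseteq> P"
        using gr_prime_Inter[OF P insert.hyps(1) gi] by blast
      then have "P = Q" by (intro insert.prems(3)) simp_all
      then show False using Q insert.hyps(2) by simp
    qed
    then obtain q0 where q0: "q0 \<in> carrier A" "\<forall>Q\<in>F. q0 \<in> Q" "q0 \<notin> P" by blast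
    have "\<exists>i. hpart A q0 i \<notin> P"
    proof (rule ccontr)
      assume "\<not> ?thesis"
      then have "q0 \<in> P"
        by (intro hpart_sum_mem[OF q0(1)])
          (simp_all add: gi gr_ideal_zero gr_ideal_add gr_ideal_subset)
      then show False using q0 by blast
    qed
    then obtain i where i: "hpart A q0 i \<notin> P" by blast
    define q where "q = hpart A q0 i"
    have q: "q \<in> component A i" "q \<notin> P" "\<forall>Q\<in>F. q \<in> Q"
      using i hpart_component[OF q0(1)] q0(2) gr_ideal_hpart[OF gi] unfolding q_def by simp_all
    have "i = 0" using gr_prime_nonzero_degree[OF P q(1)] q(2) by blast
    then have q0: "q \<in> component A 0" using q(1) by simp
    define y where "y = y0 \<otimes> q"
    have y: "y \<in> nonunits" "y \<notin> P" "\<forall>Q\<in>F. y \<in> Q"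
      unfolding y_def
      using nonunits_mult[OF y0(1) q0]
        gr_prime_mult[OF P nonunitsD(1)[OF y0(1)] component_carrier[OF q0]] y0(2) q
        gr_ideal_mult_left[OF gi _ nonunitsD(2)[OF y0(1)]] by blast+
    have "x \<oplus> y \<notin> P"
    proof
      assume "x \<oplus> y \<in> P"
      then have "x \<oplus> y \<ominus> x \<in> P" using gr_ideal_diff[OF gi _ True] by simp
      moreover have "x \<oplus> y \<ominus> x = y"
        by (rule add_minus_left[OF nonunitsD(2)[OF x(1)] nonunitsD(2)[OF y(1)]])
      ultimately show False using y by simp
    qed
    moreover have "x \<oplus> y \<notin> Q" if Q: "Q \<in> F" for Q
    proof
      assume "x \<oplus> y \<in> Q"
      then have "y \<oplus> x \<in> Q" using a_comm nonunitsD(2) x(1) y(1) by simp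
      then have "y \<oplus> x \<ominus> y \<in> Q" using gr_ideal_diff[OF gi] Q y(3) by simp
      moreover have "y \<oplus> x \<ominus> y = x"
        by (rule add_minus_left[OF nonunitsD(2)[OF y(1)] nonunitsD(2)[OF x(1)]])
      ultimately show False using x Q by simp
    qed
    ultimately show ?thesis using nonunits_add[OF x(1) y(1)] by blast
  qed (use x in blast)
qed

text \<open>A nonunit avoiding the finitely many maximal annihilators would be regular modulo \<open>X\<close>. So some
  maximal annihilator contains all nonunits of degree zero, and it contains the elements of nonzero
  degree anyway.\<close>

lemma max_ideal_annihilator:
  assumes X: "gr_ideal X" and zero_divisors: "\<And>x. x \<in> nonunits \<Longrightarrow> colon X x \<noteq> X"
  obtains z s where "z \<in> component A s" "colon X z = max_ideal"
proof -
  have "\<exists>P\<in>max_annihilators X. nonunits \<subseteq> P"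
  proof (rule ccontr)
    assume "\<not> ?thesis"
    then have "\<exists>x\<in>nonunits. \<forall>P\<in>max_annihilators X. x \<notin> P"
    proof (intro prime_avoidance[OF finite_max_annihilators[OF X] max_annihilator_prime[OF X]])
      show "P = Q" if "P \<in> max_annihilators X" "Q \<in> max_annihilators X" "Q \<subseteq> P" for P Q
        using that unfolding max_annihilators_def by blast
    qed blast+
    then obtain x where x: "x \<in> nonunits" "\<forall>P\<in>max_annihilators X. x \<notin> P" by blast
    note xc = nonunitsD[OF x(1)]
    have "\<not> colon X x \<subseteq> X"
      using zero_divisors[OF x(1)] colon_superset[OF X xc(2)] by blast
    then obtain r s where r: "r \<in> colon X x" "r \<in> component A s" "r \<notin> X"
      using gr_ideal_subsetI[OF gr_ideal_colon[OF X xc(1)] X] by blast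
    have "r \<otimes> x = x \<otimes> r" by (rule m_comm[OF component_carrier[OF r(2)] xc(2)])
    then have "x \<in> colon X r" using r(1) xc(2) by (simp add: colon_def)
    moreover have "colon X r \<in> annihilators X" using r(2,3) unfolding annihilators_def by blast
    ultimately show False using annihilator_subset_max[OF X] x(2) by blast
  qed
  then obtain P where P: "P \<in> max_annihilators X" "nonunits \<subseteq> P" by blast
  have prime: "gr_prime P" using max_annihilator_prime[OF X P(1)] .
  have Pi: "gr_ideal P" "\<one> \<notin> P" using prime unfolding gr_prime_def by auto
  have "max_ideal \<subseteq> P"
  proof (rule gr_ideal_subsetI[OF gr_ideal_max_ideal Pi(1)])
    show "a \<in> P" if "a \<in> max_ideal" "a \<in> component A s" for a s
      using that gr_prime_nonzero_degree[OF prime that(2)] max_ideal_homogeneous[OF that(2)] P(2)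
      by blast
  qed
  then have "P = max_ideal" using proper_subset_max_ideal[OF Pi] by blast
  then show thesis using P(1) that unfolding max_annihilators_def annihilators_def by blast
qed

subsection \<open>Regular sequences in degree zero\<close>

text \<open>\<open>regular_ideal t X\<close> says that \<open>X\<close> is generated by a regular sequence of length \<open>t\<close> consisting of
  nonunits of degree zero.\<close>

inductive regular_ideal :: "nat \<Rightarrow> 'a set \<Rightarrow> bool" where
  zero: "regular_ideal 0 {\<zero>}"
| adjoin: "\<lbrakk>regular_ideal t X; x \<in> nonunits; colon X x = X\<rbrakk> \<Longrightarrow> regular_ideal (Suc t) (adjoin X x)"

lemma regular_ideal_ideal:
  assumes "regular_ideal t X" shows "gr_ideal X" "\<one> \<notin> X"
proof -
  have "gr_ideal X \<and> X \<subseteq> max_ideal" using assms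
  proof induction
    case zero
    then show ?case using gr_ideal_zero_ideal gr_ideal_zero[OF gr_ideal_max_ideal] by simp
  next
    case (adjoin t X x)
    have "x \<in> max_ideal"
      using max_ideal_homogeneous[OF nonunitsD(1)[OF adjoin.hyps(2)]] adjoin.hyps(2) by simp
    then show ?case
      using adjoin.IH gr_ideal_adjoin[OF _ nonunitsD(1)[OF adjoin.hyps(2)], of X]
        adjoin_least[OF gr_ideal_max_ideal, of X x] by simp
  qed
  then show "gr_ideal X" "\<one> \<notin> X" using one_notin_max_ideal by blast+
qed

lemma maximal_regular_ideal:
  obtains t X z s where "regular_ideal t X" "z \<in> component A s" "colon X z = max_ideal"
proof -
  let ?S = "{X. \<exists>t. regular_ideal t X}"
  have "\<exists>U\<in>?S. \<forall>V\<in>?S. U \<subseteq> V \<longrightarrow> V = U"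
    by (rule gr_ideal_maximal) (use regular_ideal_ideal(1) regular_ideal.zero in blast)+
  then obtain X where "X \<in> ?S" and X_max: "\<forall>V\<in>?S. X \<subseteq> V \<longrightarrow> V = X" by (rule bexE)
  then obtain t where t: "regular_ideal t X" by blast
  have max: "V = X" if "regular_ideal u V" "X \<subseteq> V" for u V
    using bspec[OF X_max, of V] that by blast
  have X: "gr_ideal X" "\<one> \<notin> X" using regular_ideal_ideal[OF t] by auto
  have "colon X x \<noteq> X" if x: "x \<in> nonunits" for x
  proof
    assume eq: "colon X x = X"
    note xc = nonunitsD[OF x]
    have "x \<in> X"
      using max[OF regular_ideal.adjoin[OF t x eq] adjoin_superset[OF X(1) xc(2)]]
        adjoin_mem[OF X(1) xc(2)] by simp
    then have "\<one> \<in> colon X x" using xc by (simp add: colon_def)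
    then show False using eq X by simp
  qed
  then show thesis using max_ideal_annihilator[OF X(1)] that[OF t] by blast
qed

end

section \<open>Torsion subcomplexes of a complex of injectives\<close>

locale injective_complex = graded_cring A
  for A :: "('k, 'a, 'e) graded_module_scheme" (structure) +
  fixes I :: "nat \<Rightarrow> ('a, 'c) graded_module" and d :: "nat \<Rightarrow> 'c \<Rightarrow> 'c"
  assumes injective: "gr_injective A (I n)"
    and d_hom: "d n \<in> gr_hom A (I n) (I (Suc n))"
    and d_d: "x \<in> carrier (I n) \<Longrightarrow> d (Suc n) (d n x) = \<zero>\<^bsub>I (Suc (Suc n))\<^esub>"
begin

sublocale I: graded_right_module A "I n" for n
  using injective unfolding gr_injective_def by blast

lemma d_closed: "x \<in> carrier (I n) \<Longrightarrow> d n x \<in> carrier (I (Suc n))"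
  using d_hom[of n] unfolding gr_hom_def by blast

lemma d_add: "\<lbrakk>x \<in> carrier (I n); y \<in> carrier (I n)\<rbrakk> \<Longrightarrow> d n (x \<oplus>\<^bsub>I n\<^esub> y) = d n x \<oplus>\<^bsub>I (Suc n)\<^esub> d n y"
  using d_hom[of n] unfolding gr_hom_def by blast

lemma d_act: "\<lbrakk>a \<in> carrier A; x \<in> carrier (I n)\<rbrakk> \<Longrightarrow> d n (a \<odot>\<^bsub>I n\<^esub> x) = a \<odot>\<^bsub>I (Suc n)\<^esub> d n x"
  using d_hom[of n] unfolding gr_hom_def by blast

lemma d_component: "x \<in> component (I n) j \<Longrightarrow> d n x \<in> component (I (Suc n)) j"
  using d_hom[of n] unfolding gr_hom_def by blast

lemma act_zero: assumes "a \<in> carrier A" shows "a \<odot>\<^bsub>I n\<^esub> \<zero>\<^bsub>I n\<^esub> = \<zero>\<^bsub>I n\<^esub>"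
proof -
  have "a \<odot>\<^bsub>I n\<^esub> (\<zero> \<odot>\<^bsub>I n\<^esub> \<zero>\<^bsub>I n\<^esub>) = (\<zero> \<otimes> a) \<odot>\<^bsub>I n\<^esub> \<zero>\<^bsub>I n\<^esub>"
    by (rule I.act_assoc[symmetric]) (use assms in simp_all)
  then show ?thesis using I.act_minus_one(2)[of "\<zero>\<^bsub>I n\<^esub>" n] assms by simp
qed

lemma d_zero: "d n \<zero>\<^bsub>I n\<^esub> = \<zero>\<^bsub>I (Suc n)\<^esub>"
  using d_act[of \<zero> "\<zero>\<^bsub>I n\<^esub>" n] I.act_minus_one(2)[of "\<zero>\<^bsub>I n\<^esub>" n] d_closed[of "\<zero>\<^bsub>I n\<^esub>" n]
    I.act_minus_one(2)[of "d n \<zero>\<^bsub>I n\<^esub>" "Suc n"] by simp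

lemma diff_eq:
  assumes "x \<in> carrier (I n)" "y \<in> carrier (I n)"
  shows "x \<ominus>\<^bsub>I n\<^esub> y = x \<oplus>\<^bsub>I n\<^esub> (\<ominus> \<one>) \<odot>\<^bsub>I n\<^esub> y"
  using assms I.act_minus_one(1) by (simp add: a_minus_def)

lemma diff_add_cancel:
  assumes "x \<in> carrier (I n)" "y \<in> carrier (I n)"
  shows "(x \<ominus>\<^bsub>I n\<^esub> y) \<oplus>\<^bsub>I n\<^esub> y = x" "x \<ominus>\<^bsub>I n\<^esub> (x \<ominus>\<^bsub>I n\<^esub> y) = y"
proof -
  show "(x \<ominus>\<^bsub>I n\<^esub> y) \<oplus>\<^bsub>I n\<^esub> y = x"
    using assms by (simp add: a_minus_def I.a_assoc I.l_neg)
  have "x \<ominus>\<^bsub>I n\<^esub> (x \<ominus>\<^bsub>I n\<^esub> y) = (x \<oplus>\<^bsub>I n\<^esub> \<ominus>\<^bsub>I n\<^esub> x) \<oplus>\<^bsub>I n\<^esub> y"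
    using assms by (simp add: a_minus_def I.minus_add I.a_assoc)
  then show "x \<ominus>\<^bsub>I n\<^esub> (x \<ominus>\<^bsub>I n\<^esub> y) = y" using assms by (simp add: I.r_neg)
qed

lemma act_diff:
  assumes "a \<in> carrier A" "x \<in> carrier (I n)" "y \<in> carrier (I n)"
  shows "a \<odot>\<^bsub>I n\<^esub> (x \<ominus>\<^bsub>I n\<^esub> y) = a \<odot>\<^bsub>I n\<^esub> x \<ominus>\<^bsub>I n\<^esub> a \<odot>\<^bsub>I n\<^esub> y"
proof -
  have "a \<odot>\<^bsub>I n\<^esub> ((\<ominus> \<one>) \<odot>\<^bsub>I n\<^esub> y) = (\<ominus> \<one>) \<odot>\<^bsub>I n\<^esub> (a \<odot>\<^bsub>I n\<^esub> y)"
    using assms I.act_assoc[of "\<ominus> \<one>" a y n, symmetric] I.act_assoc[of a "\<ominus> \<one>" y n, symmetric]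
    by (simp add: m_comm)
  then show ?thesis using assms by (simp add: diff_eq I.act_add I.act_closed)
qed

lemma act_diff_scalar:
  assumes "a \<in> carrier A" "b \<in> carrier A" "x \<in> carrier (I n)"
  shows "(a \<ominus> b) \<odot>\<^bsub>I n\<^esub> x = a \<odot>\<^bsub>I n\<^esub> x \<ominus>\<^bsub>I n\<^esub> b \<odot>\<^bsub>I n\<^esub> x"
proof -
  have "(\<ominus> b) \<odot>\<^bsub>I n\<^esub> x = (b \<otimes> \<ominus> \<one>) \<odot>\<^bsub>I n\<^esub> x" using assms by (simp add: r_minus)
  also have "\<dots> = (\<ominus> \<one>) \<odot>\<^bsub>I n\<^esub> (b \<odot>\<^bsub>I n\<^esub> x)" using assms by (intro I.act_assoc) auto
  finally show ?thesis using assms by (simp add: minus_eq diff_eq I.act_add_scalar I.act_closed)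
qed

lemma d_diff:
  assumes "x \<in> carrier (I n)" "y \<in> carrier (I n)"
  shows "d n (x \<ominus>\<^bsub>I n\<^esub> y) = d n x \<ominus>\<^bsub>I (Suc n)\<^esub> d n y"
  using assms by (simp add: diff_eq d_add d_act d_closed I.act_closed)

lemma act_comm:
  assumes "a \<in> carrier A" "b \<in> carrier A" "x \<in> carrier (I n)"
  shows "a \<odot>\<^bsub>I n\<^esub> (b \<odot>\<^bsub>I n\<^esub> x) = b \<odot>\<^bsub>I n\<^esub> (a \<odot>\<^bsub>I n\<^esub> x)"
  using assms by (simp add: I.act_assoc[symmetric] m_comm)

text \<open>An element \<open>y\<close> of \<open>torsion n J j\<close> corresponds to the graded homomorphism \<open>A/J \<rightarrow> (I n)(j)\<close>
  sending \<open>1\<close> to \<open>y\<close>. So if \<open>I\<close> resolves \<open>A\<close>, the cohomology of these groups is \<open>Ext(A/J, A(j))\<close>, and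
  \<open>Ext_zero n J j\<close> expresses that its \<open>n\<close>-th group vanishes.\<close>

definition torsion :: "nat \<Rightarrow> 'a set \<Rightarrow> int \<Rightarrow> 'c set" where
  "torsion n J j = {y \<in> component (I n) j. \<forall>a\<in>J. a \<odot>\<^bsub>I n\<^esub> y = \<zero>\<^bsub>I n\<^esub>}"

definition cycles :: "nat \<Rightarrow> 'a set \<Rightarrow> int \<Rightarrow> 'c set" where
  "cycles n J j = {y \<in> torsion n J j. d n y = \<zero>\<^bsub>I (Suc n)\<^esub>}"

definition boundaries :: "nat \<Rightarrow> 'a set \<Rightarrow> int \<Rightarrow> 'c set" where
  "boundaries n J j = (case n of 0 \<Rightarrow> {\<zero>\<^bsub>I n\<^esub>} | Suc m \<Rightarrow> d m ` torsion m J j)"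

definition Ext_zero :: "nat \<Rightarrow> 'a set \<Rightarrow> int \<Rightarrow> bool" where
  "Ext_zero n J j \<longleftrightarrow> cycles n J j \<subseteq> boundaries n J j"

lemma boundaries_0: "boundaries 0 J j = {\<zero>\<^bsub>I 0\<^esub>}" by (simp add: boundaries_def)

lemma boundaries_Suc: "boundaries (Suc n) J j = d n ` torsion n J j" by (simp add: boundaries_def)

lemma torsionI:
  "\<lbrakk>y \<in> component (I n) j; \<And>a. a \<in> J \<Longrightarrow> a \<odot>\<^bsub>I n\<^esub> y = \<zero>\<^bsub>I n\<^esub>\<rbrakk> \<Longrightarrow> y \<in> torsion n J j"
  by (simp add: torsion_def)

lemma torsionD: "\<lbrakk>y \<in> torsion n J j; a \<in> J\<rbrakk> \<Longrightarrow> a \<odot>\<^bsub>I n\<^esub> y = \<zero>\<^bsub>I n\<^esub>"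
  by (simp add: torsion_def)

lemma torsion_component: "y \<in> torsion n J j \<Longrightarrow> y \<in> component (I n) j"
  by (simp add: torsion_def)

lemma torsion_carrier: "y \<in> torsion n J j \<Longrightarrow> y \<in> carrier (I n)"
  using I.component_carrier torsion_component by blast

lemma cycles_torsion: "y \<in> cycles n J j \<Longrightarrow> y \<in> torsion n J j"
  by (simp add: cycles_def)

lemma cycles_carrier: "y \<in> cycles n J j \<Longrightarrow> y \<in> carrier (I n)"
  using torsion_carrier cycles_torsion by blast

lemma torsion_antimono: "J \<subseteq> K \<Longrightarrow> torsion n K j \<subseteq> torsion n J j"
  unfolding torsion_def by blast

lemma cycles_antimono: "J \<subseteq> K \<Longrightarrow> cycles n K j \<subseteq> cycles n J j"
  unfolding cycles_def using torsion_antimono[of J K n j] by blast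

lemma boundaries_antimono: "J \<subseteq> K \<Longrightarrow> boundaries n K j \<subseteq> boundaries n J j"
  unfolding boundaries_def using torsion_antimono[of J K _ j] by (cases n) auto

lemma torsion_act:
  assumes "J \<subseteq> carrier A" "y \<in> torsion n J j" "a \<in> component A s"
  shows "a \<odot>\<^bsub>I n\<^esub> y \<in> torsion n J (j + s)"
proof (rule torsionI)
  show "a \<odot>\<^bsub>I n\<^esub> y \<in> component (I n) (j + s)"
    using I.act_component assms(3) torsion_component[OF assms(2)] .
  have ac: "a \<in> carrier A" using component_carrier assms(3) .
  show "b \<odot>\<^bsub>I n\<^esub> (a \<odot>\<^bsub>I n\<^esub> y) = \<zero>\<^bsub>I n\<^esub>" if "b \<in> J" for b
    using act_comm[of b a y n] that assms(1) ac torsion_carrier[OF assms(2)]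
      torsionD[OF assms(2) that] act_zero[OF ac] by auto
qed

lemma torsion_zero: "J \<subseteq> carrier A \<Longrightarrow> \<zero>\<^bsub>I n\<^esub> \<in> torsion n J j"
  by (rule torsionI) (use I.zero_component act_zero in auto)

lemma component_add_I:
  "\<lbrakk>x \<in> component (I n) j; y \<in> component (I n) j\<rbrakk> \<Longrightarrow> x \<oplus>\<^bsub>I n\<^esub> y \<in> component (I n) j"
  by (rule additive_subgroup.a_closed[OF I.component_subgroup])

lemma torsion_add:
  assumes "J \<subseteq> carrier A" "x \<in> torsion n J j" "y \<in> torsion n J j"
  shows "x \<oplus>\<^bsub>I n\<^esub> y \<in> torsion n J j"
proof (rule torsionI)
  show "x \<oplus>\<^bsub>I n\<^esub> y \<in> component (I n) j"
    using component_add_I torsion_component assms by blast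
  show "b \<odot>\<^bsub>I n\<^esub> (x \<oplus>\<^bsub>I n\<^esub> y) = \<zero>\<^bsub>I n\<^esub>" if "b \<in> J" for b
    using I.act_add[of b x n y] that assms(1) torsion_carrier assms(2,3) torsionD by auto
qed

lemma minus_one_component: "\<ominus> \<one> \<in> component A 0"
  by (intro component_minus one_component)

lemma torsion_diff:
  assumes "J \<subseteq> carrier A" "x \<in> torsion n J j" "y \<in> torsion n J j"
  shows "x \<ominus>\<^bsub>I n\<^esub> y \<in> torsion n J j"
  using torsion_add[OF assms(1,2) torsion_act[OF assms(1,3) minus_one_component, simplified]]
    diff_eq torsion_carrier assms(2,3) by simp

lemma torsion_d:
  assumes "J \<subseteq> carrier A" "y \<in> torsion n J j" shows "d n y \<in> torsion (Suc n) J j"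
proof (rule torsionI)
  show "d n y \<in> component (I (Suc n)) j" using d_component torsion_component assms(2) .
  show "a \<odot>\<^bsub>I (Suc n)\<^esub> d n y = \<zero>\<^bsub>I (Suc n)\<^esub>" if "a \<in> J" for a
  proof -
    have "a \<in> carrier A" using that assms(1) by blast
    then show ?thesis
      using d_act[of a y n] torsion_carrier[OF assms(2)] torsionD[OF assms(2) that] d_zero by simp
  qed
qed

lemma boundaries_subset_cycles:
  assumes "J \<subseteq> carrier A" shows "boundaries n J j \<subseteq> cycles n J j"
proof (cases n)
  case 0
  then show ?thesis using torsion_zero[OF assms] d_zero by (simp add: boundaries_0 cycles_def)
next
  case (Suc m)
  then show ?thesis
    using torsion_d[OF assms] d_d torsion_carrier by (auto simp: boundaries_Suc cycles_def)
qed

lemma cycles_add: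
  assumes "J \<subseteq> carrier A" "x \<in> cycles n J j" "y \<in> cycles n J j"
  shows "x \<oplus>\<^bsub>I n\<^esub> y \<in> cycles n J j"
  using assms torsion_add[OF assms(1)] d_add[OF cycles_carrier[OF assms(2)] cycles_carrier[OF assms(3)]]
  by (simp add: cycles_def)

lemma cycles_act:
  assumes "J \<subseteq> carrier A" "y \<in> cycles n J j" "a \<in> component A s"
  shows "a \<odot>\<^bsub>I n\<^esub> y \<in> cycles n J (j + s)"
  using assms torsion_act[OF assms(1)] d_act[OF component_carrier[OF assms(3)] cycles_carrier[OF assms(2)]]
    act_zero[OF component_carrier[OF assms(3)]] by (simp add: cycles_def)

lemma cycles_diff:
  assumes "J \<subseteq> carrier A" "x \<in> cycles n J j" "y \<in> cycles n J j"
  shows "x \<ominus>\<^bsub>I n\<^esub> y \<in> cycles n J j"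
  using cycles_add[OF assms(1,2) cycles_act[OF assms(1,3) minus_one_component, simplified]]
    diff_eq cycles_carrier assms(2,3) by simp

lemma boundaries_zero: "J \<subseteq> carrier A \<Longrightarrow> \<zero>\<^bsub>I n\<^esub> \<in> boundaries n J j"
proof (cases n)
  case (Suc m)
  assume "J \<subseteq> carrier A"
  then show ?thesis
    using image_eqI[of _ "d m", OF d_zero[symmetric] torsion_zero] by (simp add: Suc boundaries_Suc)
qed (simp add: boundaries_0)

lemma boundaries_carrier: "J \<subseteq> carrier A \<Longrightarrow> y \<in> boundaries n J j \<Longrightarrow> y \<in> carrier (I n)"
  using boundaries_subset_cycles cycles_carrier by blast

lemma boundaries_add:
  assumes "J \<subseteq> carrier A" "x \<in> boundaries n J j" "y \<in> boundaries n J j"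
  shows "x \<oplus>\<^bsub>I n\<^esub> y \<in> boundaries n J j"
proof (cases n)
  case 0
  then show ?thesis using assms by (simp add: boundaries_0)
next
  case (Suc m)
  then obtain u v where "u \<in> torsion m J j" "v \<in> torsion m J j" "x = d m u" "y = d m v"
    using assms by (auto simp: boundaries_Suc)
  then have "x \<oplus>\<^bsub>I n\<^esub> y = d m (u \<oplus>\<^bsub>I m\<^esub> v)" "u \<oplus>\<^bsub>I m\<^esub> v \<in> torsion m J j"
    using d_add torsion_carrier torsion_add[OF assms(1)] Suc by auto
  then show ?thesis unfolding Suc boundaries_Suc by (metis image_eqI)
qed

lemma boundaries_act:
  assumes "J \<subseteq> carrier A" "y \<in> boundaries n J j" "a \<in> component A s"
  shows "a \<odot>\<^bsub>I n\<^esub> y \<in> boundaries n J (j + s)"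
proof (cases n)
  case 0
  then show ?thesis using assms act_zero[OF component_carrier[OF assms(3)]] by (simp add: boundaries_0)
next
  case (Suc m)
  then obtain u where u: "u \<in> torsion m J j" "y = d m u"
    using assms by (auto simp: boundaries_Suc)
  then have "a \<odot>\<^bsub>I n\<^esub> y = d m (a \<odot>\<^bsub>I m\<^esub> u)"
    using d_act[OF component_carrier[OF assms(3)] torsion_carrier[OF u(1)]] Suc by simp
  then show ?thesis
    using torsion_act[OF assms(1) u(1) assms(3)] unfolding Suc boundaries_Suc by simp
qed

lemma boundaries_diff:
  assumes "J \<subseteq> carrier A" "x \<in> boundaries n J j" "y \<in> boundaries n J j"
  shows "x \<ominus>\<^bsub>I n\<^esub> y \<in> boundaries n J j"
  using boundaries_add[OF assms(1,2) boundaries_act[OF assms(1,3) minus_one_component, simplified]]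
    diff_eq boundaries_carrier[OF assms(1)] assms(2,3) by simp

lemma torsion_colon:
  assumes "J \<subseteq> carrier A" "a \<in> component A s" "y \<in> torsion n J j"
  shows "a \<odot>\<^bsub>I n\<^esub> y \<in> torsion n (colon J a) (j + s)"
proof (rule torsionI)
  show "a \<odot>\<^bsub>I n\<^esub> y \<in> component (I n) (j + s)"
    using I.act_component assms(2) torsion_component[OF assms(3)] .
  show "r \<odot>\<^bsub>I n\<^esub> (a \<odot>\<^bsub>I n\<^esub> y) = \<zero>\<^bsub>I n\<^esub>" if "r \<in> colon J a" for r
    using that I.act_assoc[of a r y n] component_carrier[OF assms(2)] torsion_carrier[OF assms(3)]
      torsionD[OF assms(3)] by (simp add: colon_def)
qed

lemma cycles_colon:
  assumes "J \<subseteq> carrier A" "a \<in> component A s" "y \<in> cycles n J j"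
  shows "a \<odot>\<^bsub>I n\<^esub> y \<in> cycles n (colon J a) (j + s)"
  using torsion_colon[OF assms(1,2)] cycles_act[OF assms(1,3,2)] cycles_torsion[OF assms(3)]
  by (simp add: cycles_def)

lemma boundaries_colon:
  assumes "J \<subseteq> carrier A" "a \<in> component A s" "y \<in> boundaries n J j"
  shows "a \<odot>\<^bsub>I n\<^esub> y \<in> boundaries n (colon J a) (j + s)"
proof (cases n)
  case 0
  then show ?thesis
    using assms act_zero[OF component_carrier[OF assms(2)]] by (simp add: boundaries_0)
next
  case (Suc m)
  then obtain u where u: "u \<in> torsion m J j" "y = d m u"
    using assms by (auto simp: boundaries_Suc)
  then have "a \<odot>\<^bsub>I n\<^esub> y = d m (a \<odot>\<^bsub>I m\<^esub> u)"
    using d_act[OF component_carrier[OF assms(2)] torsion_carrier[OF u(1)]] Suc by simp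
  then show ?thesis
    using torsion_colon[OF assms(1,2) u(1)] unfolding Suc boundaries_Suc by simp
qed

lemma torsion_adjoin:
  assumes J: "J \<subseteq> carrier A" and a: "a \<in> carrier A" and y: "y \<in> torsion n J j"
    and ay: "a \<odot>\<^bsub>I n\<^esub> y = \<zero>\<^bsub>I n\<^esub>"
  shows "y \<in> torsion n (adjoin J a) j"
proof (rule torsionI)
  show "y \<in> component (I n) j" using torsion_component[OF y] .
  fix b assume "b \<in> adjoin J a"
  then obtain u r where b: "u \<in> J" "r \<in> carrier A" "b = u \<oplus> a \<otimes> r"
    unfolding adjoin_def by blast
  have uc: "u \<in> carrier A" using b(1) J by blast
  show "b \<odot>\<^bsub>I n\<^esub> y = \<zero>\<^bsub>I n\<^esub>"
    using b uc a ay torsion_carrier[OF y] torsionD[OF y b(1)] act_zero[OF b(2)]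
    by (simp add: I.act_add_scalar I.act_assoc)
qed

lemma torsion_adjoinD:
  assumes "gr_ideal J" "a \<in> component A s" "y \<in> torsion n (adjoin J a) j"
  shows "y \<in> torsion n J j" "a \<odot>\<^bsub>I n\<^esub> y = \<zero>\<^bsub>I n\<^esub>"
  using torsion_antimono[OF adjoin_superset[OF assms(1) component_carrier[OF assms(2)]]] assms(3)
    torsionD[OF assms(3) adjoin_mem[OF assms(1) component_carrier[OF assms(2)]]] by blast+

text \<open>Multiplication by \<open>a\<close> identifies \<open>A/(J : a)\<close> with the submodule \<open>(J + aA)/J\<close> of \<open>A/J\<close>, so
  injectivity of \<open>I n\<close> makes every homomorphism on the former a restriction from \<open>A/J\<close>.\<close>

lemma torsion_lift:
  assumes J: "gr_ideal J" and a: "a \<in> component A s" and z: "z \<in> torsion n (colon J a) (j + s)"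
  shows "\<exists>y\<in>torsion n J j. a \<odot>\<^bsub>I n\<^esub> y = z"
proof -
  define R where "R = shift (regular_module A) (- j)"
  define K where "K = adjoin J a"
  define X where "X = R\<lparr>carrier := K, component := (\<lambda>i. component R i \<inter> K)\<rparr>"
  have ac: "a \<in> carrier A" using component_carrier a .
  have zc: "z \<in> carrier (I n)" using torsion_carrier z .
  have Ki: "gr_ideal K" unfolding K_def by (rule gr_ideal_adjoin[OF J a])
  have Rs: "carrier R = carrier A" "add R = add A" "\<zero>\<^bsub>R\<^esub> = \<zero>" "smult R = (\<lambda>a x. x \<otimes> a)"
      "component R = (\<lambda>i. component A (i - j))"
    unfolding R_def shift_def regular_module_def by auto
  have R: "graded_right_module A R" unfolding R_def by (rule graded_right_module_shift_regular)
  have "gr_submodule A R K"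
  proof -
    have "additive_subgroup K R"
      using gr_ideal_additive[OF Ki] unfolding additive_subgroup_def by (simp add: Rs)
    moreover have "hpart R x i \<in> K" if "x \<in> K" for x i
      using gr_ideal_hpart[OF Ki that] hpart_shift_regular[OF gr_ideal_carrier[OF Ki that], of "- j" i]
      unfolding R_def by simp
    ultimately show ?thesis
      using gr_ideal_mult[OF Ki] unfolding gr_submodule_def by (simp add: Rs)
  qed
  then have X: "graded_right_module A X"
    unfolding X_def by (rule graded_right_module_submodule[OF R])
  have Xs: "carrier X = K" "add X = add A" "smult X = (\<lambda>a x. x \<otimes> a)"
      "component X = (\<lambda>i. component A (i - j) \<inter> K)"
    unfolding X_def by (simp_all add: Rs)
  \<comment> \<open>The homomorphism \<open>u + ar \<mapsto> rz\<close>; it is well defined because \<open>(J : a)\<close> kills \<open>z\<close>.\<close>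
  define g where "g b = (THE v. \<exists>u r. u \<in> J \<and> r \<in> carrier A \<and> b = u \<oplus> a \<otimes> r \<and> v = r \<odot>\<^bsub>I n\<^esub> z)" for b
  have g: "g (u \<oplus> a \<otimes> r) = r \<odot>\<^bsub>I n\<^esub> z" if ur: "u \<in> J" "r \<in> carrier A" for u r
    unfolding g_def
  proof (rule the_equality)
    fix v assume "\<exists>u' r'. u' \<in> J \<and> r' \<in> carrier A \<and> u \<oplus> a \<otimes> r = u' \<oplus> a \<otimes> r' \<and> v = r' \<odot>\<^bsub>I n\<^esub> z"
    then obtain u' r' where *: "u' \<in> J" "r' \<in> carrier A" "u \<oplus> a \<otimes> r = u' \<oplus> a \<otimes> r'" "v = r' \<odot>\<^bsub>I n\<^esub> z"
      by blast
    note c = gr_ideal_carrier[OF J ur(1)] gr_ideal_carrier[OF J *(1)] ur(2) *(2) ac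
    have "a \<otimes> (r' \<ominus> r) = a \<otimes> r' \<ominus> a \<otimes> r"
      using c by (simp add: minus_eq r_distr r_minus)
    also have "a \<otimes> r' = \<ominus> u' \<oplus> (u' \<oplus> a \<otimes> r')" using c by (simp add: r_neg1)
    also have "\<ominus> u' \<oplus> (u' \<oplus> a \<otimes> r') = \<ominus> u' \<oplus> (u \<oplus> a \<otimes> r)" using *(3) by simp
    also have "\<ominus> u' \<oplus> (u \<oplus> a \<otimes> r) \<ominus> a \<otimes> r = u \<ominus> u'"
      using c by (simp add: minus_eq a_ac r_neg)
    finally have "a \<otimes> (r' \<ominus> r) \<in> J" using gr_ideal_diff[OF J ur(1) *(1)] by simp
    then have "r' \<ominus> r \<in> colon J a" using c by (simp add: colon_def)
    then have zero: "(r' \<ominus> r) \<odot>\<^bsub>I n\<^esub> z = \<zero>\<^bsub>I n\<^esub>" by (rule torsionD[OF z])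
    have "r' \<odot>\<^bsub>I n\<^esub> z = (r' \<odot>\<^bsub>I n\<^esub> z \<ominus>\<^bsub>I n\<^esub> r \<odot>\<^bsub>I n\<^esub> z) \<oplus>\<^bsub>I n\<^esub> r \<odot>\<^bsub>I n\<^esub> z"
      using diff_add_cancel(1) I.act_closed c zc by simp
    also have "\<dots> = r \<odot>\<^bsub>I n\<^esub> z"
      using zero act_diff_scalar[OF c(4,3) zc] I.act_closed[OF c(3) zc] by simp
    finally show "v = r \<odot>\<^bsub>I n\<^esub> z" using *(4) by simp
  qed (use ur in blast)
  have KE: "\<exists>u r. u \<in> J \<and> r \<in> carrier A \<and> b = u \<oplus> a \<otimes> r" if "b \<in> K" for b
    using that unfolding K_def adjoin_def by blast
  have "g \<in> gr_hom A X (I n)"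
    unfolding gr_hom_def Xs
  proof (intro CollectI conjI ballI allI funcsetI)
    show "g b \<in> carrier (I n)" if "b \<in> K" for b
      using KE[OF that] g I.act_closed zc by auto
    show "g (b \<oplus> b') = g b \<oplus>\<^bsub>I n\<^esub> g b'" if "b \<in> K" "b' \<in> K" for b b'
    proof -
      obtain u r u' r' where *: "u \<in> J" "r \<in> carrier A" "b = u \<oplus> a \<otimes> r" "u' \<in> J" "r' \<in> carrier A"
        "b' = u' \<oplus> a \<otimes> r'" using KE \<open>b \<in> K\<close> \<open>b' \<in> K\<close> by meson
      note c = gr_ideal_carrier[OF J *(1)] gr_ideal_carrier[OF J *(4)]
      have "b \<oplus> b' = (u \<oplus> u') \<oplus> a \<otimes> (r \<oplus> r')"
        using * c ac by (simp add: r_distr a_ac)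
      then have "g (b \<oplus> b') = (r \<oplus> r') \<odot>\<^bsub>I n\<^esub> z"
        using g[OF gr_ideal_add[OF J *(1,4)], of "r \<oplus> r'"] * by simp
      then show ?thesis using * g zc by (simp add: I.act_add_scalar)
    qed
    show "g (b \<otimes> c) = c \<odot>\<^bsub>I n\<^esub> g b" if "c \<in> carrier A" "b \<in> K" for b c
    proof -
      obtain u r where *: "u \<in> J" "r \<in> carrier A" "b = u \<oplus> a \<otimes> r" using KE \<open>b \<in> K\<close> by meson
      have "b \<otimes> c = u \<otimes> c \<oplus> a \<otimes> (r \<otimes> c)"
        using * gr_ideal_carrier[OF J *(1)] ac that(1) by (simp add: l_distr m_assoc)
      then have "g (b \<otimes> c) = (r \<otimes> c) \<odot>\<^bsub>I n\<^esub> z"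
        using g[OF gr_ideal_mult[OF J *(1) that(1)], of "r \<otimes> c"] * that by simp
      then show ?thesis using * g zc that by (simp add: I.act_assoc)
    qed
    show "g b \<in> component (I n) i" if b: "b \<in> component A (i - j) \<inter> K" for b i
    proof -
      obtain u r where *: "u \<in> J" "r \<in> carrier A" "b = u \<oplus> a \<otimes> r" using KE[of b] b by blast
      have uc: "u \<in> carrier A" using gr_ideal_carrier[OF J *(1)] .
      have "b = hpart A b (i - j)" using b hpart_homogeneous[of b "i - j"] by simp
      also have "\<dots> = hpart A u (i - j) \<oplus> a \<otimes> hpart A r (i - j - s)"
        unfolding *(3) using uc *(2) ac by (simp add: hpart_add hpart_mult_homogeneous[OF a])
      finally have "g b = hpart A r (i - j - s) \<odot>\<^bsub>I n\<^esub> z"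
        using g[OF gr_ideal_hpart[OF J *(1)] hpart_carrier[OF *(2)]] by simp
      then show ?thesis
        using I.act_component[OF hpart_component[OF *(2), of "i - j - s"] torsion_component[OF z]]
        by simp
    qed
  qed
  moreover have "(\<lambda>x. x) \<in> gr_hom A X R"
    unfolding gr_hom_def Xs Rs using gr_ideal_carrier[OF Ki] by auto
  ultimately have "\<exists>h\<in>gr_hom A R (I n). \<forall>x\<in>carrier X. h x = g x"
    using gr_injective_extends[OF injective X R, of "\<lambda>x. x" g n] by (simp add: inj_on_def)
  then obtain h where h: "h \<in> gr_hom A R (I n)" and hg: "\<And>x. x \<in> K \<Longrightarrow> h x = g x"
    unfolding Xs by blast
  define y where "y = h \<one>"
  have y: "y \<in> component (I n) j"
    using h one_component unfolding gr_hom_def y_def Rs by auto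
  have hy: "h b = b \<odot>\<^bsub>I n\<^esub> y" if "b \<in> carrier A" for b
  proof -
    have "h (\<one> \<otimes> b) = b \<odot>\<^bsub>I n\<^esub> h \<one>" using h that one_closed unfolding gr_hom_def Rs by blast
    then show ?thesis using that unfolding y_def by simp
  qed
  have "y \<in> torsion n J j"
  proof (rule torsionI[OF y])
    fix u assume u: "u \<in> J"
    have uc: "u \<in> carrier A" using gr_ideal_carrier[OF J u] .
    have "u \<odot>\<^bsub>I n\<^esub> y = h u" using hy[OF uc] by simp
    also have "\<dots> = g u" using hg adjoin_superset[OF J ac] u unfolding K_def by blast
    also have "\<dots> = g (u \<oplus> a \<otimes> \<zero>)" using uc ac by simp
    also have "\<dots> = \<zero>\<^bsub>I n\<^esub>" using g[OF u, of \<zero>] I.act_minus_one(2)[OF zc] by simp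
    finally show "u \<odot>\<^bsub>I n\<^esub> y = \<zero>\<^bsub>I n\<^esub>" .
  qed
  moreover have "a \<odot>\<^bsub>I n\<^esub> y = z"
  proof -
    have "a \<odot>\<^bsub>I n\<^esub> y = g a" using hy[OF ac] hg[of a] adjoin_mem[OF J ac] unfolding K_def by simp
    also have "\<dots> = g (\<zero> \<oplus> a \<otimes> \<one>)" using ac by simp
    also have "\<dots> = z" using g[OF gr_ideal_zero[OF J], of \<one>] I.act_one[OF zc] by simp
    finally show ?thesis .
  qed
  ultimately show ?thesis by blast
qed

subsection \<open>The long exact sequence of multiplication by a homogeneous element\<close>

text \<open>
  By \<open>torsion_lift\<close> the sequence \<open>torsion n (adjoin J a) j \<rightarrow> torsion n J j \<rightarrow> torsion n (colon J a) (j + s)\<close>,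
  inclusion followed by multiplication by \<open>a\<close>, is short exact. The following lemmas are the parts of
  its long exact cohomology sequence that are used later, on the level of cycles. The connecting
  map sends the class of \<open>a y\<close> to that of \<open>d n y\<close>.
\<close>

lemma connecting_cycle:
  assumes J: "gr_ideal J" and a: "a \<in> component A s" and y: "y \<in> torsion n J j"
    and ay: "d n (a \<odot>\<^bsub>I n\<^esub> y) = \<zero>\<^bsub>I (Suc n)\<^esub>"
  shows "d n y \<in> cycles (Suc n) (adjoin J a) j"
proof -
  note Js = gr_ideal_subset[OF J] and ac = component_carrier[OF a] and yc = torsion_carrier[OF y]
  have "a \<odot>\<^bsub>I (Suc n)\<^esub> d n y = \<zero>\<^bsub>I (Suc n)\<^esub>" using ay d_act[OF ac yc] by simp
  then have "d n y \<in> torsion (Suc n) (adjoin J a) j"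
    by (rule torsion_adjoin[OF Js ac torsion_d[OF Js y]])
  then show ?thesis using d_d[OF yc] by (simp add: cycles_def)
qed

text \<open>The connecting map is well defined: boundaries go to boundaries.\<close>

lemma connecting_boundary:
  assumes J: "gr_ideal J" and a: "a \<in> component A s" and y: "y \<in> torsion n J j"
    and ay: "a \<odot>\<^bsub>I n\<^esub> y \<in> boundaries n (colon J a) (j + s)"
  shows "d n y \<in> boundaries (Suc n) (adjoin J a) j"
proof -
  note Js = gr_ideal_subset[OF J] and ac = component_carrier[OF a] and yc = torsion_carrier[OF y]
  show ?thesis
  proof (cases n)
    case 0
    then have "a \<odot>\<^bsub>I n\<^esub> y = \<zero>\<^bsub>I n\<^esub>" using ay by (simp add: boundaries_0)
    then show ?thesis using torsion_adjoin[OF Js ac y] by (simp add: boundaries_Suc)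
  next
    case (Suc m)
    then obtain z where z: "z \<in> torsion m (colon J a) (j + s)" "a \<odot>\<^bsub>I n\<^esub> y = d m z"
      using ay by (auto simp: boundaries_Suc)
    obtain u where u: "u \<in> torsion m J j" "a \<odot>\<^bsub>I m\<^esub> u = z" using torsion_lift[OF J a z(1)] by blast
    have uc: "u \<in> carrier (I m)" using torsion_carrier[OF u(1)] .
    have du: "d m u \<in> torsion n J j" unfolding Suc by (rule torsion_d[OF Js u(1)])
    have "a \<odot>\<^bsub>I n\<^esub> d m u = d m z" using d_act[OF ac uc] u(2) Suc by simp
    then have "a \<odot>\<^bsub>I n\<^esub> (y \<ominus>\<^bsub>I n\<^esub> d m u) = \<zero>\<^bsub>I n\<^esub>"
      using act_diff[OF ac yc torsion_carrier[OF du]] z(2) I.act_closed[OF ac yc]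
      by (simp add: a_minus_def I.r_neg)
    then have "y \<ominus>\<^bsub>I n\<^esub> d m u \<in> torsion n (adjoin J a) j"
      by (rule torsion_adjoin[OF Js ac torsion_diff[OF Js y du]])
    moreover have "d n (y \<ominus>\<^bsub>I n\<^esub> d m u) = d n y"
      using d_diff[OF yc torsion_carrier[OF du]] d_d[OF uc] d_closed[OF yc] Suc
      by (simp add: a_minus_def)
    ultimately show ?thesis unfolding boundaries_Suc by (metis image_eqI)
  qed
qed

text \<open>Exactness at the cohomology of \<open>J\<close>.\<close>

lemma cycle_adjoin:
  assumes J: "gr_ideal J" and a: "a \<in> component A s" and w: "w \<in> cycles n J j"
    and aw: "a \<odot>\<^bsub>I n\<^esub> w \<in> boundaries n (colon J a) (j + s)"
  shows "\<exists>w'\<in>cycles n (adjoin J a) j. w \<ominus>\<^bsub>I n\<^esub> w' \<in> boundaries n J j"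
proof -
  note Js = gr_ideal_subset[OF J] and ac = component_carrier[OF a] and wc = cycles_carrier[OF w]
  show ?thesis
  proof (cases n)
    case 0
    then have "a \<odot>\<^bsub>I n\<^esub> w = \<zero>\<^bsub>I n\<^esub>" using aw by (simp add: boundaries_0)
    then have "w \<in> cycles n (adjoin J a) j"
      using torsion_adjoin[OF Js ac cycles_torsion[OF w]] w by (simp add: cycles_def)
    moreover have "w \<ominus>\<^bsub>I n\<^esub> w \<in> boundaries n J j"
      using wc boundaries_zero[OF Js, of n j] by (simp add: a_minus_def I.r_neg)
    ultimately show ?thesis by blast
  next
    case (Suc m)
    then obtain z where z: "z \<in> torsion m (colon J a) (j + s)" "a \<odot>\<^bsub>I n\<^esub> w = d m z"
      using aw by (auto simp: boundaries_Suc)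
    obtain u where u: "u \<in> torsion m J j" "a \<odot>\<^bsub>I m\<^esub> u = z" using torsion_lift[OF J a z(1)] by blast
    have uc: "u \<in> carrier (I m)" using torsion_carrier[OF u(1)] .
    have du: "d m u \<in> boundaries n J j" using u(1) unfolding Suc boundaries_Suc by blast
    have duc: "d m u \<in> cycles n J j" using du boundaries_subset_cycles[OF Js] by blast
    have "a \<odot>\<^bsub>I n\<^esub> d m u = d m z" using d_act[OF ac uc] u(2) Suc by simp
    then have "a \<odot>\<^bsub>I n\<^esub> (w \<ominus>\<^bsub>I n\<^esub> d m u) = \<zero>\<^bsub>I n\<^esub>"
      using act_diff[OF ac wc cycles_carrier[OF duc]] z(2) I.act_closed[OF ac wc]
      by (simp add: a_minus_def I.r_neg)
    moreover have diff: "w \<ominus>\<^bsub>I n\<^esub> d m u \<in> cycles n J j" by (rule cycles_diff[OF Js w duc])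
    ultimately have "w \<ominus>\<^bsub>I n\<^esub> d m u \<in> cycles n (adjoin J a) j"
      using torsion_adjoin[OF Js ac cycles_torsion] by (simp add: cycles_def)
    moreover have "w \<ominus>\<^bsub>I n\<^esub> (w \<ominus>\<^bsub>I n\<^esub> d m u) \<in> boundaries n J j"
      using diff_add_cancel(2)[OF wc cycles_carrier[OF duc]] du by simp
    ultimately show ?thesis by blast
  qed
qed

text \<open>Exactness at the cohomology of \<open>colon J a\<close>, in the case of a vanishing target of the connecting
  map. The preimage can then be corrected to hit the cycle itself, not only its class.\<close>

lemma cycles_lift:
  assumes J: "gr_ideal J" and a: "a \<in> component A s" and z: "z \<in> cycles n (colon J a) (j + s)"
    and E: "Ext_zero (Suc n) (adjoin J a) j"
  shows "\<exists>y\<in>cycles n J j. a \<odot>\<^bsub>I n\<^esub> y = z"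
proof -
  note Js = gr_ideal_subset[OF J] and ac = component_carrier[OF a]
  obtain y where y: "y \<in> torsion n J j" "a \<odot>\<^bsub>I n\<^esub> y = z"
    using torsion_lift[OF J a cycles_torsion[OF z]] by blast
  have yc: "y \<in> carrier (I n)" using torsion_carrier[OF y(1)] .
  have "d n y \<in> cycles (Suc n) (adjoin J a) j"
    by (rule connecting_cycle[OF J a y(1)]) (use z y(2) in \<open>simp add: cycles_def\<close>)
  then obtain u where u: "u \<in> torsion n (adjoin J a) j" "d n y = d n u"
    using E unfolding Ext_zero_def boundaries_Suc by blast
  have uJ: "u \<in> torsion n J j" "a \<odot>\<^bsub>I n\<^esub> u = \<zero>\<^bsub>I n\<^esub>" using torsion_adjoinD[OF J a u(1)] by auto
  have uc: "u \<in> carrier (I n)" using torsion_carrier[OF u(1)] .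
  have "y \<ominus>\<^bsub>I n\<^esub> u \<in> cycles n J j"
    using torsion_diff[OF Js y(1) uJ(1)] d_diff[OF yc uc] u(2) d_closed[OF uc]
    by (simp add: cycles_def a_minus_def I.r_neg)
  moreover have "a \<odot>\<^bsub>I n\<^esub> (y \<ominus>\<^bsub>I n\<^esub> u) = z"
    using act_diff[OF ac yc uc] y(2) uJ(2) cycles_carrier[OF z] by (simp add: a_minus_def)
  ultimately show ?thesis by blast
qed

text \<open>Exactness at the cohomology of \<open>adjoin J a\<close>.\<close>

lemma cycle_connecting:
  assumes J: "gr_ideal J" and a: "a \<in> component A s" and w: "w \<in> cycles (Suc n) (adjoin J a) j"
    and wB: "w \<in> boundaries (Suc n) J j"
  shows "\<exists>y\<in>torsion n J j. w = d n y \<and> a \<odot>\<^bsub>I n\<^esub> y \<in> cycles n (colon J a) (j + s)"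
proof -
  note Js = gr_ideal_subset[OF J] and ac = component_carrier[OF a]
  obtain y where y: "y \<in> torsion n J j" "w = d n y" using wB by (auto simp: boundaries_Suc)
  have "d n (a \<odot>\<^bsub>I n\<^esub> y) = a \<odot>\<^bsub>I (Suc n)\<^esub> w"
    using d_act[OF ac torsion_carrier[OF y(1)]] y(2) by simp
  also have "\<dots> = \<zero>\<^bsub>I (Suc n)\<^esub>" using torsion_adjoinD(2)[OF J a cycles_torsion[OF w]] .
  finally show ?thesis
    using y torsion_colon[OF Js a y(1)] by (auto simp: cycles_def)
qed

end

section \<open>Noetherian cohomology and Nakayama's lemma\<close>

locale local_injective_complex = local_graded_cring A l + injective_complex A I d
  for A :: "('k, 'a, 'e) graded_module_scheme" (structure) and l
    and I :: "nat \<Rightarrow> ('a, 'c) graded_module" and d :: "nat \<Rightarrow> 'c \<Rightarrow> 'c"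
begin

text \<open>An \<open>A\<^sub>0\<close>-submodule of \<open>Ext(A/J, A(j))\<close> is represented by its preimage in the cycles. This avoids
  forming quotients.\<close>

definition Ext_submodule :: "nat \<Rightarrow> 'a set \<Rightarrow> int \<Rightarrow> 'c set \<Rightarrow> bool" where
  "Ext_submodule n J j S \<longleftrightarrow> boundaries n J j \<subseteq> S \<and> S \<subseteq> cycles n J j \<and>
     (\<forall>x\<in>S. \<forall>y\<in>S. x \<oplus>\<^bsub>I n\<^esub> y \<in> S) \<and> (\<forall>r\<in>component A 0. \<forall>x\<in>S. r \<odot>\<^bsub>I n\<^esub> x \<in> S)"

definition Ext_noetherian :: "nat \<Rightarrow> 'a set \<Rightarrow> int \<Rightarrow> bool" where
  "Ext_noetherian n J j \<longleftrightarrow>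
     (\<forall>f :: nat \<Rightarrow> 'c set. (\<forall>k. Ext_submodule n J j (f k) \<and> f k \<subseteq> f (Suc k)) \<longrightarrow>
        (\<exists>m. \<forall>k\<ge>m. f k = f m))"

lemma Ext_submoduleD:
  assumes "Ext_submodule n J j S"
  shows "boundaries n J j \<subseteq> S" "S \<subseteq> cycles n J j"
    "\<lbrakk>x \<in> S; y \<in> S\<rbrakk> \<Longrightarrow> x \<oplus>\<^bsub>I n\<^esub> y \<in> S" "\<lbrakk>r \<in> component A 0; x \<in> S\<rbrakk> \<Longrightarrow> r \<odot>\<^bsub>I n\<^esub> x \<in> S"
  using assms unfolding Ext_submodule_def by blast+

lemma Ext_submodule_diff:
  assumes S: "Ext_submodule n J j S" and x: "x \<in> S" and y: "y \<in> S"
  shows "x \<ominus>\<^bsub>I n\<^esub> y \<in> S"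
proof -
  have "x \<in> carrier (I n)" "y \<in> carrier (I n)"
    using Ext_submoduleD(2)[OF S] x y cycles_carrier by blast+
  then show ?thesis
    using Ext_submoduleD(3)[OF S x Ext_submoduleD(4)[OF S minus_one_component y]] diff_eq by simp
qed

lemma Ext_submodule_boundaries:
  assumes "J \<subseteq> carrier A" shows "Ext_submodule n J j (boundaries n J j)"
  using boundaries_subset_cycles[OF assms] boundaries_add[OF assms] boundaries_act[OF assms, of _ n j _ 0]
  by (simp add: Ext_submodule_def)

lemma Ext_noetherian_if_zero:
  assumes "Ext_zero n J j" shows "Ext_noetherian n J j"
proof -
  have "S = boundaries n J j" if "Ext_submodule n J j S" for S
    using Ext_submoduleD(1,2)[OF that] assms unfolding Ext_zero_def by blast
  then show ?thesis unfolding Ext_noetherian_def by blast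
qed

text \<open>Nakayama's lemma: a nonzero Noetherian module has a maximal proper submodule \<open>U\<close>. Modulo \<open>U\<close>
  every element is a multiple \<open>r e\<close> of a fixed nonzero \<open>e\<close>; if \<open>x\<close> acts surjectively then \<open>e = x r e\<close>
  modulo \<open>U\<close> for some \<open>r\<close>, which is absurd because \<open>1 - x r\<close> is invertible.\<close>

lemma Ext_nakayama:
  assumes noeth: "Ext_noetherian n J j" and J: "J \<subseteq> carrier A" and x: "x \<in> nonunits"
    and onto: "\<And>w. w \<in> cycles n J j \<Longrightarrow> \<exists>w'\<in>cycles n J j. w \<ominus>\<^bsub>I n\<^esub> x \<odot>\<^bsub>I n\<^esub> w' \<in> boundaries n J j"
  shows "Ext_zero n J j"
proof (rule ccontr)
  note xc = nonunitsD[OF x]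
  define \<S> where "\<S> = {S. Ext_submodule n J j S \<and> S \<noteq> cycles n J j}"
  assume "\<not> Ext_zero n J j"
  then have "boundaries n J j \<in> \<S>"
    using Ext_submodule_boundaries[OF J, of n j] unfolding \<S>_def Ext_zero_def by blast
  then have ne: "\<S> \<noteq> {}" by blast
  have "\<exists>m. \<forall>k\<ge>m. f k = f m" if "\<And>k. f k \<in> \<S> \<and> f k \<subseteq> f (Suc k)" for f :: "nat \<Rightarrow> 'c set"
    using noeth that unfolding Ext_noetherian_def \<S>_def by blast
  then have "\<exists>U\<in>\<S>. \<forall>V\<in>\<S>. U \<subseteq> V \<longrightarrow> V = U" by (rule ascending_chains_imp_maximal[OF ne])
  then obtain U where "U \<in> \<S>" and max: "\<forall>V\<in>\<S>. U \<subseteq> V \<longrightarrow> V = U" by (rule bexE)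
  then have U: "Ext_submodule n J j U" and U_ne: "U \<noteq> cycles n J j" unfolding \<S>_def by simp_all
  note UD = Ext_submoduleD[OF U]
  have Uc: "u \<in> carrier (I n)" if "u \<in> U" for u using that UD(2) cycles_carrier by blast
  have U0: "\<zero>\<^bsub>I n\<^esub> \<in> U" using UD(1) boundaries_zero[OF J] by blast
  obtain e where e: "e \<in> cycles n J j" "e \<notin> U" using U_ne UD(2) by blast
  have ec: "e \<in> carrier (I n)" using cycles_carrier[OF e(1)] .
  define V where "V = {u \<oplus>\<^bsub>I n\<^esub> r \<odot>\<^bsub>I n\<^esub> e | u r. u \<in> U \<and> r \<in> component A 0}"
  have VI: "v \<in> V" if "u \<in> U" "r \<in> component A 0" "v = u \<oplus>\<^bsub>I n\<^esub> r \<odot>\<^bsub>I n\<^esub> e" for u r v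
    using that unfolding V_def by blast
  have VE: "\<exists>u r. u \<in> U \<and> r \<in> component A 0 \<and> v = u \<oplus>\<^bsub>I n\<^esub> r \<odot>\<^bsub>I n\<^esub> e" if "v \<in> V" for v
    using that unfolding V_def by blast
  have UV: "U \<subseteq> V"
  proof
    fix u assume u: "u \<in> U"
    show "u \<in> V"
      by (rule VI[OF u zero_component]) (use Uc[OF u] I.act_minus_one(2)[OF ec] in simp)
  qed
  have eV: "e \<in> V" by (rule VI[OF U0 one_component]) (use ec I.act_one[OF ec] in simp)
  have "Ext_submodule n J j V"
    unfolding Ext_submodule_def
  proof (intro conjI ballI subsetI)
    show "b \<in> V" if "b \<in> boundaries n J j" for b using that UD(1) UV by blast
    show "v \<in> cycles n J j" if "v \<in> V" for v
    proof -
      obtain u r where *: "u \<in> U" "r \<in> component A 0" "v = u \<oplus>\<^bsub>I n\<^esub> r \<odot>\<^bsub>I n\<^esub> e" using VE[OF \<open>v \<in> V\<close>] by blast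
      have "r \<odot>\<^bsub>I n\<^esub> e \<in> cycles n J j" using cycles_act[OF J e(1) *(2)] by simp
      then show ?thesis unfolding *(3) using *(1) UD(2) by (intro cycles_add[OF J]) auto
    qed
    show "v \<oplus>\<^bsub>I n\<^esub> v' \<in> V" if v: "v \<in> V" "v' \<in> V" for v v'
    proof -
      obtain u r u' r' where *: "u \<in> U" "r \<in> component A 0" "v = u \<oplus>\<^bsub>I n\<^esub> r \<odot>\<^bsub>I n\<^esub> e"
        "u' \<in> U" "r' \<in> component A 0" "v' = u' \<oplus>\<^bsub>I n\<^esub> r' \<odot>\<^bsub>I n\<^esub> e" using VE v by meson
      note c = component_carrier[OF *(2)] component_carrier[OF *(5)]
      show ?thesis
        by (rule VI[OF UD(3)[OF *(1,4)] component_add[OF *(2,5)]])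
          (use * c Uc ec I.act_closed in \<open>simp add: I.act_add_scalar I.a_ac\<close>)
    qed
    show "q \<odot>\<^bsub>I n\<^esub> v \<in> V" if q: "q \<in> component A 0" "v \<in> V" for q v
    proof -
      obtain u r where *: "u \<in> U" "r \<in> component A 0" "v = u \<oplus>\<^bsub>I n\<^esub> r \<odot>\<^bsub>I n\<^esub> e" using VE[OF q(2)] by blast
      note c = component_carrier[OF *(2)] component_carrier[OF q(1)]
      show ?thesis
        by (rule VI[OF UD(4)[OF q(1) *(1)] mult_degree_zero[OF *(2) q(1)]])
          (use * c Uc ec I.act_closed in \<open>simp add: I.act_add I.act_assoc\<close>)
    qed
  qed
  then have V: "V = cycles n J j" using max UV eV e(2) unfolding \<S>_def by blast
  obtain w where w: "w \<in> cycles n J j" "e \<ominus>\<^bsub>I n\<^esub> x \<odot>\<^bsub>I n\<^esub> w \<in> boundaries n J j" using onto[OF e(1)] by blast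
  obtain u r where ur: "u \<in> U" "r \<in> component A 0" "w = u \<oplus>\<^bsub>I n\<^esub> r \<odot>\<^bsub>I n\<^esub> e"
    using VE w(1) V by blast
  have rc: "r \<in> carrier A" using component_carrier[OF ur(2)] .
  have wc: "w \<in> carrier (I n)" using cycles_carrier[OF w(1)] .
  have xu: "x \<odot>\<^bsub>I n\<^esub> u \<in> U" using UD(4)[OF xc(1) ur(1)] .
  have xw: "x \<odot>\<^bsub>I n\<^esub> w = x \<odot>\<^bsub>I n\<^esub> u \<oplus>\<^bsub>I n\<^esub> (x \<otimes> r) \<odot>\<^bsub>I n\<^esub> e"
    unfolding ur(3) using Uc[OF ur(1)] rc xc ec act_comm[OF xc(2) rc ec] I.act_closed
    by (simp add: I.act_add I.act_assoc)
  have eq: "(\<one> \<ominus> x \<otimes> r) \<odot>\<^bsub>I n\<^esub> e = (e \<ominus>\<^bsub>I n\<^esub> x \<odot>\<^bsub>I n\<^esub> w) \<oplus>\<^bsub>I n\<^esub> x \<odot>\<^bsub>I n\<^esub> u"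
  proof -
    define p q where "p = x \<odot>\<^bsub>I n\<^esub> u" and "q = (x \<otimes> r) \<odot>\<^bsub>I n\<^esub> e"
    have c: "p \<in> carrier (I n)" "q \<in> carrier (I n)"
      unfolding p_def q_def using xc rc ec Uc[OF ur(1)] I.act_closed by auto
    have "(e \<ominus>\<^bsub>I n\<^esub> (p \<oplus>\<^bsub>I n\<^esub> q)) \<oplus>\<^bsub>I n\<^esub> p = e \<oplus>\<^bsub>I n\<^esub> \<ominus>\<^bsub>I n\<^esub> q \<oplus>\<^bsub>I n\<^esub> (\<ominus>\<^bsub>I n\<^esub> p \<oplus>\<^bsub>I n\<^esub> p)"
      using c ec by (simp add: a_minus_def I.minus_add I.a_ac)
    also have "\<dots> = e \<ominus>\<^bsub>I n\<^esub> q" using c ec by (simp add: a_minus_def I.l_neg)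
    finally have "(e \<ominus>\<^bsub>I n\<^esub> (p \<oplus>\<^bsub>I n\<^esub> q)) \<oplus>\<^bsub>I n\<^esub> p = e \<ominus>\<^bsub>I n\<^esub> q" .
    then show ?thesis
      unfolding xw p_def[symmetric] q_def[symmetric]
      using act_diff_scalar[OF one_closed m_closed[OF xc(2) rc] ec] I.act_one[OF ec]
      by (simp add: q_def)
  qed
  have eU: "(\<one> \<ominus> x \<otimes> r) \<odot>\<^bsub>I n\<^esub> e \<in> U"
    unfolding eq by (rule UD(3)) (use w(2) UD(1) xu in auto)
  obtain c where c: "c \<in> component A 0" "(\<one> \<ominus> x \<otimes> r) \<otimes> c = \<one>"
    using one_minus_nonunit[OF x ur(2)] by blast
  have "c \<odot>\<^bsub>I n\<^esub> ((\<one> \<ominus> x \<otimes> r) \<odot>\<^bsub>I n\<^esub> e) = e"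
    using I.act_assoc[of "\<one> \<ominus> x \<otimes> r" c e n] c(2) component_carrier[OF c(1)] xc rc ec I.act_one[OF ec]
    by simp
  then show False using UD(4)[OF c(1) eU] e(2) by simp
qed

text \<open>In an exact sequence \<open>E' \<rightarrow> E \<rightarrow> E''\<close> a chain in \<open>E\<close> is stationary as soon as its preimage in
  \<open>E'\<close> and its image in \<open>E''\<close> are.\<close>

lemma Ext_noetherian_adjoin:
  assumes J: "gr_ideal J" and a: "a \<in> component A s"
    and left: "Ext_noetherian n (colon J a) (j + s)" and right: "Ext_noetherian (Suc n) J j"
  shows "Ext_noetherian (Suc n) (adjoin J a) j"
  unfolding Ext_noetherian_def
proof (intro allI impI)
  fix f :: "nat \<Rightarrow> 'c set"
  assume "\<forall>k. Ext_submodule (Suc n) (adjoin J a) j (f k) \<and> f k \<subseteq> f (Suc k)"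
  then have f: "Ext_submodule (Suc n) (adjoin J a) j (f k)" and fS: "f k \<subseteq> f (Suc k)" for k by blast+
  note fD = Ext_submoduleD[OF f]
  note Js = gr_ideal_subset[OF J] and ac = component_carrier[OF a]
  note Ki = gr_ideal_colon[OF J a] and Li = gr_ideal_adjoin[OF J a]
  note Ks = gr_ideal_subset[OF Ki] and Ls = gr_ideal_subset[OF Li]
  have JL: "J \<subseteq> adjoin J a" by (rule adjoin_superset[OF J ac])
  have mono: "f k \<subseteq> f k'" if "k \<le> k'" for k k' using lift_Suc_mono_le[of f, OF fS that] .
  have fc: "w \<in> carrier (I (Suc n))" if "w \<in> f k" for w k using that fD(2) cycles_carrier by blast
  have f0: "\<zero>\<^bsub>I (Suc n)\<^esub> \<in> f k" for k using fD(1) boundaries_zero[OF Ls] by blast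
  define g where "g k = {z \<in> cycles n (colon J a) (j + s).
      \<exists>y\<in>torsion n J j. a \<odot>\<^bsub>I n\<^esub> y = z \<and> d n y \<in> f k}" for k
  define h where "h k = {w \<oplus>\<^bsub>I (Suc n)\<^esub> b | w b. w \<in> f k \<and> b \<in> boundaries (Suc n) J j}" for k
  have gI: "z \<in> g k" if "z \<in> cycles n (colon J a) (j + s)" "y \<in> torsion n J j" "a \<odot>\<^bsub>I n\<^esub> y = z"
      "d n y \<in> f k" for z y k using that unfolding g_def by blast
  have gE: "\<exists>y. z \<in> cycles n (colon J a) (j + s) \<and> y \<in> torsion n J j \<and> a \<odot>\<^bsub>I n\<^esub> y = z \<and> d n y \<in> f k"
    if "z \<in> g k" for z k using that unfolding g_def by blast
  have hI: "v \<in> h k" if "w \<in> f k" "b \<in> boundaries (Suc n) J j" "v = w \<oplus>\<^bsub>I (Suc n)\<^esub> b" for v w b k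
    using that unfolding h_def by blast
  have hE: "\<exists>w b. w \<in> f k \<and> b \<in> boundaries (Suc n) J j \<and> v = w \<oplus>\<^bsub>I (Suc n)\<^esub> b" if "v \<in> h k" for v k
    using that unfolding h_def by blast
  have g: "Ext_submodule n (colon J a) (j + s) (g k)" for k
    unfolding Ext_submodule_def
  proof (intro conjI ballI subsetI)
    show "z \<in> g k" if z: "z \<in> boundaries n (colon J a) (j + s)" for z
    proof -
      have zc: "z \<in> cycles n (colon J a) (j + s)" using z boundaries_subset_cycles[OF Ks] by blast
      obtain y where y: "y \<in> torsion n J j" "a \<odot>\<^bsub>I n\<^esub> y = z"
        using torsion_lift[OF J a cycles_torsion[OF zc]] by blast
      have "d n y \<in> f k"
        using connecting_boundary[OF J a y(1)] z y(2) fD(1) by blast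
      then show ?thesis by (rule gI[OF zc y])
    qed
    show "z \<in> cycles n (colon J a) (j + s)" if "z \<in> g k" for z using that unfolding g_def by blast
    show "z \<oplus>\<^bsub>I n\<^esub> z' \<in> g k" if z: "z \<in> g k" "z' \<in> g k" for z z'
    proof -
      obtain y y' where y: "z \<in> cycles n (colon J a) (j + s)" "y \<in> torsion n J j" "a \<odot>\<^bsub>I n\<^esub> y = z"
        "d n y \<in> f k" "z' \<in> cycles n (colon J a) (j + s)" "y' \<in> torsion n J j" "a \<odot>\<^bsub>I n\<^esub> y' = z'"
        "d n y' \<in> f k" using gE z by meson
      note c = torsion_carrier[OF y(2)] torsion_carrier[OF y(6)]
      show ?thesis
        by (rule gI[OF cycles_add[OF Ks y(1,5)] torsion_add[OF Js y(2,6)]])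
          (use y c ac fD(3)[OF y(4,8)] in \<open>simp_all add: I.act_add d_add\<close>)
    qed
    show "r \<odot>\<^bsub>I n\<^esub> z \<in> g k" if r: "r \<in> component A 0" "z \<in> g k" for r z
    proof -
      obtain y where y: "z \<in> cycles n (colon J a) (j + s)" "y \<in> torsion n J j" "a \<odot>\<^bsub>I n\<^esub> y = z"
        "d n y \<in> f k" using gE[OF r(2)] by blast
      note c = torsion_carrier[OF y(2)] component_carrier[OF r(1)]
      show ?thesis
      proof (rule gI)
        show "r \<odot>\<^bsub>I n\<^esub> z \<in> cycles n (colon J a) (j + s)" using cycles_act[OF Ks y(1) r(1)] by simp
        show "r \<odot>\<^bsub>I n\<^esub> y \<in> torsion n J j" using torsion_act[OF Js y(2) r(1)] by simp
        show "a \<odot>\<^bsub>I n\<^esub> (r \<odot>\<^bsub>I n\<^esub> y) = r \<odot>\<^bsub>I n\<^esub> z" using act_comm[OF ac c(2,1)] y(3) by simp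
        show "d n (r \<odot>\<^bsub>I n\<^esub> y) \<in> f k" using d_act[OF c(2,1)] fD(4)[OF r(1) y(4)] by simp
      qed
    qed
  qed
  have h: "Ext_submodule (Suc n) J j (h k)" for k
    unfolding Ext_submodule_def
  proof (intro conjI ballI subsetI)
    show "b \<in> h k" if "b \<in> boundaries (Suc n) J j" for b
      by (rule hI[OF f0 that]) (use boundaries_carrier[OF Js that] in simp)
    show "v \<in> cycles (Suc n) J j" if "v \<in> h k" for v
    proof -
      obtain w b where *: "w \<in> f k" "b \<in> boundaries (Suc n) J j" "v = w \<oplus>\<^bsub>I (Suc n)\<^esub> b"
        using hE[OF \<open>v \<in> h k\<close>] by blast
      have "w \<in> cycles (Suc n) J j" using *(1) fD(2) cycles_antimono[OF JL] by blast
      then show ?thesis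
        unfolding *(3) using *(2) boundaries_subset_cycles[OF Js] by (intro cycles_add[OF Js]) auto
    qed
    show "v \<oplus>\<^bsub>I (Suc n)\<^esub> v' \<in> h k" if v: "v \<in> h k" "v' \<in> h k" for v v'
    proof -
      obtain w b w' b' where *: "w \<in> f k" "b \<in> boundaries (Suc n) J j" "v = w \<oplus>\<^bsub>I (Suc n)\<^esub> b"
        "w' \<in> f k" "b' \<in> boundaries (Suc n) J j" "v' = w' \<oplus>\<^bsub>I (Suc n)\<^esub> b'" using hE v by meson
      note c = fc[OF *(1)] fc[OF *(4)] boundaries_carrier[OF Js *(2)] boundaries_carrier[OF Js *(5)]
      show ?thesis
        by (rule hI[OF fD(3)[OF *(1,4)] boundaries_add[OF Js *(2,5)]])
          (use * c in \<open>simp add: I.a_ac\<close>)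
    qed
    show "r \<odot>\<^bsub>I (Suc n)\<^esub> v \<in> h k" if r: "r \<in> component A 0" "v \<in> h k" for r v
    proof -
      obtain w b where *: "w \<in> f k" "b \<in> boundaries (Suc n) J j" "v = w \<oplus>\<^bsub>I (Suc n)\<^esub> b"
        using hE[OF r(2)] by blast
      note c = fc[OF *(1)] boundaries_carrier[OF Js *(2)] component_carrier[OF r(1)]
      have "r \<odot>\<^bsub>I (Suc n)\<^esub> b \<in> boundaries (Suc n) J j" using boundaries_act[OF Js *(2) r(1)] by simp
      then show ?thesis
        by (rule hI[OF fD(4)[OF r(1) *(1)]]) (use * c in \<open>simp add: I.act_add\<close>)
    qed
  qed
  have gS: "g k \<subseteq> g (Suc k)" for k using fS[of k] unfolding g_def by blast
  have hS: "h k \<subseteq> h (Suc k)" for k using fS[of k] unfolding h_def by blast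
  obtain m1 where m1: "\<And>k. k \<ge> m1 \<Longrightarrow> g k = g m1"
    using left g gS unfolding Ext_noetherian_def by meson
  obtain m2 where m2: "\<And>k. k \<ge> m2 \<Longrightarrow> h k = h m2"
    using right h hS unfolding Ext_noetherian_def by meson
  define m where "m = max m1 m2"
  have "f k = f m" if k: "k \<ge> m" for k
  proof
    have gk: "g k = g m" using m1[of k] m1[of m] k unfolding m_def by simp
    have hk: "h k = h m" using m2[of k] m2[of m] k unfolding m_def by simp
    show "f m \<subseteq> f k" using mono[OF k] .
    show "f k \<subseteq> f m"
    proof
      fix w assume w: "w \<in> f k"
      have "w \<in> h k"
        by (rule hI[OF w boundaries_zero[OF Js]]) (use fc[OF w] in simp)
      then obtain x b where xb: "x \<in> f m" "b \<in> boundaries (Suc n) J j" "w = x \<oplus>\<^bsub>I (Suc n)\<^esub> b"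
        using hE hk by blast
      note c = fc[OF xb(1)] boundaries_carrier[OF Js xb(2)]
      have "b = w \<ominus>\<^bsub>I (Suc n)\<^esub> x"
      proof -
        have "w \<ominus>\<^bsub>I (Suc n)\<^esub> x = b \<oplus>\<^bsub>I (Suc n)\<^esub> (x \<oplus>\<^bsub>I (Suc n)\<^esub> \<ominus>\<^bsub>I (Suc n)\<^esub> x)"
          unfolding xb(3) using c by (simp add: a_minus_def I.a_ac)
        then show ?thesis using c by (simp add: I.r_neg)
      qed
      then have bf: "b \<in> f k" using Ext_submodule_diff[OF f w] mono[OF k] xb(1) by blast
      then have "b \<in> cycles (Suc n) (adjoin J a) j" using fD(2) by blast
      then obtain y where y: "y \<in> torsion n J j" "b = d n y" "a \<odot>\<^bsub>I n\<^esub> y \<in> cycles n (colon J a) (j + s)"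
        using cycle_connecting[OF J a _ xb(2)] by blast
      have "a \<odot>\<^bsub>I n\<^esub> y \<in> g m" using gI[OF y(3,1)] bf y(2) gk by blast
      then obtain y' where y': "y' \<in> torsion n J j" "a \<odot>\<^bsub>I n\<^esub> y' = a \<odot>\<^bsub>I n\<^esub> y" "d n y' \<in> f m"
        using gE by blast
      note yc = torsion_carrier[OF y(1)] torsion_carrier[OF y'(1)]
      have "a \<odot>\<^bsub>I n\<^esub> (y \<ominus>\<^bsub>I n\<^esub> y') = \<zero>\<^bsub>I n\<^esub>"
        using act_diff[OF ac yc] y'(2) I.act_closed[OF ac yc(1)] by (simp add: a_minus_def I.r_neg)
      then have "y \<ominus>\<^bsub>I n\<^esub> y' \<in> torsion n (adjoin J a) j"
        by (rule torsion_adjoin[OF Js ac torsion_diff[OF Js y(1) y'(1)]])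
      then have "d n (y \<ominus>\<^bsub>I n\<^esub> y') \<in> f m" using fD(1) unfolding boundaries_Suc by blast
      then have "(d n y \<ominus>\<^bsub>I (Suc n)\<^esub> d n y') \<oplus>\<^bsub>I (Suc n)\<^esub> d n y' \<in> f m"
        using fD(3)[OF _ y'(3)] d_diff[OF yc] by simp
      then have "b \<in> f m"
        using diff_add_cancel(1)[OF d_closed[OF yc(1)] d_closed[OF yc(2)]] y(2) by simp
      then show "w \<in> f m" unfolding xb(3) by (rule fD(3)[OF xb(1)])
    qed
  qed
  then show "\<exists>m. \<forall>k\<ge>m. f k = f m" by blast
qed

end

locale finite_injective_resolution = local_injective_complex A l I d
  for A :: "('k, 'a, 'e) graded_module_scheme" (structure) and l
    and I :: "nat \<Rightarrow> ('a, 'c) graded_module" and d :: "nat \<Rightarrow> 'c \<Rightarrow> 'c" +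
  fixes \<epsilon> :: "'a \<Rightarrow> 'c" and len :: nat
  assumes augmentation: "\<epsilon> \<in> gr_hom A (regular_module A) (I 0)" "inj_on \<epsilon> (carrier A)"
    and exact_0: "{x \<in> carrier (I 0). d 0 x = \<zero>\<^bsub>I 1\<^esub>} = \<epsilon> ` carrier A"
    and exact_Suc: "{x \<in> carrier (I (Suc n)). d (Suc n) x = \<zero>\<^bsub>I (Suc (Suc n))\<^esub>} = d n ` carrier (I n)"
    and finite_length: "len < n \<Longrightarrow> carrier (I n) = {\<zero>\<^bsub>I n\<^esub>}"
begin

lemma \<epsilon>_closed: "a \<in> carrier A \<Longrightarrow> \<epsilon> a \<in> carrier (I 0)"
  using augmentation(1) unfolding gr_hom_def by auto

lemma \<epsilon>_add: "\<lbrakk>a \<in> carrier A; b \<in> carrier A\<rbrakk> \<Longrightarrow> \<epsilon> (a \<oplus> b) = \<epsilon> a \<oplus>\<^bsub>I 0\<^esub> \<epsilon> b"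
  using augmentation(1) unfolding gr_hom_def regular_module_simps by blast

lemma \<epsilon>_mult: "\<lbrakk>a \<in> carrier A; b \<in> carrier A\<rbrakk> \<Longrightarrow> \<epsilon> (a \<otimes> b) = b \<odot>\<^bsub>I 0\<^esub> \<epsilon> a"
  using augmentation(1) unfolding gr_hom_def regular_module_simps by blast

lemma \<epsilon>_component: "a \<in> component A j \<Longrightarrow> \<epsilon> a \<in> component (I 0) j"
  using augmentation(1) unfolding gr_hom_def regular_module_simps by blast

lemma d_\<epsilon>: "a \<in> carrier A \<Longrightarrow> d 0 (\<epsilon> a) = \<zero>\<^bsub>I (Suc 0)\<^esub>"
  using exact_0 by auto

lemma \<epsilon>_zero: "\<epsilon> \<zero> = \<zero>\<^bsub>I 0\<^esub>"
  using \<epsilon>_mult[of \<zero> \<zero>] I.act_minus_one(2)[OF \<epsilon>_closed[of \<zero>]] by simp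

lemma cycles_0_image:
  assumes "w \<in> cycles 0 J j" shows "\<exists>a\<in>component A j. w = \<epsilon> a"
proof -
  have w: "w \<in> component (I 0) j" "d 0 w = \<zero>\<^bsub>I 1\<^esub>"
    using assms unfolding cycles_def torsion_def by simp_all
  then have "w \<in> \<epsilon> ` carrier A" using exact_0 I.component_carrier[OF w(1)] by blast
  then obtain a where a: "a \<in> carrier A" "w = \<epsilon> a" by blast
  have "hpart (I 0) (\<epsilon> a) (j + 0) = \<epsilon> (hpart A a j)"
    by (rule hpart_map[OF graded_group_axioms I.graded_group_axioms])
      (use \<epsilon>_closed \<epsilon>_add \<epsilon>_component a in auto)
  then have "w = \<epsilon> (hpart A a j)" using a(2) I.hpart_homogeneous[OF w(1)] by simp
  then show ?thesis using hpart_component[OF a(1)] by blast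
qed

lemma Ext_zero_free: "Ext_zero (Suc n) {\<zero>} j"
  unfolding Ext_zero_def
proof
  fix w assume w: "w \<in> cycles (Suc n) {\<zero>} j"
  have wj: "w \<in> component (I (Suc n)) j" using torsion_component[OF cycles_torsion[OF w]] .
  have "w \<in> d n ` carrier (I n)"
    using w cycles_carrier[OF w] exact_Suc[of n] unfolding cycles_def by blast
  then obtain x where x: "x \<in> carrier (I n)" "w = d n x" by blast
  have "hpart (I (Suc n)) (d n x) (j + 0) = d n (hpart (I n) x j)"
    by (rule hpart_map[OF I.graded_group_axioms[of n] I.graded_group_axioms[of "Suc n"]])
      (simp_all add: d_closed d_add d_component x)
  then have "w = d n (hpart (I n) x j)" using x(2) I.hpart_homogeneous[OF wj] by simp
  moreover have "hpart (I n) x j \<in> torsion n {\<zero>} j"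
    using I.hpart_component[OF x(1)] I.act_minus_one(2)[OF I.hpart_carrier[OF x(1)]]
    by (simp add: torsion_def)
  ultimately show "w \<in> boundaries (Suc n) {\<zero>} j" unfolding boundaries_Suc by blast
qed

text \<open>In cohomological degree zero, \<open>Ext(A/J, A(j))\<close> is a submodule of the component of \<open>A\<close> of degree
  \<open>j\<close>, whose \<open>A\<^sub>0\<close>-submodules are detected by graded ideals of \<open>A\<close>.\<close>

lemma Ext_noetherian_0:
  assumes J: "gr_ideal J" shows "Ext_noetherian 0 J j"
  unfolding Ext_noetherian_def
proof (intro allI impI)
  fix f :: "nat \<Rightarrow> 'c set"
  assume "\<forall>k. Ext_submodule 0 J j (f k) \<and> f k \<subseteq> f (Suc k)"
  then have f: "Ext_submodule 0 J j (f k)" and fS: "f k \<subseteq> f (Suc k)" for k by blast+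
  note fD = Ext_submoduleD[OF f]
  define U where "U k = {a \<in> component A j. \<epsilon> a \<in> f k}" for k
  \<comment> \<open>The largest graded ideal whose degree-\<open>j\<close> part lies in \<open>U k\<close>; that part is all of \<open>U k\<close>.\<close>
  define K where "K k = {a \<in> carrier A. \<forall>b\<in>carrier A. hpart A (a \<otimes> b) j \<in> U k}" for k
  have U0: "\<zero> \<in> U k" for k
    using zero_component \<epsilon>_zero fD(1)[of k] by (simp add: U_def boundaries_0)
  have U_add: "a \<oplus> b \<in> U k" if "a \<in> U k" "b \<in> U k" for a b k
    using that fD(3)[of _ k] component_add \<epsilon>_add[OF component_carrier component_carrier, of a j b j]
    by (simp add: U_def)
  have U_mult: "a \<otimes> b \<in> U k" if "a \<in> U k" "b \<in> component A 0" for a b k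
    using that fD(4)[OF that(2), of _ k] component_mult[of a j b 0]
      \<epsilon>_mult[OF component_carrier component_carrier, of a j b 0] by (simp add: U_def)
  have Ki: "gr_ideal (K k)" for k
  proof (rule gr_idealI)
    show "K k \<subseteq> carrier A" unfolding K_def by blast
    show "\<zero> \<in> K k" using U0 by (simp add: K_def hpart_zero)
    show "a \<oplus> b \<in> K k" if "a \<in> K k" "b \<in> K k" for a b
      using that U_add by (simp add: K_def l_distr hpart_add)
    show "a \<otimes> r \<in> K k" if "a \<in> K k" "r \<in> carrier A" for a r
      using that by (simp add: K_def m_assoc)
    show "hpart A a i \<in> K k" if a: "a \<in> K k" for a i
    proof -
      have ac: "a \<in> carrier A" using a unfolding K_def by blast
      have "hpart A (hpart A a i \<otimes> b) j \<in> U k" if b: "b \<in> carrier A" for b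
      proof -
        have "hpart A (hpart A a i \<otimes> b) j = hpart A a i \<otimes> hpart A b (j - i)"
          by (rule hpart_mult_homogeneous[OF hpart_component[OF ac] b])
        also have "\<dots> = hpart A (a \<otimes> hpart A b (j - i)) j"
          using hpart_homogeneous_mult[OF hpart_component[OF b] ac, of "j - i" j] by simp
        finally show ?thesis using a hpart_carrier[OF b] unfolding K_def by simp
      qed
      then show ?thesis using hpart_carrier[OF ac] unfolding K_def by blast
    qed
  qed
  have KU: "a \<in> K k \<longleftrightarrow> a \<in> U k" if a: "a \<in> component A j" for a k
  proof
    have ac: "a \<in> carrier A" using component_carrier[OF a] .
    show "a \<in> U k" if "a \<in> K k"
    proof -
      have "hpart A (a \<otimes> \<one>) j \<in> U k" using that one_closed unfolding K_def by blast
      then show ?thesis using ac hpart_homogeneous[OF a] by simp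
    qed
    show "a \<in> K k" if aU: "a \<in> U k"
      using ac hpart_mult_homogeneous[OF a] U_mult[OF aU hpart_component] by (simp add: K_def)
  qed
  have "K k \<subseteq> K (Suc k)" for k using fS[of k] unfolding K_def U_def by blast
  then obtain m where m: "\<And>k. k \<ge> m \<Longrightarrow> K k = K m"
    using noetherian Ki unfolding gr_noetherian_def gr_ideal_def by meson
  have "f k = f m" if k: "k \<ge> m" for k
  proof -
    have "w \<in> f k \<longleftrightarrow> w \<in> f m" if w: "w \<in> cycles 0 J j" for w
    proof -
      obtain a where a: "a \<in> component A j" "w = \<epsilon> a" using cycles_0_image[OF w] by blast
      then show ?thesis using KU[OF a(1)] m[OF k] by (auto simp: U_def)
    qed
    then show ?thesis using fD(2) by blast
  qed
  then show "\<exists>m. \<forall>k\<ge>m. f k = f m" by blast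
qed

text \<open>Dimension shifting: \<open>J\<close> is filtered, along its generators, by shifted cyclic modules, and \<open>Ext\<close> of
  these one degree lower is already known to be Noetherian.\<close>

lemma Ext_noetherian:
  assumes J: "gr_ideal J" shows "Ext_noetherian n J j"
  using J
proof (induction n arbitrary: J j)
  case 0
  then show ?case by (rule Ext_noetherian_0)
next
  case (Suc n)
  have "{\<zero>} \<subseteq> J" using gr_ideal_zero[OF Suc.prems] by simp
  with gr_ideal_zero_ideal Suc.prems have "\<forall>j. Ext_noetherian (Suc n) J j"
  proof (induction rule: gr_ideal_generator_induct)
    case base
    show ?case using Ext_noetherian_if_zero[OF Ext_zero_free] by blast
  next
    case (adjoin K a s)
    show ?case
      using Ext_noetherian_adjoin[OF adjoin(1,3) Suc.IH[OF gr_ideal_colon[OF adjoin(1,3)]]] adjoin(4)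
      by blast
  qed
  then show ?case by blast
qed

lemma Ext_zero_if_onto:
  assumes J: "gr_ideal J" and x: "x \<in> nonunits"
    and onto: "\<And>w. w \<in> cycles n J j \<Longrightarrow> \<exists>w'\<in>cycles n J j. x \<odot>\<^bsub>I n\<^esub> w' = w"
  shows "Ext_zero n J j"
proof (rule Ext_nakayama[OF Ext_noetherian[OF J] gr_ideal_subset[OF J] x])
  fix w assume w: "w \<in> cycles n J j"
  then obtain w' where w': "w' \<in> cycles n J j" "x \<odot>\<^bsub>I n\<^esub> w' = w" using onto by blast
  have "w \<ominus>\<^bsub>I n\<^esub> x \<odot>\<^bsub>I n\<^esub> w' \<in> boundaries n J j"
    using w'(2) cycles_carrier[OF w] boundaries_zero[OF gr_ideal_subset[OF J]]
    by (simp add: a_minus_def I.r_neg)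
  then show "\<exists>w'\<in>cycles n J j. w \<ominus>\<^bsub>I n\<^esub> x \<odot>\<^bsub>I n\<^esub> w' \<in> boundaries n J j" using w'(1) by blast
qed

end

context finite_injective_resolution
begin

section \<open>Cohomology of a maximal regular sequence\<close>

lemma boundaries_cong:
  assumes J: "J \<subseteq> carrier A" and c: "u \<in> carrier (I n)" "v \<in> carrier (I n)"
    and uv: "u \<ominus>\<^bsub>I n\<^esub> v \<in> boundaries n J j"
  shows "u \<in> boundaries n J j \<longleftrightarrow> v \<in> boundaries n J j"
proof
  show "v \<in> boundaries n J j" if "u \<in> boundaries n J j"
    using boundaries_diff[OF J that uv] diff_add_cancel(2)[OF c] by simp
  show "u \<in> boundaries n J j" if "v \<in> boundaries n J j"
    using boundaries_add[OF J uv that] diff_add_cancel(1)[OF c] by simp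
qed

text \<open>The map \<open>a \<mapsto> a w\<close> induces an isomorphism of graded modules from \<open>A/X\<close> to the sum over \<open>j\<close> of the
  \<open>t\<close>-th groups \<open>Ext(A/X, A(j))\<close>.\<close>

definition Ext_generator :: "nat \<Rightarrow> 'a set \<Rightarrow> 'c \<Rightarrow> bool" where
  "Ext_generator t X w \<longleftrightarrow> w \<in> cycles t X 0 \<and>
     (\<forall>j. \<forall>c\<in>cycles t X j. \<exists>a\<in>component A j. c \<ominus>\<^bsub>I t\<^esub> a \<odot>\<^bsub>I t\<^esub> w \<in> boundaries t X j) \<and>
     (\<forall>j. \<forall>a\<in>component A j. a \<odot>\<^bsub>I t\<^esub> w \<in> boundaries t X j \<longrightarrow> a \<in> X)"

lemma Ext_generatorD:
  assumes "Ext_generator t X w"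
  shows "w \<in> cycles t X 0"
    "c \<in> cycles t X j \<Longrightarrow> \<exists>a\<in>component A j. c \<ominus>\<^bsub>I t\<^esub> a \<odot>\<^bsub>I t\<^esub> w \<in> boundaries t X j"
    "\<lbrakk>a \<in> component A j; a \<odot>\<^bsub>I t\<^esub> w \<in> boundaries t X j\<rbrakk> \<Longrightarrow> a \<in> X"
  using assms unfolding Ext_generator_def by blast+

lemma Ext_generator_0: "Ext_generator 0 {\<zero>} (\<epsilon> \<one>)"
proof -
  have \<epsilon>1: "a \<odot>\<^bsub>I 0\<^esub> \<epsilon> \<one> = \<epsilon> a" if "a \<in> carrier A" for a
    using \<epsilon>_mult[OF one_closed that] that by simp
  have "\<epsilon> \<one> \<in> cycles 0 {\<zero>} 0"
    using \<epsilon>_component[OF one_component] \<epsilon>1[of \<zero>] \<epsilon>_zero d_\<epsilon>[OF one_closed]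
    by (simp add: cycles_def torsion_def)
  moreover have "\<exists>a\<in>component A j. c \<ominus>\<^bsub>I 0\<^esub> a \<odot>\<^bsub>I 0\<^esub> \<epsilon> \<one> \<in> boundaries 0 {\<zero>} j"
    if c: "c \<in> cycles 0 {\<zero>} j" for c j
  proof -
    obtain a where a: "a \<in> component A j" "c = \<epsilon> a" using cycles_0_image[OF c] by blast
    then have "c \<ominus>\<^bsub>I 0\<^esub> a \<odot>\<^bsub>I 0\<^esub> \<epsilon> \<one> \<in> boundaries 0 {\<zero>} j"
      using \<epsilon>1[OF component_carrier[OF a(1)]] \<epsilon>_closed[OF component_carrier[OF a(1)]]
      by (simp add: boundaries_0 a_minus_def I.r_neg)
    then show ?thesis using a(1) by blast
  qed
  moreover have "a \<in> {\<zero>}"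
    if a: "a \<in> component A j" "a \<odot>\<^bsub>I 0\<^esub> \<epsilon> \<one> \<in> boundaries 0 {\<zero>} j" for a j
  proof -
    have ac: "a \<in> carrier A" using component_carrier[OF a(1)] .
    have "\<epsilon> a = \<epsilon> \<zero>" using a(2) \<epsilon>1[OF ac] \<epsilon>_zero by (simp add: boundaries_0)
    then show ?thesis using inj_onD[OF augmentation(2) _ ac zero_closed] by blast
  qed
  ultimately show ?thesis unfolding Ext_generator_def by blast
qed

text \<open>Rees' theorem: since \<open>x\<close> acts injectively on \<open>Ext(A/X, A) = A/X\<close>, the long exact sequence of
  multiplication by \<open>x\<close> moves the only cohomology group up by one and divides it by \<open>x\<close>. The
  grading is not shifted as \<open>x\<close> has degree zero.\<close>

lemma Ext_regular_ideal:
  assumes "regular_ideal t X"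
  shows "(\<forall>n j. n \<noteq> t \<longrightarrow> Ext_zero n X j) \<and> (\<exists>w. Ext_generator t X w)"
  using assms
proof induction
  case zero
  have "Ext_zero n {\<zero>} j" if "n \<noteq> 0" for n j
    using Ext_zero_free[of "n - 1" j] that by simp
  then show ?case using Ext_generator_0 by blast
next
  case (adjoin t X x)
  note x = adjoin.hyps(2)
  have reg: "colon X x = X" using adjoin.hyps by blast
  have X: "gr_ideal X" using regular_ideal_ideal(1) adjoin.hyps(1) .
  have zero: "Ext_zero n X j" if "n \<noteq> t" for n j using adjoin.IH that by blast
  obtain w where w: "Ext_generator t X w" using adjoin.IH by blast
  note wD = Ext_generatorD[OF w]
  note x0 = nonunitsD(1)[OF x] and xc = nonunitsD(2)[OF x] and Xs = gr_ideal_subset[OF X]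
  let ?X = "adjoin X x"
  have X': "gr_ideal ?X" by (rule gr_ideal_adjoin[OF X x0])
  note X's = gr_ideal_subset[OF X']
  have XX': "X \<subseteq> ?X" by (rule adjoin_superset[OF X xc])
  have wc: "w \<in> carrier (I t)" using cycles_carrier[OF wD(1)] .
  have ker: "a \<odot>\<^bsub>I t\<^esub> w = \<zero>\<^bsub>I t\<^esub>" if "a \<in> X" for a
    using torsionD[OF cycles_torsion[OF wD(1)] that] .
  \<comment> \<open>The map from the cohomology of \<open>adjoin X x\<close> to that of \<open>X\<close> is zero: its image is killed by \<open>x\<close>.\<close>
  have bnd: "u \<in> boundaries n X j" if u: "u \<in> cycles n ?X j" and n: "n \<noteq> Suc t" for u n j
  proof (cases "n = t")
    case False
    then show ?thesis using zero u cycles_antimono[OF XX'] unfolding Ext_zero_def by blast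
  next
    case n: True
    have uX: "u \<in> cycles t X j" using u n cycles_antimono[OF XX'] by blast
    have uc: "u \<in> carrier (I t)" using cycles_carrier[OF uX] .
    obtain a where a: "a \<in> component A j" "u \<ominus>\<^bsub>I t\<^esub> a \<odot>\<^bsub>I t\<^esub> w \<in> boundaries t X j"
      using wD(2)[OF uX] by blast
    have ac: "a \<in> carrier A" using component_carrier[OF a(1)] .
    have aw: "a \<odot>\<^bsub>I t\<^esub> w \<in> carrier (I t)" by (rule I.act_closed[OF ac wc])
    have xu: "x \<odot>\<^bsub>I t\<^esub> u = \<zero>\<^bsub>I t\<^esub>"
      using torsion_adjoinD(2)[OF X x0 cycles_torsion[OF u]] n by simp
    have "x \<odot>\<^bsub>I t\<^esub> u \<ominus>\<^bsub>I t\<^esub> x \<odot>\<^bsub>I t\<^esub> (a \<odot>\<^bsub>I t\<^esub> w) \<in> boundaries t X j"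
      using boundaries_act[OF Xs a(2) x0] act_diff[OF xc uc aw] by simp
    then have "x \<odot>\<^bsub>I t\<^esub> (a \<odot>\<^bsub>I t\<^esub> w) \<in> boundaries t X j"
      using boundaries_cong[OF Xs I.act_closed[OF xc uc] I.act_closed[OF xc aw]]
        boundaries_zero[OF Xs, of t j] xu by simp
    then have "(a \<otimes> x) \<odot>\<^bsub>I t\<^esub> w \<in> boundaries t X j" using I.act_assoc[OF ac xc wc] by simp
    moreover have "a \<otimes> x \<in> component A j" using component_mult[OF a(1) x0] by simp
    ultimately have "a \<otimes> x \<in> X" by (intro wD(3))
    then have "a \<in> colon X x" using ac xc m_comm[OF ac xc] by (simp add: colon_def)
    then have "a \<odot>\<^bsub>I t\<^esub> w \<in> boundaries t X j" using ker reg boundaries_zero[OF Xs] by simp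
    then show ?thesis using boundaries_cong[OF Xs uc aw a(2)] n by simp
  qed
  have "Ext_zero n ?X j" if n: "n \<noteq> Suc t" for n j
    unfolding Ext_zero_def
  proof
    fix u assume u: "u \<in> cycles n ?X j"
    show "u \<in> boundaries n ?X j"
    proof (cases n)
      case 0
      then show ?thesis using bnd[OF u n] by (simp add: boundaries_0)
    next
      case (Suc m)
      obtain y where y: "y \<in> torsion m X j" "u = d m y" "x \<odot>\<^bsub>I m\<^esub> y \<in> cycles m (colon X x) (j + 0)"
        using cycle_connecting[OF X x0 u[unfolded Suc] bnd[OF u n, unfolded Suc]] by blast
      have "Ext_zero m X (j + 0)" using zero n Suc by simp
      then have "x \<odot>\<^bsub>I m\<^esub> y \<in> boundaries m (colon X x) (j + 0)"
        using y(3) unfolding Ext_zero_def reg by blast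
      then show ?thesis unfolding y(2) Suc by (rule connecting_boundary[OF X x0 y(1)])
    qed
  qed
  moreover have "\<exists>w. Ext_generator (Suc t) ?X w"
  proof -
    have "w \<in> torsion t (colon X x) (0 + 0)" using cycles_torsion[OF wD(1)] reg by simp
    then obtain y where y: "y \<in> torsion t X 0" "x \<odot>\<^bsub>I t\<^esub> y = w" using torsion_lift[OF X x0] by blast
    have yc: "y \<in> carrier (I t)" using torsion_carrier[OF y(1)] .
    have dy: "d t y \<in> cycles (Suc t) ?X 0"
      by (rule connecting_cycle[OF X x0 y(1)]) (use wD(1) y(2) in \<open>simp add: cycles_def\<close>)
    have ay: "a \<odot>\<^bsub>I t\<^esub> y \<in> torsion t X j" if "a \<in> component A j" for a j
      using torsion_act[OF Xs y(1) that] by simp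
    have xay: "x \<odot>\<^bsub>I t\<^esub> (a \<odot>\<^bsub>I t\<^esub> y) = a \<odot>\<^bsub>I t\<^esub> w" if "a \<in> carrier A" for a
      using act_comm[OF xc that yc] y(2) by simp
    have "\<exists>a\<in>component A j. c \<ominus>\<^bsub>I (Suc t)\<^esub> a \<odot>\<^bsub>I (Suc t)\<^esub> d t y \<in> boundaries (Suc t) ?X j"
      if c: "c \<in> cycles (Suc t) ?X j" for c j
    proof -
      have "c \<in> boundaries (Suc t) X j"
        using zero[of "Suc t" j] c cycles_antimono[OF XX'] unfolding Ext_zero_def by auto
      then obtain u where u: "u \<in> torsion t X j" "c = d t u" "x \<odot>\<^bsub>I t\<^esub> u \<in> cycles t (colon X x) (j + 0)"
        using cycle_connecting[OF X x0 c] by blast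
      have uc: "u \<in> carrier (I t)" using torsion_carrier[OF u(1)] .
      obtain a where a: "a \<in> component A j" "x \<odot>\<^bsub>I t\<^esub> u \<ominus>\<^bsub>I t\<^esub> a \<odot>\<^bsub>I t\<^esub> w \<in> boundaries t X j"
        using wD(2)[of "x \<odot>\<^bsub>I t\<^esub> u" j] u(3) reg by auto
      have ac: "a \<in> carrier A" using component_carrier[OF a(1)] .
      have ayc: "a \<odot>\<^bsub>I t\<^esub> y \<in> carrier (I t)" by (rule I.act_closed[OF ac yc])
      have "x \<odot>\<^bsub>I t\<^esub> (u \<ominus>\<^bsub>I t\<^esub> a \<odot>\<^bsub>I t\<^esub> y) \<in> boundaries t (colon X x) (j + 0)"
        using a(2) act_diff[OF xc uc ayc] xay[OF ac] reg by simp
      then have "d t (u \<ominus>\<^bsub>I t\<^esub> a \<odot>\<^bsub>I t\<^esub> y) \<in> boundaries (Suc t) ?X j"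
        by (rule connecting_boundary[OF X x0 torsion_diff[OF Xs u(1) ay[OF a(1)]]])
      then have "c \<ominus>\<^bsub>I (Suc t)\<^esub> a \<odot>\<^bsub>I (Suc t)\<^esub> d t y \<in> boundaries (Suc t) ?X j"
        using d_diff[OF uc ayc] d_act[OF ac yc] u(2) by simp
      then show ?thesis using a(1) by blast
    qed
    moreover have "a \<in> ?X"
      if a: "a \<in> component A j" "a \<odot>\<^bsub>I (Suc t)\<^esub> d t y \<in> boundaries (Suc t) ?X j" for a j
    proof -
      have ac: "a \<in> carrier A" using component_carrier[OF a(1)] .
      have ayc: "a \<odot>\<^bsub>I t\<^esub> y \<in> carrier (I t)" by (rule I.act_closed[OF ac yc])
      obtain v where v: "v \<in> torsion t ?X j" "d t (a \<odot>\<^bsub>I t\<^esub> y) = d t v"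
        using a(2) d_act[OF ac yc] by (auto simp: boundaries_Suc)
      have vX: "v \<in> torsion t X j" "x \<odot>\<^bsub>I t\<^esub> v = \<zero>\<^bsub>I t\<^esub>" using torsion_adjoinD[OF X x0 v(1)] by blast+
      have vc: "v \<in> carrier (I t)" using torsion_carrier[OF v(1)] .
      have "a \<odot>\<^bsub>I t\<^esub> y \<ominus>\<^bsub>I t\<^esub> v \<in> cycles t X j"
        using torsion_diff[OF Xs ay[OF a(1)] vX(1)] d_diff[OF ayc vc] v(2) d_closed[OF vc]
        by (simp add: cycles_def a_minus_def I.r_neg)
      then obtain b where b: "b \<in> component A j"
        "(a \<odot>\<^bsub>I t\<^esub> y \<ominus>\<^bsub>I t\<^esub> v) \<ominus>\<^bsub>I t\<^esub> b \<odot>\<^bsub>I t\<^esub> w \<in> boundaries t X j"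
        using wD(2) by blast
      have bc: "b \<in> carrier A" using component_carrier[OF b(1)] .
      have bwc: "b \<odot>\<^bsub>I t\<^esub> w \<in> carrier (I t)" by (rule I.act_closed[OF bc wc])
      have awc: "a \<odot>\<^bsub>I t\<^esub> w \<in> carrier (I t)" by (rule I.act_closed[OF ac wc])
      have avc: "a \<odot>\<^bsub>I t\<^esub> y \<ominus>\<^bsub>I t\<^esub> v \<in> carrier (I t)" using ayc vc by simp
      have "x \<odot>\<^bsub>I t\<^esub> (a \<odot>\<^bsub>I t\<^esub> y \<ominus>\<^bsub>I t\<^esub> v) = a \<odot>\<^bsub>I t\<^esub> w"
        using act_diff[OF xc ayc vc] xay[OF ac] vX(2) awc by (simp add: a_minus_def)
      moreover have "x \<odot>\<^bsub>I t\<^esub> ((a \<odot>\<^bsub>I t\<^esub> y \<ominus>\<^bsub>I t\<^esub> v) \<ominus>\<^bsub>I t\<^esub> b \<odot>\<^bsub>I t\<^esub> w) \<in> boundaries t X j"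
        using boundaries_act[OF Xs b(2) x0] by simp
      ultimately have "a \<odot>\<^bsub>I t\<^esub> w \<ominus>\<^bsub>I t\<^esub> (b \<otimes> x) \<odot>\<^bsub>I t\<^esub> w \<in> boundaries t X j"
        using act_diff[OF xc avc bwc] I.act_assoc[OF bc xc wc] by simp
      then have "(a \<ominus> b \<otimes> x) \<odot>\<^bsub>I t\<^esub> w \<in> boundaries t X j"
        using act_diff_scalar[OF ac m_closed[OF bc xc] wc] by simp
      moreover have "a \<ominus> b \<otimes> x \<in> component A j"
        using component_diff[OF a(1)] component_mult[OF b(1) x0] by simp
      ultimately have "a \<ominus> b \<otimes> x \<in> X" by (intro wD(3))
      moreover have "a = (a \<ominus> b \<otimes> x) \<oplus> x \<otimes> b"
        using ac bc xc by (simp add: minus_eq a_assoc l_neg m_comm)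
      ultimately show ?thesis using bc unfolding adjoin_def by blast
    qed
    ultimately show ?thesis using dy unfolding Ext_generator_def by blast
  qed
  ultimately show ?case by blast
qed

lemma Ext_zero_regular_ideal: "\<lbrakk>regular_ideal t X; n \<noteq> t\<rbrakk> \<Longrightarrow> Ext_zero n X j"
  using Ext_regular_ideal by blast

text \<open>Bass' argument. A graded ideal \<open>P\<close> that is maximal with nonzero \<open>n\<close>-th group \<open>Ext(A/P, A)\<close> is
  prime: for homogeneous \<open>a\<close> outside \<open>P\<close> that group lies between those of \<open>P + aA\<close> and \<open>(P : a)\<close>, and
  both would vanish if \<open>(P : a)\<close> were larger than \<open>P\<close>. So \<open>(P : a) = P\<close> and, as nothing survives in
  degree \<open>n + 1\<close>, such an \<open>a\<close> acts surjectively on \<open>Ext(A/P, A)\<close>. By Nakayama's lemma \<open>P\<close> must contain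
  all nonunits of degree zero, so it is the maximal ideal, whose \<open>Ext\<close> is assumed to vanish.\<close>

lemma Ext_zero_if_max_ideal:
  assumes above: "\<And>J j. gr_ideal J \<Longrightarrow> Ext_zero (Suc n) J j"
    and residue: "\<And>j. Ext_zero n max_ideal j" and J: "gr_ideal J"
  shows "Ext_zero n J j"
proof (rule ccontr)
  assume "\<not> Ext_zero n J j"
  define \<S> where "\<S> = {J. gr_ideal J \<and> \<not> (\<forall>j. Ext_zero n J j)}"
  have "\<exists>U\<in>\<S>. \<forall>V\<in>\<S>. U \<subseteq> V \<longrightarrow> V = U"
    by (rule gr_ideal_maximal) (use J \<open>\<not> Ext_zero n J j\<close> in \<open>auto simp: \<S>_def\<close>)
  then obtain P where "P \<in> \<S>" and max: "\<forall>V\<in>\<S>. P \<subseteq> V \<longrightarrow> V = P" by (rule bexE)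
  then obtain i where P: "gr_ideal P" and i: "\<not> Ext_zero n P i" unfolding \<S>_def by blast
  have larger: "Ext_zero n K j" if "gr_ideal K" "P \<subseteq> K" "K \<noteq> P" for K j
    using max that unfolding \<S>_def by blast
  note Ps = gr_ideal_subset[OF P]
  have lift: "\<exists>y\<in>cycles n P j. a \<odot>\<^bsub>I n\<^esub> y = z"
    if "a \<in> component A s" "z \<in> cycles n (colon P a) (j + s)" for a s j z
    by (rule cycles_lift[OF P that above[OF gr_ideal_adjoin[OF P that(1)]]])
  have prime: "colon P a = P" if a: "a \<in> component A s" "a \<notin> P" for a s
  proof (rule ccontr)
    assume ne: "colon P a \<noteq> P"
    note ac = component_carrier[OF a(1)]
    have sub: "P \<subseteq> adjoin P a" by (rule adjoin_superset[OF P ac])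
    have adj: "Ext_zero n (adjoin P a) i"
      by (rule larger[OF gr_ideal_adjoin[OF P a(1)] sub]) (use adjoin_mem[OF P ac] a(2) in blast)
    have col: "Ext_zero n (colon P a) (i + s)"
      by (rule larger[OF gr_ideal_colon[OF P a(1)] colon_superset[OF P ac] ne])
    have "w \<in> boundaries n P i" if w: "w \<in> cycles n P i" for w
    proof -
      have "a \<odot>\<^bsub>I n\<^esub> w \<in> boundaries n (colon P a) (i + s)"
        using cycles_colon[OF Ps a(1) w] col unfolding Ext_zero_def by blast
      then obtain w' where w': "w' \<in> cycles n (adjoin P a) i" "w \<ominus>\<^bsub>I n\<^esub> w' \<in> boundaries n P i"
        using cycle_adjoin[OF P a(1) w] by blast
      have "w' \<in> boundaries n P i"
        using w'(1) adj boundaries_antimono[OF sub] unfolding Ext_zero_def by blast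
      then show ?thesis
        using boundaries_cong[OF Ps cycles_carrier[OF w] cycles_carrier[OF w'(1)] w'(2)] by simp
    qed
    then show False using i unfolding Ext_zero_def by blast
  qed
  have "\<one> \<notin> P"
  proof
    assume one: "\<one> \<in> P"
    have "w \<in> boundaries n P i" if w: "w \<in> cycles n P i" for w
      using torsionD[OF cycles_torsion[OF w] one] I.act_one[OF cycles_carrier[OF w]]
        boundaries_zero[OF Ps] by simp
    then show False using i unfolding Ext_zero_def by blast
  qed
  then have "gr_prime P" using P prime unfolding gr_prime_def by blast
  note degree = gr_prime_nonzero_degree[OF this]
  have "max_ideal \<subseteq> P"
  proof (rule gr_ideal_subsetI[OF gr_ideal_max_ideal P])
    fix a s assume a: "a \<in> max_ideal" "a \<in> component A s"
    show "a \<in> P"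
    proof (rule ccontr)
      assume aP: "a \<notin> P"
      then have s: "s = 0" using degree[OF a(2)] by blast
      then have "a \<in> nonunits" using a max_ideal_homogeneous by blast
      then have "Ext_zero n P i"
      proof (rule Ext_zero_if_onto[OF P])
        show "\<exists>w'\<in>cycles n P i. a \<odot>\<^bsub>I n\<^esub> w' = w" if "w \<in> cycles n P i" for w
          by (rule lift[OF a(2)]) (use that prime[OF a(2) aP] s in simp)
      qed
      then show False using i by blast
    qed
  qed
  then have "P = max_ideal" using proper_subset_max_ideal[OF P \<open>\<one> \<notin> P\<close>] by blast
  then show False using i residue by blast
qed

text \<open>Descending induction from the length of the resolution. Multiplication by \<open>z\<close> embeds the residue
  field into \<open>A/X\<close>. If \<open>Ext\<close> vanishes in degree \<open>n + 1\<close>, then in degree \<open>n\<close> the group of the residue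
  field is a quotient of that of \<open>A/X\<close>, which is zero for \<open>n > t\<close>.\<close>

lemma Ext_zero_above:
  assumes X: "regular_ideal t X" and z: "z \<in> component A s" "colon X z = max_ideal"
    and n: "t < n" and J: "gr_ideal J"
  shows "Ext_zero n J j"
  using n J
proof (induction "Suc len - n" arbitrary: n J j rule: less_induct)
  case (less n J j)
  have Xi: "gr_ideal X" using regular_ideal_ideal(1)[OF X] .
  show ?case
  proof (cases "len < n")
    case True
    then have "w = \<zero>\<^bsub>I n\<^esub>" if "w \<in> cycles n J j" for w
      using finite_length cycles_carrier[OF that] by blast
    then show ?thesis
      using boundaries_zero[OF gr_ideal_subset[OF less.prems(2)]] unfolding Ext_zero_def by blast
  next
    case False
    have above: "Ext_zero (Suc n) J j" if "gr_ideal J" for J j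
      by (rule less.hyps) (use False less.prems(1) that in auto)
    have residue: "Ext_zero n max_ideal j" for j
      unfolding Ext_zero_def
    proof
      fix w assume "w \<in> cycles n max_ideal j"
      then have "w \<in> cycles n (colon X z) ((j - s) + s)" using z(2) by simp
      then obtain y where y: "y \<in> cycles n X (j - s)" "z \<odot>\<^bsub>I n\<^esub> y = w"
        using cycles_lift[OF Xi z(1) _ above[OF gr_ideal_adjoin[OF Xi z(1)]]] by blast
      have "y \<in> boundaries n X (j - s)"
        using Ext_zero_regular_ideal[OF X, of n "j - s"] less.prems(1) y(1)
        unfolding Ext_zero_def by auto
      then have "w \<in> boundaries n (colon X z) ((j - s) + s)"
        using boundaries_colon[OF gr_ideal_subset[OF Xi] z(1)] y(2) by blast
      then show "w \<in> boundaries n max_ideal j" using z(2) by simp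
    qed
    show ?thesis by (rule Ext_zero_if_max_ideal[OF above residue less.prems(2)])
  qed
qed

text \<open>The module \<open>A/J\<close> arises from \<open>A/X\<close> by dividing out cyclic modules over \<open>A/X\<close> one after the other;
  dimension shifting starts from the vanishing of \<open>Ext(A/X, A)\<close> below degree \<open>t\<close>.\<close>

lemma Ext_zero_below:
  assumes X: "regular_ideal t X" and n: "n < t" and J: "gr_ideal J" "X \<subseteq> J"
  shows "Ext_zero n J j"
  using n J
proof (induction n arbitrary: J j)
  case (0 J j)
  have "cycles 0 J j \<subseteq> boundaries 0 X j"
    using Ext_zero_regular_ideal[OF X, of 0 j] cycles_antimono[OF 0(3), of 0 j] 0(1)
    unfolding Ext_zero_def by simp
  then show ?case by (simp add: Ext_zero_def boundaries_0)
next
  case (Suc n J j)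
  have Xi: "gr_ideal X" using regular_ideal_ideal(1)[OF X] .
  from Xi Suc.prems(2,3) have "\<forall>j. Ext_zero (Suc n) J j"
  proof (induction rule: gr_ideal_generator_induct)
    case base
    show ?case using Ext_zero_regular_ideal[OF X] Suc.prems(1) by simp
  next
    case (adjoin K a s)
    note K = adjoin(1) and XK = adjoin(2) and a = adjoin(3)
    note ac = component_carrier[OF a]
    have "w \<in> boundaries (Suc n) (adjoin K a) j" if w: "w \<in> cycles (Suc n) (adjoin K a) j" for w j
    proof -
      have "w \<in> boundaries (Suc n) K j"
        using w adjoin(4) cycles_antimono[OF adjoin_superset[OF K ac]] unfolding Ext_zero_def by blast
      then obtain y where y: "y \<in> torsion n K j" "w = d n y" "a \<odot>\<^bsub>I n\<^esub> y \<in> cycles n (colon K a) (j + s)"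
        using cycle_connecting[OF K a w] by blast
      have "Ext_zero n (colon K a) (j + s)"
        by (rule Suc.IH[OF _ gr_ideal_colon[OF K a] order_trans[OF XK colon_superset[OF K ac]]])
          (use Suc.prems(1) in simp)
      then show ?thesis
        using connecting_boundary[OF K a y(1)] y(2,3) unfolding Ext_zero_def by blast
    qed
    then show ?case unfolding Ext_zero_def by blast
  qed
  then show ?case by blast
qed

text \<open>By \<open>Ext_zero_below\<close> the \<open>t\<close>-th functor \<open>Ext(-, A)\<close> is left exact on modules over \<open>A/X\<close>. The next
  two lemmas make this explicit for the surjection from \<open>A/X\<close> onto \<open>A/J\<close>: the induced map is
  injective and its image is the \<open>J\<close>-torsion of \<open>Ext(A/X, A)\<close>.\<close>

lemma Ext_inclusion:
  assumes X: "regular_ideal t X" and J: "gr_ideal J" "X \<subseteq> J"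
  shows "cycles t J j \<inter> boundaries t X j \<subseteq> boundaries t J j"
proof (cases t)
  case 0
  then show ?thesis by (simp add: boundaries_0)
next
  case (Suc m)
  have Xi: "gr_ideal X" using regular_ideal_ideal(1)[OF X] .
  from Xi J have "\<forall>j. cycles t J j \<inter> boundaries t X j \<subseteq> boundaries t J j"
  proof (induction rule: gr_ideal_generator_induct)
    case base
    then show ?case by blast
  next
    case (adjoin K a s)
    note K = adjoin(1) and XK = adjoin(2) and a = adjoin(3)
    note ac = component_carrier[OF a]
    have "w \<in> boundaries t (adjoin K a) j"
      if w: "w \<in> cycles t (adjoin K a) j" "w \<in> boundaries t X j" for w j
    proof -
      have "w \<in> boundaries t K j"
        using w adjoin(4) cycles_antimono[OF adjoin_superset[OF K ac]] by blast
      then obtain y where y: "y \<in> torsion m K j" "w = d m y" "a \<odot>\<^bsub>I m\<^esub> y \<in> cycles m (colon K a) (j + s)"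
        using cycle_connecting[OF K a w(1)[unfolded Suc]] unfolding Suc by blast
      have "Ext_zero m (colon K a) (j + s)"
        by (rule Ext_zero_below[OF X _ gr_ideal_colon[OF K a] order_trans[OF XK colon_superset[OF K ac]]])
          (simp add: Suc)
      then show ?thesis
        using connecting_boundary[OF K a y(1)] y(2,3) unfolding Ext_zero_def Suc by blast
    qed
    then show ?case by blast
  qed
  then show ?thesis by blast
qed

lemma Ext_torsion:
  assumes X: "regular_ideal t X" and J: "gr_ideal J" "X \<subseteq> J" and w: "w \<in> cycles t X j"
    and ann: "\<And>a s. \<lbrakk>a \<in> J; a \<in> component A s\<rbrakk> \<Longrightarrow> a \<odot>\<^bsub>I t\<^esub> w \<in> boundaries t X (j + s)"
  shows "\<exists>w'\<in>cycles t J j. w \<ominus>\<^bsub>I t\<^esub> w' \<in> boundaries t X j"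
proof -
  have Xi: "gr_ideal X" using regular_ideal_ideal(1)[OF X] .
  note Xs = gr_ideal_subset[OF Xi]
  note wc = cycles_carrier[OF w]
  from Xi J
  have "(\<forall>s. \<forall>a\<in>J \<inter> component A s. a \<odot>\<^bsub>I t\<^esub> w \<in> boundaries t X (j + s)) \<longrightarrow>
    (\<exists>w'\<in>cycles t J j. w \<ominus>\<^bsub>I t\<^esub> w' \<in> boundaries t X j)"
  proof (induction rule: gr_ideal_generator_induct)
    case base
    have "w \<ominus>\<^bsub>I t\<^esub> w \<in> boundaries t X j"
      using wc boundaries_zero[OF Xs] by (simp add: a_minus_def I.r_neg)
    then show ?case using w by blast
  next
    case (adjoin K a s)
    note K = adjoin(1) and XK = adjoin(2) and a = adjoin(3)
    note ac = component_carrier[OF a]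
    show ?case
    proof
      assume ann: "\<forall>s. \<forall>b\<in>adjoin K a \<inter> component A s. b \<odot>\<^bsub>I t\<^esub> w \<in> boundaries t X (j + s)"
      then have "\<forall>s. \<forall>b\<in>K \<inter> component A s. b \<odot>\<^bsub>I t\<^esub> w \<in> boundaries t X (j + s)"
        using adjoin_superset[OF K ac] by blast
      then obtain u where u: "u \<in> cycles t K j" "w \<ominus>\<^bsub>I t\<^esub> u \<in> boundaries t X j"
        using adjoin(4) by blast
      have uc: "u \<in> carrier (I t)" using cycles_carrier[OF u(1)] .
      have "a \<odot>\<^bsub>I t\<^esub> w \<in> boundaries t X (j + s)" using ann adjoin_mem[OF K ac] a by blast
      moreover have "a \<odot>\<^bsub>I t\<^esub> w \<ominus>\<^bsub>I t\<^esub> a \<odot>\<^bsub>I t\<^esub> u \<in> boundaries t X (j + s)"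
        using boundaries_act[OF Xs u(2) a] act_diff[OF ac wc uc] by simp
      ultimately have "a \<odot>\<^bsub>I t\<^esub> u \<in> boundaries t X (j + s)"
        using boundaries_cong[OF Xs I.act_closed[OF ac wc] I.act_closed[OF ac uc]] by blast
      then have "a \<odot>\<^bsub>I t\<^esub> u \<in> boundaries t (colon K a) (j + s)"
        using Ext_inclusion[OF X gr_ideal_colon[OF K a] order_trans[OF XK colon_superset[OF K ac]]]
          cycles_colon[OF gr_ideal_subset[OF K] a u(1)] by blast
      then obtain v where v: "v \<in> cycles t (adjoin K a) j" "u \<ominus>\<^bsub>I t\<^esub> v \<in> boundaries t K j"
        using cycle_adjoin[OF K a u(1)] by blast
      have vc: "v \<in> carrier (I t)" using cycles_carrier[OF v(1)] .
      have "u \<ominus>\<^bsub>I t\<^esub> v \<in> boundaries t X j" using v(2) boundaries_antimono[OF XK] by blast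
      then have "(w \<ominus>\<^bsub>I t\<^esub> u) \<oplus>\<^bsub>I t\<^esub> (u \<ominus>\<^bsub>I t\<^esub> v) \<in> boundaries t X j"
        by (rule boundaries_add[OF Xs u(2)])
      moreover have "(w \<ominus>\<^bsub>I t\<^esub> u) \<oplus>\<^bsub>I t\<^esub> (u \<ominus>\<^bsub>I t\<^esub> v) = w \<ominus>\<^bsub>I t\<^esub> v"
        using diff_add_cancel(1)[OF wc uc] wc uc vc by (simp add: a_minus_def I.a_assoc[symmetric])
      ultimately show "\<exists>w'\<in>cycles t (adjoin K a) j. w \<ominus>\<^bsub>I t\<^esub> w' \<in> boundaries t X j"
        using v(1) by auto
    qed
  qed
  then show ?thesis using ann by blast
qed

section \<open>Concentration in one degree\<close>

text \<open>The generator \<open>w\<close> identifies \<open>Ext(A/X, A)\<close> with \<open>A/X\<close>, and \<open>Ext_inclusion\<close> embeds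
  \<open>Ext(A\<^sub>0/X\<^sub>0, A(i))\<close> into it, as elements of degree \<open>i\<close> killed by everything of nonzero degree.\<close>

lemma Ext_socle:
  assumes X: "regular_ideal t X" and w: "Ext_generator t X w"
    and "\<not> Ext_zero t (degree_zero_in X) i"
  obtains u where "u \<in> component A i" "u \<notin> X"
    "\<And>b s. \<lbrakk>b \<in> component A s; s \<noteq> 0\<rbrakk> \<Longrightarrow> u \<otimes> b \<in> X"
proof -
  have Xi: "gr_ideal X" using regular_ideal_ideal(1)[OF X] .
  note Xs = gr_ideal_subset[OF Xi] and wD = Ext_generatorD[OF w]
  note XY = degree_zero_in_superset[OF Xi] and Y = gr_ideal_degree_zero_in_ideal[OF Xi]
  have wc: "w \<in> carrier (I t)" using cycles_carrier[OF wD(1)] .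
  obtain c where c: "c \<in> cycles t (degree_zero_in X) i" "c \<notin> boundaries t (degree_zero_in X) i"
    using assms(3) unfolding Ext_zero_def by blast
  have cX: "c \<in> cycles t X i" using c(1) cycles_antimono[OF XY] by blast
  have cn: "c \<notin> boundaries t X i" using c Ext_inclusion[OF X Y XY] by blast
  have cc: "c \<in> carrier (I t)" using cycles_carrier[OF cX] .
  obtain u where u: "u \<in> component A i" "c \<ominus>\<^bsub>I t\<^esub> u \<odot>\<^bsub>I t\<^esub> w \<in> boundaries t X i"
    using wD(2)[OF cX] by blast
  have uc: "u \<in> carrier A" using component_carrier[OF u(1)] .
  have uw: "u \<odot>\<^bsub>I t\<^esub> w \<in> carrier (I t)" by (rule I.act_closed[OF uc wc])
  have "u \<notin> X"
  proof
    assume "u \<in> X"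
    then have "u \<odot>\<^bsub>I t\<^esub> w \<in> boundaries t X i"
      using torsionD[OF cycles_torsion[OF wD(1)]] boundaries_zero[OF Xs] by simp
    then show False using boundaries_cong[OF Xs cc uw u(2)] cn by simp
  qed
  moreover have "u \<otimes> b \<in> X" if b: "b \<in> component A s" "s \<noteq> 0" for b s
  proof -
    have bc: "b \<in> carrier A" using component_carrier[OF b(1)] .
    have "b \<in> degree_zero_in X"
      using degree_zero_in_homogeneous[OF b(1) gr_ideal_zero[OF Xi]] b(2) by simp
    then have "b \<odot>\<^bsub>I t\<^esub> c = \<zero>\<^bsub>I t\<^esub>" by (rule torsionD[OF cycles_torsion[OF c(1)]])
    then have "b \<odot>\<^bsub>I t\<^esub> c \<in> boundaries t X (i + s)" using boundaries_zero[OF Xs] by simp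
    moreover have "b \<odot>\<^bsub>I t\<^esub> c \<ominus>\<^bsub>I t\<^esub> b \<odot>\<^bsub>I t\<^esub> (u \<odot>\<^bsub>I t\<^esub> w) \<in> boundaries t X (i + s)"
      using boundaries_act[OF Xs u(2) b(1)] act_diff[OF bc cc uw] by simp
    ultimately have "b \<odot>\<^bsub>I t\<^esub> (u \<odot>\<^bsub>I t\<^esub> w) \<in> boundaries t X (i + s)"
      using boundaries_cong[OF Xs I.act_closed[OF bc cc] I.act_closed[OF bc uw]] by blast
    then show ?thesis
      using wD(3)[OF component_mult[OF u(1) b(1)]] I.act_assoc[OF uc bc wc] by simp
  qed
  ultimately show thesis using that u(1) by blast
qed

text \<open>The ring \<open>A/X\<close> is self-injective. If its socle had elements \<open>u\<close>, \<open>v\<close> in two different degrees,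
  the projection of \<open>uA + vA\<close> onto \<open>uA\<close> would be multiplication by some \<open>e\<close> of degree zero:
  \<open>u e = u\<close> and \<open>v e = 0\<close> modulo \<open>X\<close>. But \<open>e\<close> or \<open>1 - e\<close> is invertible.\<close>

lemma Ext_unique_degree:
  assumes X: "regular_ideal t X" and z: "z \<in> component A s" "colon X z = max_ideal"
    and ij: "i \<noteq> j"
    and Ei: "\<not> Ext_zero t (degree_zero_in X) i" and Ej: "\<not> Ext_zero t (degree_zero_in X) j"
  shows False
proof -
  have Xi: "gr_ideal X" using regular_ideal_ideal(1)[OF X] .
  note Xs = gr_ideal_subset[OF Xi]
  obtain w where w: "Ext_generator t X w" using Ext_regular_ideal[OF X] by blast
  note wD = Ext_generatorD[OF w]
  have wc: "w \<in> carrier (I t)" using cycles_carrier[OF wD(1)] .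
  obtain u where u: "u \<in> component A i" "u \<notin> X"
    and u_soc: "\<And>b s. \<lbrakk>b \<in> component A s; s \<noteq> 0\<rbrakk> \<Longrightarrow> u \<otimes> b \<in> X"
    using Ext_socle[OF X w Ei] by blast
  obtain v where v: "v \<in> component A j" "v \<notin> X"
    and v_soc: "\<And>b s. \<lbrakk>b \<in> component A s; s \<noteq> 0\<rbrakk> \<Longrightarrow> v \<otimes> b \<in> X"
    using Ext_socle[OF X w Ej] by blast
  note uc = component_carrier[OF u(1)] and vc = component_carrier[OF v(1)]
  define J where "J = adjoin X v"
  have J: "gr_ideal J" unfolding J_def by (rule gr_ideal_adjoin[OF Xi v(1)])
  have XJ: "X \<subseteq> J" unfolding J_def by (rule adjoin_superset[OF Xi vc])
  define K where "K = colon J u"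
  have K: "gr_ideal K" unfolding K_def by (rule gr_ideal_colon[OF J u(1)])
  have XK: "X \<subseteq> K" unfolding K_def using colon_superset[OF J uc] XJ by blast
  \<comment> \<open>\<open>uA\<close> and \<open>vA\<close> are concentrated in the different degrees \<open>i\<close> and \<open>j\<close> modulo \<open>X\<close>, so they meet in zero.\<close>
  have K_ann: "u \<otimes> r \<in> X" if r: "r \<in> K" "r \<in> component A p" for r p
  proof (cases "p = 0")
    case False
    then show ?thesis using u_soc r(2) by blast
  next
    case True
    have rc: "r \<in> carrier A" using component_carrier[OF r(2)] .
    have "u \<otimes> r \<in> J" using r(1) unfolding K_def colon_def by blast
    then obtain y q where yq: "y \<in> X" "q \<in> carrier A" "u \<otimes> r = y \<oplus> v \<otimes> q"
      unfolding J_def adjoin_def by blast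
    have yc: "y \<in> carrier A" using gr_ideal_carrier[OF Xi yq(1)] .
    have "u \<otimes> r \<in> component A i" using component_mult[OF u(1) r(2)] True by simp
    then have "u \<otimes> r = hpart A (u \<otimes> r) i" using hpart_homogeneous[of "u \<otimes> r" i] by simp
    also have "\<dots> = hpart A y i \<oplus> v \<otimes> hpart A q (i - j)"
      unfolding yq(3) using yc yq(2) vc by (simp add: hpart_add hpart_mult_homogeneous[OF v(1)])
    finally show ?thesis
      using gr_ideal_add[OF Xi gr_ideal_hpart[OF Xi yq(1)] v_soc[OF hpart_component[OF yq(2)]]] ij
      by simp
  qed
  have uw: "u \<odot>\<^bsub>I t\<^esub> w \<in> cycles t X i" using cycles_act[OF Xs wD(1) u(1)] by simp
  have uwc: "u \<odot>\<^bsub>I t\<^esub> w \<in> carrier (I t)" using cycles_carrier[OF uw] .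
  have "\<exists>w'\<in>cycles t K i. u \<odot>\<^bsub>I t\<^esub> w \<ominus>\<^bsub>I t\<^esub> w' \<in> boundaries t X i"
  proof (rule Ext_torsion[OF X K XK uw])
    fix r p assume r: "r \<in> K" "r \<in> component A p"
    have "r \<odot>\<^bsub>I t\<^esub> (u \<odot>\<^bsub>I t\<^esub> w) = (u \<otimes> r) \<odot>\<^bsub>I t\<^esub> w"
      using I.act_assoc[OF uc component_carrier[OF r(2)] wc] by simp
    also have "\<dots> = \<zero>\<^bsub>I t\<^esub>" by (rule torsionD[OF cycles_torsion[OF wD(1)] K_ann[OF r]])
    finally show "r \<odot>\<^bsub>I t\<^esub> (u \<odot>\<^bsub>I t\<^esub> w) \<in> boundaries t X (i + p)" using boundaries_zero[OF Xs] by simp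
  qed
  then obtain w' where w': "w' \<in> cycles t K i" "u \<odot>\<^bsub>I t\<^esub> w \<ominus>\<^bsub>I t\<^esub> w' \<in> boundaries t X i" by blast
  \<comment> \<open>Self-injectivity: the map \<open>u \<mapsto> u\<close>, \<open>v \<mapsto> 0\<close> extends to \<open>A/X\<close>; the image of \<open>1\<close> is \<open>y\<close>.\<close>
  have "\<exists>y\<in>cycles t J 0. u \<odot>\<^bsub>I t\<^esub> y = w'"
  proof (rule cycles_lift[OF J u(1)])
    show "w' \<in> cycles t (colon J u) (0 + i)" using w'(1) unfolding K_def by simp
    show "Ext_zero (Suc t) (adjoin J u) 0"
      by (rule Ext_zero_above[OF X z _ gr_ideal_adjoin[OF J u(1)]]) simp
  qed
  then obtain y where y: "y \<in> cycles t J 0" "u \<odot>\<^bsub>I t\<^esub> y = w'" by blast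
  have yX: "y \<in> cycles t X 0" using y(1) cycles_antimono[OF XJ] by blast
  have yc: "y \<in> carrier (I t)" using cycles_carrier[OF yX] .
  obtain e where e: "e \<in> component A 0" "y \<ominus>\<^bsub>I t\<^esub> e \<odot>\<^bsub>I t\<^esub> w \<in> boundaries t X 0"
    using wD(2)[OF yX] by blast
  have ec: "e \<in> carrier A" using component_carrier[OF e(1)] .
  have ew: "e \<odot>\<^bsub>I t\<^esub> w \<in> carrier (I t)" by (rule I.act_closed[OF ec wc])
  have b_cong: "b \<odot>\<^bsub>I t\<^esub> y \<ominus>\<^bsub>I t\<^esub> (e \<otimes> b) \<odot>\<^bsub>I t\<^esub> w \<in> boundaries t X p" if b: "b \<in> component A p" for b p
    using boundaries_act[OF Xs e(2) b] act_diff[OF component_carrier[OF b] yc ew]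
      I.act_assoc[OF ec component_carrier[OF b] wc] by simp
  have ve: "e \<otimes> v \<in> X"
  proof -
    have "v \<odot>\<^bsub>I t\<^esub> y = \<zero>\<^bsub>I t\<^esub>"
      using torsionD[OF cycles_torsion[OF y(1)]] adjoin_mem[OF Xi vc] unfolding J_def by blast
    then have "(e \<otimes> v) \<odot>\<^bsub>I t\<^esub> w \<in> boundaries t X j"
      using boundaries_cong[OF Xs I.act_closed[OF vc yc] I.act_closed[OF m_closed[OF ec vc] wc]
          b_cong[OF v(1)]] boundaries_zero[OF Xs] by simp
    moreover have "e \<otimes> v \<in> component A j" using component_mult[OF e(1) v(1)] by simp
    ultimately show ?thesis by (intro wD(3))
  qed
  have ue: "u \<ominus> e \<otimes> u \<in> X"
  proof -
    have w'c: "w' \<in> carrier (I t)" using cycles_carrier[OF w'(1)] .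
    have euw: "(e \<otimes> u) \<odot>\<^bsub>I t\<^esub> w \<in> carrier (I t)" by (rule I.act_closed[OF m_closed[OF ec uc] wc])
    have "(u \<odot>\<^bsub>I t\<^esub> w \<ominus>\<^bsub>I t\<^esub> w') \<oplus>\<^bsub>I t\<^esub> (w' \<ominus>\<^bsub>I t\<^esub> (e \<otimes> u) \<odot>\<^bsub>I t\<^esub> w) \<in> boundaries t X i"
      using boundaries_add[OF Xs w'(2)] b_cong[OF u(1)] y(2) by simp
    moreover have "(u \<odot>\<^bsub>I t\<^esub> w \<ominus>\<^bsub>I t\<^esub> w') \<oplus>\<^bsub>I t\<^esub> (w' \<ominus>\<^bsub>I t\<^esub> (e \<otimes> u) \<odot>\<^bsub>I t\<^esub> w)
        = u \<odot>\<^bsub>I t\<^esub> w \<ominus>\<^bsub>I t\<^esub> (e \<otimes> u) \<odot>\<^bsub>I t\<^esub> w"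
      using diff_add_cancel(1)[OF uwc w'c] uwc w'c euw
      by (simp add: a_minus_def I.a_assoc[symmetric])
    ultimately have "(u \<ominus> e \<otimes> u) \<odot>\<^bsub>I t\<^esub> w \<in> boundaries t X i"
      using act_diff_scalar[OF uc m_closed[OF ec uc] wc] by simp
    moreover have "u \<ominus> e \<otimes> u \<in> component A i"
      using component_diff[OF u(1)] component_mult[OF e(1) u(1)] by simp
    ultimately show ?thesis by (intro wD(3))
  qed
  from local[OF e(1)] show False
  proof
    assume "\<exists>b\<in>component A 0. e \<otimes> b = \<one>"
    then obtain b where b: "b \<in> carrier A" "e \<otimes> b = \<one>" using component_carrier by blast
    have "(e \<otimes> v) \<otimes> b = (e \<otimes> b) \<otimes> v" using b(1) ec vc by (simp add: m_ac)
    then have "v \<in> X" using gr_ideal_mult[OF Xi ve b(1)] b(2) vc by simp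
    then show False using v(2) by blast
  next
    assume "\<exists>b\<in>component A 0. (\<one> \<ominus> e) \<otimes> b = \<one>"
    then obtain b where b: "b \<in> carrier A" "(\<one> \<ominus> e) \<otimes> b = \<one>" using component_carrier by blast
    have "u \<ominus> e \<otimes> u = (\<one> \<ominus> e) \<otimes> u" using ec uc by (simp add: minus_eq l_distr l_minus)
    then have "(u \<ominus> e \<otimes> u) \<otimes> b = ((\<one> \<ominus> e) \<otimes> b) \<otimes> u" using b(1) ec uc by (simp add: m_ac)
    then have "u \<in> X" using gr_ideal_mult[OF Xi ue b(1)] b(2) uc by simp
    then show False using u(2) by blast
  qed
qed

lemma degree_zero_in_adjoin:
  assumes X: "gr_ideal X" and x: "x \<in> component A 0"
  shows "degree_zero_in (adjoin X x) = adjoin (degree_zero_in X) x"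
proof
  note xc = component_carrier[OF x]
  have X': "gr_ideal (adjoin X x)" by (rule gr_ideal_adjoin[OF X x])
  show "adjoin (degree_zero_in X) x \<subseteq> degree_zero_in (adjoin X x)"
  proof (rule adjoin_least[OF gr_ideal_degree_zero_in_ideal[OF X']])
    show "degree_zero_in X \<subseteq> degree_zero_in (adjoin X x)"
      using adjoin_superset[OF X xc] unfolding degree_zero_in_def by blast
    show "x \<in> degree_zero_in (adjoin X x)"
      using degree_zero_in_superset[OF X'] adjoin_mem[OF X xc] by blast
  qed
  show "degree_zero_in (adjoin X x) \<subseteq> adjoin (degree_zero_in X) x"
  proof
    fix a assume "a \<in> degree_zero_in (adjoin X x)"
    then obtain u r where a: "a \<in> carrier A" "u \<in> X" "r \<in> carrier A" "hpart A a 0 = u \<oplus> x \<otimes> r"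
      unfolding degree_zero_in_def adjoin_def by blast
    have uc: "u \<in> carrier A" using gr_ideal_carrier[OF X a(2)] .
    have c: "a \<ominus> x \<otimes> r \<in> carrier A" "x \<otimes> r \<in> carrier A" using a(1,3) xc by simp_all
    have a_eq: "a = (a \<ominus> x \<otimes> r) \<oplus> x \<otimes> r"
      using a(1) c(2) by (simp add: minus_eq a_assoc l_neg)
    have "hpart A a 0 = hpart A (a \<ominus> x \<otimes> r) 0 \<oplus> hpart A (x \<otimes> r) 0"
      using hpart_add[OF c, of 0] a_eq by simp
    moreover have "hpart A a 0 = hpart A u 0 \<oplus> hpart A (x \<otimes> r) 0"
    proof -
      have "hpart A (hpart A a 0) 0 = hpart A a 0"
        using hpart_homogeneous[OF hpart_component[OF a(1), of 0]] by simp
      then show ?thesis using a(4) hpart_add[OF uc c(2), of 0] by simp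
    qed
    ultimately have "hpart A (a \<ominus> x \<otimes> r) 0 = hpart A u 0"
      using hpart_carrier c uc by (metis add.right_cancel)
    then have "a \<ominus> x \<otimes> r \<in> degree_zero_in X"
      using c(1) gr_ideal_hpart[OF X a(2)] unfolding degree_zero_in_def by simp
    then show "a \<in> adjoin (degree_zero_in X) x"
      using a_eq a(3) unfolding adjoin_def by blast
  qed
qed

text \<open>Since \<open>x\<close> is regular on \<open>A/X\<close>, it is regular on the degree-zero part of \<open>A/X\<close>; if \<open>Ext\<close> of the
  quotient by \<open>x\<close> vanishes then \<open>x\<close> acts surjectively, and Nakayama's lemma applies.\<close>

lemma Ext_zero_descend:
  assumes "regular_ideal t X" "\<And>n. Ext_zero n (degree_zero_in X) j"
  shows "Ext_zero n (degree_zero_in {\<zero>}) j"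
  using assms
proof (induction arbitrary: n)
  case zero
  then show ?case .
next
  case (adjoin t X x)
  have X: "gr_ideal X" using regular_ideal_ideal(1)[OF adjoin.hyps(1)] .
  note x0 = nonunitsD(1)[OF adjoin.hyps(2)] and xc = nonunitsD(2)[OF adjoin.hyps(2)]
  let ?Y = "degree_zero_in X"
  have Y: "gr_ideal ?Y" by (rule gr_ideal_degree_zero_in_ideal[OF X])
  have col: "colon ?Y x = ?Y"
  proof -
    have "x \<otimes> hpart A r 0 \<in> X \<longleftrightarrow> hpart A r 0 \<in> X" if "r \<in> carrier A" for r
      using adjoin.hyps(3) hpart_carrier[OF that, of 0] unfolding colon_def by blast
    then show ?thesis
      using xc hpart_mult_homogeneous[OF x0] by (auto simp: colon_def degree_zero_in_def)
  qed
  have "Ext_zero n ?Y j" for n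
  proof (rule Ext_zero_if_onto[OF Y adjoin.hyps(2)])
    fix w assume w: "w \<in> cycles n ?Y j"
    show "\<exists>w'\<in>cycles n ?Y j. x \<odot>\<^bsub>I n\<^esub> w' = w"
    proof (rule cycles_lift[OF Y x0])
      show "w \<in> cycles n (colon ?Y x) (j + 0)" using w col by simp
      show "Ext_zero (Suc n) (adjoin ?Y x) j"
        using adjoin.prems unfolding degree_zero_in_adjoin[OF X x0] .
    qed
  qed
  then show ?case by (rule adjoin.IH)
qed

theorem Ext_degree_zero_concentrated:
  "\<exists>i. \<forall>j. j \<noteq> i \<longrightarrow> (\<forall>n. Ext_zero n (degree_zero_in {\<zero>}) j)"
proof -
  obtain t X z s where X: "regular_ideal t X" and z: "z \<in> component A s" "colon X z = max_ideal"
    using maximal_regular_ideal by metis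
  have Xi: "gr_ideal X" using regular_ideal_ideal(1)[OF X] .
  note Y = gr_ideal_degree_zero_in_ideal[OF Xi] and XY = degree_zero_in_superset[OF Xi]
  obtain i where i: "\<And>j. j \<noteq> i \<Longrightarrow> Ext_zero t (degree_zero_in X) j"
    using Ext_unique_degree[OF X z] by blast
  have "Ext_zero n (degree_zero_in X) j" if "j \<noteq> i" for n j
    using Ext_zero_above[OF X z _ Y] Ext_zero_below[OF X _ Y XY] i[OF that] by (cases n t rule: linorder_cases) auto
  then show ?thesis using Ext_zero_descend[OF X] by blast
qed

end

section \<open>Translation to the derived Hom functor\<close>

lemma (in graded_cring) gr_ideal_imp_ideal:
  assumes J: "gr_ideal J" shows "ideal J A"
proof (rule idealI[OF ring_axioms])
  show "subgroup J (add_monoid A)"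
    using gr_ideal_additive[OF J] unfolding additive_subgroup_def subgroup_def m_inv_def by simp
qed (use gr_ideal_mult[OF J] gr_ideal_mult_left[OF J] in auto)

lemma shift_simps [simp]:
  "carrier (shift M j) = carrier M" "\<zero>\<^bsub>shift M j\<^esub> = \<zero>\<^bsub>M\<^esub>" "add (shift M j) = add M"
  "smult (shift M j) = smult M" "component (shift M j) i = component M (i + j)"
  by (simp_all add: shift_def)

lemma gr_hom_shift: "f \<in> gr_hom A M N \<Longrightarrow> f \<in> gr_hom A (shift M j) (shift N j)"
  by (simp add: gr_hom_def)

lemma gr_hom_shift_right:
  assumes "f \<in> gr_hom A M (shift N j)" shows "f \<in> gr_hom A (shift M (- j)) N"
proof -
  have "f x \<in> component N i" if "x \<in> component M (i + - j)" for x i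
  proof -
    have "f x \<in> component (shift N j) (i + - j)" using assms that unfolding gr_hom_def by blast
    then show ?thesis by simp
  qed
  then show ?thesis using assms unfolding gr_hom_def by simp
qed

lemma gr_hom_shift_left:
  assumes "f \<in> gr_hom A (shift M (- j)) N" shows "f \<in> gr_hom A M (shift N j)"
proof -
  have "f x \<in> component N (i + j)" if "x \<in> component M i" for x i
  proof -
    have "x \<in> component (shift M (- j)) (i + j)" using that by simp
    then show ?thesis using assms unfolding gr_hom_def by blast
  qed
  then show ?thesis using assms unfolding gr_hom_def by simp
qed

text \<open>A lifting problem for the shifted module becomes one for \<open>I\<close> by shifting back the other two
  modules.\<close>

lemma gr_injective_shift:
  fixes A :: "('k, 'a, 'e) graded_module_scheme"
  assumes I: "gr_injective A I" shows "gr_injective A (shift I j)"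
  unfolding gr_injective_def
proof (intro conjI allI impI)
  show "graded_right_module A (shift I j)"
    using graded_right_module_shift I unfolding gr_injective_def by blast
  fix X Y :: "('a, 'a) graded_module" and f g
  assume XY: "graded_right_module A X" "graded_right_module A Y"
    and f: "f \<in> gr_hom A X Y" "inj_on f (carrier X)" and g: "g \<in> gr_hom A X (shift I j)"
  have "\<exists>h\<in>gr_hom A (shift Y (- j)) I. \<forall>x\<in>carrier (shift X (- j)). h (f x) = g x"
    by (rule gr_injective_extends[OF I graded_right_module_shift[OF XY(1)]
          graded_right_module_shift[OF XY(2)] gr_hom_shift[OF f(1)] _ gr_hom_shift_right[OF g]])
      (use f(2) in simp)
  then obtain h where "h \<in> gr_hom A (shift Y (- j)) I" "\<forall>x\<in>carrier X. h (f x) = g x" by auto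
  then show "\<exists>h\<in>gr_hom A Y (shift I j). \<forall>x\<in>carrier X. h (f x) = g x"
    using gr_hom_shift_left[of h A Y j I] by blast
qed

lemma injective_resolution_shift:
  assumes "injective_resolution A N I d e"
  shows "injective_resolution A (shift N j) (\<lambda>n. shift (I n) j) d e"
  unfolding injective_resolution_def shift_simps
proof (intro conjI allI)
  note res = assms[unfolded injective_resolution_def]
  show "gr_injective A (shift (I n) j)" for n using res by (intro gr_injective_shift) blast
  show "d n \<in> gr_hom A (shift (I n) j) (shift (I (Suc n)) j)" for n
    using res by (intro gr_hom_shift) blast
  show "e \<in> gr_hom A (shift N j) (shift (I 0) j)" using res by (intro gr_hom_shift) blast
qed (use assms in \<open>simp_all add: injective_resolution_def\<close>)

context local_graded_cring
begin

lemma positive_part_eq: "positive_part A = degree_zero_in {\<zero>}"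
proof -
  have "hpart A x i = \<zero>" if "x \<in> carrier A" "i < 0" for x i
    using hpart_component[OF that(1), of i] outside[of i] that(2) by simp
  then show ?thesis
    unfolding positive_part_def degree_zero_in_def by (auto simp: order_le_less)
qed

lemma gr_ideal_positive_part: "gr_ideal (positive_part A)"
  unfolding positive_part_eq by (rule gr_ideal_degree_zero_in_ideal[OF gr_ideal_zero_ideal])

lemma ideal_positive_part: "ideal (positive_part A) A"
  by (rule gr_ideal_imp_ideal[OF gr_ideal_positive_part])

lemma degree_zero_module_simps:
  "carrier (degree_zero_module A) = (\<lambda>a. positive_part A +> a) ` carrier A"
  "component (degree_zero_module A) i = (\<lambda>a. positive_part A +> a) ` component A i"
  "\<lbrakk>a \<in> carrier A; b \<in> carrier A\<rbrakk> \<Longrightarrow>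
     (positive_part A +> a) \<oplus>\<^bsub>degree_zero_module A\<^esub> (positive_part A +> b) = positive_part A +> (a \<oplus> b)"
  "\<lbrakk>a \<in> carrier A; b \<in> carrier A\<rbrakk> \<Longrightarrow>
     a \<odot>\<^bsub>degree_zero_module A\<^esub> (positive_part A +> b) = positive_part A +> (b \<otimes> a)"
  using ring_hom_add[OF ideal.rcos_ring_hom[OF ideal_positive_part], of a b]
    ring_hom_mult[OF ideal.rcos_ring_hom[OF ideal_positive_part], of b a]
  by (auto simp: degree_zero_module_def Let_def FactRing_def A_RCOSETS_def')

end

context finite_injective_resolution
begin

text \<open>A homomorphism from \<open>A\<^sub>0\<close> is determined by the image of \<open>1\<close>, which can be any element of
  the right degree annihilated by \<open>positive_part A\<close>.\<close>

lemma hom_degree_zero_module_torsion: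
  assumes f: "f \<in> gr_hom A (degree_zero_module A) (shift (I n) j)"
  defines "y \<equiv> f (positive_part A +> \<one>)"
  shows "y \<in> torsion n (positive_part A) j"
    and "a \<in> carrier A \<Longrightarrow> f (positive_part A +> a) = a \<odot>\<^bsub>I n\<^esub> y"
proof -
  let ?P = "positive_part A" and ?M = "degree_zero_module A"
  have one: "?P +> \<one> \<in> component ?M 0" "?P +> \<one> \<in> carrier ?M"
    using one_component one_closed unfolding degree_zero_module_simps by blast+
  have "y \<in> component (shift (I n) j) 0"
    using f one(1) unfolding gr_hom_def y_def by blast
  then have y: "y \<in> component (I n) j" by simp
  have act: "f (?P +> a) = a \<odot>\<^bsub>I n\<^esub> y" if a: "a \<in> carrier A" for a
  proof -
    have "f (a \<odot>\<^bsub>?M\<^esub> (?P +> \<one>)) = a \<odot>\<^bsub>I n\<^esub> y"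
      using f a one(2) unfolding gr_hom_def y_def by auto
    then show ?thesis using a by (simp add: degree_zero_module_simps)
  qed
  then show "a \<in> carrier A \<Longrightarrow> f (?P +> a) = a \<odot>\<^bsub>I n\<^esub> y" .
  show "y \<in> torsion n ?P j"
  proof (rule torsionI[OF y])
    fix a assume a: "a \<in> ?P"
    have ac: "a \<in> carrier A" using gr_ideal_carrier[OF gr_ideal_positive_part a] .
    have "?P +> a = ?P +> \<zero>"
      using quotient_eq_iff_same_a_r_cos[OF ideal_positive_part ac zero_closed] a ac
      by (simp add: minus_eq)
    then have "a \<odot>\<^bsub>I n\<^esub> y = \<zero> \<odot>\<^bsub>I n\<^esub> y" using act[OF ac] act[OF zero_closed] by simp
    then show "a \<odot>\<^bsub>I n\<^esub> y = \<zero>\<^bsub>I n\<^esub>"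
      using I.act_minus_one(2) I.component_carrier[OF y] by simp
  qed
qed

lemma torsion_hom_degree_zero_module:
  assumes y: "y \<in> torsion n (positive_part A) j"
  obtains g where "g \<in> gr_hom A (degree_zero_module A) (shift (I n) j)"
    "\<And>a. a \<in> carrier A \<Longrightarrow> g (positive_part A +> a) = a \<odot>\<^bsub>I n\<^esub> y"
proof -
  let ?P = "positive_part A" and ?M = "degree_zero_module A"
  have yc: "y \<in> carrier (I n)" using torsion_carrier[OF y] .
  define g where "g X = (SOME a. a \<in> carrier A \<and> X = ?P +> a) \<odot>\<^bsub>I n\<^esub> y" for X
  have g: "g (?P +> a) = a \<odot>\<^bsub>I n\<^esub> y" if a: "a \<in> carrier A" for a
  proof -
    define b where "b = (SOME b. b \<in> carrier A \<and> ?P +> a = ?P +> b)"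
    have "b \<in> carrier A \<and> ?P +> a = ?P +> b"
      unfolding b_def by (rule someI[of _ a]) (use a in simp)
    then have b: "b \<in> carrier A" and ab: "?P +> a = ?P +> b" by blast+
    have "a \<ominus> b \<in> ?P"
      using quotient_eq_iff_same_a_r_cos[OF ideal_positive_part a b] ab by blast
    then have "a \<odot>\<^bsub>I n\<^esub> y \<ominus>\<^bsub>I n\<^esub> b \<odot>\<^bsub>I n\<^esub> y = \<zero>\<^bsub>I n\<^esub>"
      using torsionD[OF y] act_diff_scalar[OF a b yc] by simp
    then have "a \<odot>\<^bsub>I n\<^esub> y = b \<odot>\<^bsub>I n\<^esub> y"
      using diff_add_cancel(1)[OF I.act_closed[OF a yc] I.act_closed[OF b yc]] I.act_closed[OF b yc]
      by simp
    then show ?thesis unfolding g_def b_def by simp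
  qed
  have "g \<in> gr_hom A ?M (shift (I n) j)"
    unfolding gr_hom_def shift_simps degree_zero_module_simps(1,2)
  proof (intro CollectI conjI ballI allI funcsetI)
    show "g X \<in> carrier (I n)" if "X \<in> (\<lambda>a. ?P +> a) ` carrier A" for X
      using that g I.act_closed yc by auto
    show "g (X \<oplus>\<^bsub>?M\<^esub> Y) = g X \<oplus>\<^bsub>I n\<^esub> g Y"
      if "X \<in> (\<lambda>a. ?P +> a) ` carrier A" "Y \<in> (\<lambda>a. ?P +> a) ` carrier A" for X Y
      using that g yc by (auto simp: degree_zero_module_simps I.act_add_scalar)
    show "g (a \<odot>\<^bsub>?M\<^esub> X) = a \<odot>\<^bsub>I n\<^esub> g X" if "a \<in> carrier A" "X \<in> (\<lambda>a. ?P +> a) ` carrier A" for a X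
      using that g yc by (auto simp: degree_zero_module_simps I.act_assoc)
    show "g X \<in> component (I n) (i + j)" if "X \<in> (\<lambda>a. ?P +> a) ` component A i" for X i
    proof -
      from that obtain a where a: "a \<in> component A i" "X = ?P +> a" by blast
      then show ?thesis
        using g[OF component_carrier[OF a(1)]] I.act_component[OF a(1) torsion_component[OF y]]
        by (simp add: add.commute)
    qed
  qed
  then show thesis using g that by blast
qed

lemma hom_complex_acyclic_degree_zero_module:
  assumes E: "\<And>n. Ext_zero n (positive_part A) j"
  shows "hom_complex_acyclic A (degree_zero_module A) (\<lambda>n. shift (I n) j) d"
proof -
  let ?P = "positive_part A" and ?M = "degree_zero_module A"
  have one: "?P +> \<one> \<in> carrier ?M" using one_closed unfolding degree_zero_module_simps by blast
  have cycle: "f (?P +> \<one>) \<in> boundaries n ?P j"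
    if f: "f \<in> gr_hom A ?M (shift (I n) j)" and df: "\<And>x. x \<in> carrier ?M \<Longrightarrow> d n (f x) = \<zero>\<^bsub>I (Suc n)\<^esub>"
    for f n
    using hom_degree_zero_module_torsion(1)[OF f] df[OF one] E[of n]
    unfolding Ext_zero_def cycles_def by blast
  show ?thesis
    unfolding hom_complex_acyclic_def shift_simps
  proof (intro conjI allI ballI impI)
    fix f x
    assume f: "f \<in> gr_hom A ?M (shift (I 0) j)" and df: "\<forall>x\<in>carrier ?M. d 0 (f x) = \<zero>\<^bsub>I 1\<^esub>"
      and x: "x \<in> carrier ?M"
    obtain a where a: "a \<in> carrier A" "x = ?P +> a" using x unfolding degree_zero_module_simps by blast
    have "f (?P +> \<one>) = \<zero>\<^bsub>I 0\<^esub>" using cycle[OF f] df by (simp add: boundaries_0)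
    then show "f x = \<zero>\<^bsub>I 0\<^esub>"
      using hom_degree_zero_module_torsion(2)[OF f a(1)] act_zero[OF a(1)] a(2) by simp
  next
    fix n f
    assume f: "f \<in> gr_hom A ?M (shift (I (Suc n)) j)"
      and df: "\<forall>x\<in>carrier ?M. d (Suc n) (f x) = \<zero>\<^bsub>I (Suc (Suc n))\<^esub>"
    obtain y where y: "y \<in> torsion n ?P j" "f (?P +> \<one>) = d n y"
      using cycle[OF f] df by (auto simp: boundaries_Suc)
    obtain g where g: "g \<in> gr_hom A ?M (shift (I n) j)"
      "\<And>a. a \<in> carrier A \<Longrightarrow> g (?P +> a) = a \<odot>\<^bsub>I n\<^esub> y"
      using torsion_hom_degree_zero_module[OF y(1)] by blast
    have "f x = d n (g x)" if x: "x \<in> carrier ?M" for x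
    proof -
      obtain a where a: "a \<in> carrier A" "x = ?P +> a"
        using x unfolding degree_zero_module_simps by blast
      then show ?thesis
        using hom_degree_zero_module_torsion(2)[OF f a(1)] g(2)[OF a(1)] y(2)
          d_act[OF a(1) torsion_carrier[OF y(1)]] by simp
    qed
    then show "\<exists>g\<in>gr_hom A ?M (shift (I n) j). \<forall>x\<in>carrier ?M. f x = d n (g x)" using g(1) by blast
  qed
qed

end

theorem (in local_graded_cring) right_hwg_if_finite_injective_dimension:
  assumes "finite_gr_injective_dimension TYPE('c) A (regular_module A)"
  shows "right_hwg TYPE('c) A"
proof -
  obtain I :: "nat \<Rightarrow> ('a, 'c) graded_module" and d e m
    where res: "injective_resolution A (regular_module A) I d e"
      and m: "\<And>n. m < n \<Longrightarrow> carrier (I n) = {\<zero>\<^bsub>I n\<^esub>}"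
    using assms unfolding finite_gr_injective_dimension_def by blast
  have r: "gr_injective A (I n)" "d n \<in> gr_hom A (I n) (I (Suc n))"
      "e \<in> gr_hom A (regular_module A) (I 0)" "inj_on e (carrier A)"
      "{x \<in> carrier (I 0). d 0 x = \<zero>\<^bsub>I 1\<^esub>} = e ` carrier A"
      "{x \<in> carrier (I (Suc n)). d (Suc n) x = \<zero>\<^bsub>I (Suc (Suc n))\<^esub>} = d n ` carrier (I n)" for n
    using res unfolding injective_resolution_def by simp_all
  interpret finite_injective_resolution A l I d e m
  proof unfold_locales
    show "d (Suc n) (d n x) = \<zero>\<^bsub>I (Suc (Suc n))\<^esub>" if "x \<in> carrier (I n)" for x n
      using r(6)[of n] that by blast
  qed (fact r m)+
  obtain i where i: "\<And>j n. j \<noteq> i \<Longrightarrow> Ext_zero n (positive_part A) j"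
    using Ext_degree_zero_concentrated unfolding positive_part_eq by blast
  have "RHom_zero TYPE('c) A (degree_zero_module A) (shift (regular_module A) j)" if "j \<noteq> i" for j
    unfolding RHom_zero_def
    using injective_resolution_shift[OF res] hom_complex_acyclic_degree_zero_module[OF i[OF that]]
    by blast
  then show ?thesis unfolding right_hwg_def by blast
qed

section \<open>Commutative local algebras and their opposites\<close>

lemma (in cring) ideal_subset_maximalideal:
  assumes J: "ideal J R" "\<one> \<notin> J"
  shows "\<exists>m. maximalideal m R \<and> J \<subseteq> m"
proof -
  let ?S = "{K. ideal K R \<and> J \<subseteq> K \<and> \<one> \<notin> K}"
  have "\<exists>M\<in>?S. \<forall>K\<in>?S. M \<subseteq> K \<longrightarrow> K = M"
  proof (rule subset_Zorn_nonempty)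
    show "?S \<noteq> {}" using J by blast
    fix C assume C: "C \<noteq> {}" "subset.chain ?S C"
    then have "subset.chain {K. ideal K R} C" unfolding subset.chain_def by blast
    then have "ideal (\<Union>C) R" using chain_Union_is_ideal[of C] C(1) by simp
    then show "\<Union>C \<in> ?S" using C unfolding subset.chain_def by blast
  qed
  then obtain M where "M \<in> ?S" and max: "\<forall>K\<in>?S. M \<subseteq> K \<longrightarrow> K = M" by (rule bexE)
  then have M: "ideal M R" "J \<subseteq> M" "\<one> \<notin> M" by simp_all
  have "maximalideal M R"
  proof (rule maximalidealI[OF M(1)])
    show "carrier R \<noteq> M" using M(3) by blast
    fix K assume K: "ideal K R" "M \<subseteq> K" "K \<subseteq> carrier R"
    show "K = M \<or> K = carrier R"
    proof (cases "\<one> \<in> K")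
      case True
      then show ?thesis using ideal.one_imp_carrier[OF K(1)] by blast
    next
      case False
      then have "K \<in> ?S" using K M(2) by blast
      then show ?thesis using max K(2) by blast
    qed
  qed
  then show ?thesis using M(2) by blast
qed

text \<open>Two nonunits whose sum is \<open>1\<close> would lie in the unique maximal ideal together.\<close>

lemma local_ring_unit:
  fixes R (structure)
  assumes R: "local_ring R" and a: "a \<in> carrier R"
  shows "(\<exists>b\<in>carrier R. a \<otimes> b = \<one>) \<or> (\<exists>b\<in>carrier R. (\<one> \<ominus> a) \<otimes> b = \<one>)"
proof (rule ccontr)
  interpret cring R using R unfolding local_ring_def by blast
  assume no: "\<not> ?thesis"
  have max: "\<exists>m. maximalideal m R \<and> x \<in> m"
    if x: "x \<in> carrier R" "\<forall>b\<in>carrier R. x \<otimes> b \<noteq> \<one>" for x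
  proof -
    have "\<one> \<notin> PIdl x"
      using x m_comm unfolding cgenideal_def by force
    then show ?thesis
      using ideal_subset_maximalideal[OF cgenideal_ideal[OF x(1)]] cgenideal_self[OF x(1)] by blast
  qed
  have na: "\<forall>b\<in>carrier R. a \<otimes> b \<noteq> \<one>" and n1: "\<forall>b\<in>carrier R. (\<one> \<ominus> a) \<otimes> b \<noteq> \<one>"
    using no by blast+
  obtain m where m: "maximalideal m R" "a \<in> m" using max[OF a na] by blast
  obtain m' where m': "maximalideal m' R" "\<one> \<ominus> a \<in> m'" using max[of "\<one> \<ominus> a"] a n1 by auto
  have "m' = m" using R m(1) m'(1) unfolding local_ring_def by blast
  interpret m: maximalideal m R by fact
  have "\<one> \<ominus> a \<oplus> a \<in> m" using m(2) m'(2) \<open>m' = m\<close> m.a_closed by blast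
  moreover have "\<one> \<ominus> a \<oplus> a = \<one>" using a by (simp add: minus_eq a_assoc l_neg)
  ultimately show False using m.one_imp_carrier m.I_notcarr by simp
qed

lemma local_ring_one_neq_zero:
  fixes R (structure)
  assumes R: "local_ring R" shows "\<one> \<noteq> \<zero>"
proof
  interpret cring R using R unfolding local_ring_def by blast
  assume eq: "\<one> = \<zero>"
  obtain m where "maximalideal m R" using R unfolding local_ring_def by blast
  then interpret m: maximalideal m R .
  show False using m.one_imp_carrier m.I_notcarr m.zero_closed eq by simp
qed

lemma local_graded_cringI:
  fixes A :: "('k, 'a, 'e) graded_module_scheme"
  assumes fin: "finitely_graded_algebra k A l" and loc: "local_ring A"
    and noeth: "gr_noetherian A (regular_module A)"
  shows "local_graded_cring A (int l)"
proof -
  interpret finitely_graded_algebra k A l by fact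
  interpret cring A using loc unfolding local_ring_def by blast
  interpret graded_cring A by unfold_locales
  have inverse: "\<exists>b\<in>component A 0. a \<otimes>\<^bsub>A\<^esub> b = \<one>\<^bsub>A\<^esub>"
    if "a \<in> component A 0" "b \<in> carrier A" "a \<otimes>\<^bsub>A\<^esub> b = \<one>\<^bsub>A\<^esub>" for a b
    using hpart_mult_homogeneous[OF that(1,2), of 0] that(3) hpart_homogeneous[OF one_component]
      hpart_component[OF that(2), of 0] by auto
  show ?thesis
  proof
    fix a assume a: "a \<in> component A 0"
    then show "(\<exists>b\<in>component A 0. a \<otimes>\<^bsub>A\<^esub> b = \<one>\<^bsub>A\<^esub>) \<or>
        (\<exists>b\<in>component A 0. (\<one>\<^bsub>A\<^esub> \<ominus>\<^bsub>A\<^esub> a) \<otimes>\<^bsub>A\<^esub> b = \<one>\<^bsub>A\<^esub>)"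
      using local_ring_unit[OF loc component_carrier[OF a]] inverse
        component_diff[OF one_component a] by blast
  qed (use noeth component_outside local_ring_one_neq_zero[OF loc] in auto)
qed

lemma opposite_simps [simp]:
  "carrier (opposite A) = carrier A" "\<zero>\<^bsub>opposite A\<^esub> = \<zero>\<^bsub>A\<^esub>" "\<one>\<^bsub>opposite A\<^esub> = \<one>\<^bsub>A\<^esub>"
  "add (opposite A) = add A" "component (opposite A) = component A"
  "x \<otimes>\<^bsub>opposite A\<^esub> y = y \<otimes>\<^bsub>A\<^esub> x"
  by (simp_all add: opposite_def)

lemma local_graded_cring_opposite:
  fixes A :: "('k, 'a, 'e) graded_module_scheme"
  assumes "local_graded_cring A l" and noeth: "gr_noetherian (opposite A) (regular_module (opposite A))"
  shows "local_graded_cring (opposite A) l"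
proof -
  interpret local_graded_cring A l by fact
  have fs: "finsum (opposite A) c S = finsum A c S" for c and S :: "int set"
    unfolding finsum_def by simp
  have ab: "abelian_group (opposite A)"
    by (rule abelian_groupI) (auto simp: a_assoc a_comm a_lcomm intro: l_neg)
  interpret op: abelian_group "opposite A" by (rule ab)
  have neg: "\<ominus>\<^bsub>opposite A\<^esub> x = \<ominus>\<^bsub>A\<^esub> x" for x
    unfolding a_inv_def by simp
  have cr: "cring (opposite A)"
    by (rule cringI[OF ab]) (auto intro!: comm_monoidI simp: m_ac r_distr)
  interpret op: cring "opposite A" by (rule cr)
  interpret op: graded_group "opposite A"
  proof (intro graded_group.intro graded_group_axioms.intro ab)
    show "additive_subgroup (component (opposite A) i) (opposite A)" for i
      using component_subgroup[of i] unfolding additive_subgroup_def by simp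
    show "\<exists>!c. homogeneous_decomposition (opposite A) x c" if "x \<in> carrier (opposite A)" for x
      using that unique_decomposition[of x] fs unfolding homogeneous_decomposition_def by simp
  qed
  show ?thesis
  proof
    show "a \<otimes>\<^bsub>opposite A\<^esub> b \<in> component (opposite A) (i + j)"
      if "a \<in> component (opposite A) i" "b \<in> component (opposite A) j" for a b i j
      using component_mult[of b j a i] that by (simp add: add.commute)
    show "(\<exists>b\<in>component (opposite A) 0. a \<otimes>\<^bsub>opposite A\<^esub> b = \<one>\<^bsub>opposite A\<^esub>) \<or>
        (\<exists>b\<in>component (opposite A) 0. (\<one>\<^bsub>opposite A\<^esub> \<ominus>\<^bsub>opposite A\<^esub> a) \<otimes>\<^bsub>opposite A\<^esub> b = \<one>\<^bsub>opposite A\<^esub>)"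
      if a: "a \<in> component (opposite A) 0" for a
    proof -
      have ac: "a \<in> carrier A" using component_carrier a by simp
      have comm: "b \<otimes>\<^bsub>A\<^esub> x = x \<otimes>\<^bsub>A\<^esub> b" if "b \<in> component A 0" "x \<in> carrier A" for b x
        using m_comm component_carrier that by blast
      have "\<one>\<^bsub>opposite A\<^esub> \<ominus>\<^bsub>opposite A\<^esub> a = \<one>\<^bsub>A\<^esub> \<ominus>\<^bsub>A\<^esub> a" by (simp add: a_minus_def neg)
      then show ?thesis
        using local[of a] a comm[OF _ ac] comm[of _ "\<one>\<^bsub>A\<^esub> \<ominus>\<^bsub>A\<^esub> a"] ac by auto
    qed
  qed (use noeth one_component outside one_neq_zero in simp_all)
qed

theorem theorem1p4:
  fixes k :: "'k ring" and A :: "('k, 'a) graded_module" and l :: nat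
  assumes "finitely_graded_algebra k A l"
    and "local_ring A"
    and "iwanaga_gorenstein TYPE('c) A"
  shows "hwg TYPE('c) A"
proof -
  have IG: "gr_noetherian A (regular_module A)"
    "gr_noetherian (opposite A) (regular_module (opposite A))"
    "finite_gr_injective_dimension TYPE('c) A (regular_module A)"
    "finite_gr_injective_dimension TYPE('c) (opposite A) (regular_module (opposite A))"
    using assms(3) unfolding iwanaga_gorenstein_def by simp_all
  have A: "local_graded_cring A (int l)"
    using local_graded_cringI[OF assms(1,2) IG(1)] .
  have op: "local_graded_cring (opposite A) (int l)"
    using local_graded_cring_opposite[OF A IG(2)] .
  show ?thesis
    unfolding hwg_def
    using local_graded_cring.right_hwg_if_finite_injective_dimension[OF A IG(3)]
      local_graded_cring.right_hwg_if_finite_injective_dimension[OF op IG(4)] by blast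
qed

end
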